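(* Let $r\ge1$, let $N$ be a non-negative integer, and let $a,b_1,\dots,b_r,x_1,\dots,x_r$ be generic nonzero complex parameters. Then $$\sum_{\substack{k_1,\dots,k_r\ge0\\ 2|\mathbf k|\le N}}\frac{\Delta(\mathbf xq^{3\mathbf k};p)}{\Delta(\mathbf x;p)}q^{|\mathbf k|-2e_2(\mathbf k)}\prod_{1\le i<j\le r}\frac1{(a^2x_ix_jq^{N+1};q^3,p)_{k_i+k_j}}$$ $$\times\prod_{i=1}^r\left(\frac{\theta(ax_iq^{|\mathbf k|+3k_i};p)}{\theta(ax_i;p)}\frac{(ax_i;q,p)_{|\mathbf k|}\,(q^{-N}/ax_i;q,p)_{|\mathbf k|-k_i}}{(aq/b_i,b_iq^{-N}/a;q,p)_{|\mathbf k|}\,(q^{k_i-|\mathbf k|+N+1}ax_i;q,p)_{2k_i}}\right)$$ $$\times\frac{(q^{N+1};q,p)_{|\mathbf k|}\,(q^{-N};q,p)_{2|\mathbf k|}}{\prod_{i=1}^r(ax_iq^{2-N};q^3,p)_{k_i}}\prod_{i,j=1}^r\frac{(b_jx_i,a^2x_iq^{N+1}/b_j;q^3,p)_{k_i}}{(q^3x_i/x_j;q^3,p)_{k_i}}$$ $$=\prod_{i=1}^r\frac{(ax_iq;q,p)_N\,(aq^{2-N}/b_i;q^3,p)_N}{(aq/b_i;q,p)_N\,(ax_iq^{2-N};q^3,p)_N}.$$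
   Context: $p,q$ are complex numbers with $|p|<1$, $q\ne0$, and $q^k\notin p^{\mathbb Z}$ for all integers $k>0$ (if $p=0$: $q^k\ne1$). For $x\ne0$, $\theta(x;p)=\prod_{j=0}^\infty(1-p^jx)(1-p^{j+1}/x)$. Elliptic shifted factorials: $(a;q,p)_k=\prod_{j=0}^{k-1}\theta(aq^j;p)$ for $k\in\mathbb Z_{\ge0}$ (similarly with base $q^3$), and $(a_1,\dots,a_m;q,p)_k=(a_1;q,p)_k\cdots(a_m;q,p)_k$. For $\mathbf k=(k_1,\dots,k_r)$, $|\mathbf k|=k_1+\cdots+k_r$ and $e_2(\mathbf k)=\sum_{1\le i<j\le r}k_ik_j$. For $\mathbf x=(x_1,\dots,x_r)$, $\Delta(\mathbf x;p)=\prod_{1\le i<j\le r}x_j\theta(x_i/x_j;p)$, and $\mathbf xq^{3\mathbf k}=(x_1q^{3k_1},\dots,x_rq^{3k_r})$. In expressions such as $q^{-N}/ax_i$, everything after the slash is in the denominator. All parameters are assumed generic so that no denominator vanishes. *)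

theory Defs
  imports "HOL-Analysis.Analysis"
begin

text \<open>Only used for \<open>norm p < 1\<close> and \<open>x \<noteq> 0\<close>, where the product converges (see below).\<close>

definition theta :: "complex \<Rightarrow> complex \<Rightarrow> complex" where
  "theta x p = (\<Prod>j. (1 - p ^ j * x) * (1 - p ^ (j + 1) / x))"

definition ell_fact :: "complex \<Rightarrow> complex \<Rightarrow> complex \<Rightarrow> nat \<Rightarrow> complex" where
  "ell_fact a q p k = (\<Prod>j<k. theta (a * q ^ j) p)"

text \<open>Tuples indexed by \<open>1, \<dots>, r\<close> are functions on \<open>nat\<close> of which only the values on \<open>{1..r}\<close> matter.\<close>

definition tsum :: "nat \<Rightarrow> (nat \<Rightarrow> nat) \<Rightarrow> nat" where
  "tsum r k = (\<Sum>i=1..r. k i)"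

definition e2 :: "nat \<Rightarrow> (nat \<Rightarrow> nat) \<Rightarrow> nat" where
  "e2 r k = (\<Sum>i=1..r. \<Sum>j=i+1..r. k i * k j)"

definition Delta :: "nat \<Rightarrow> (nat \<Rightarrow> complex) \<Rightarrow> complex \<Rightarrow> complex" where
  "Delta r x p = (\<Prod>i=1..r. \<Prod>j=i+1..r. x j * theta (x i / x j) p)"

text \<open>The summation range. Extensionality (\<open>\<rightarrow>\<^sub>E\<close>) makes each tuple occur exactly once.\<close>

definition sum_range :: "nat \<Rightarrow> nat \<Rightarrow> (nat \<Rightarrow> nat) set" where
  "sum_range r N = {k \<in> {1..r} \<rightarrow>\<^sub>E UNIV. 2 * tsum r k \<le> N}"

lemma finite_sum_range: "finite (sum_range r N)"
proof (rule finite_subset)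
  show "sum_range r N \<subseteq> {1..r} \<rightarrow>\<^sub>E {..N}"
  proof
    fix k assume k: "k \<in> sum_range r N"
    have "k i \<le> N" if "i \<in> {1..r}" for i
    proof -
      have "k i \<le> tsum r k"
        unfolding tsum_def using that by (intro member_le_sum) auto
      then show ?thesis using k by (simp add: sum_range_def)
    qed
    then show "k \<in> {1..r} \<rightarrow>\<^sub>E {..N}"
      using k by (auto simp: sum_range_def PiE_iff)
  qed
  show "finite ({1..r} \<rightarrow>\<^sub>E {..N})" by (intro finite_PiE) auto
qed

lemma convergent_prod_theta:
  fixes p x :: complex
  assumes "norm p < 1"
  shows "convergent_prod (\<lambda>j. (1 - p ^ j * x) * (1 - p ^ (j + 1) / x))"
proof (rule convergent_prod_mult)
  have s: "summable (\<lambda>j. norm p ^ j)" using assms by simp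
  show "convergent_prod (\<lambda>j. 1 - p ^ j * x)"
    using summable_mult2[OF s, of "norm x"]
    by (intro abs_convergent_prod_imp_convergent_prod summable_imp_abs_convergent_prod)
       (simp add: norm_mult norm_power)
  show "convergent_prod (\<lambda>j. 1 - p ^ (j + 1) / x)"
    using summable_mult2[OF s, of "norm p / norm x"]
    by (intro abs_convergent_prod_imp_convergent_prod summable_imp_abs_convergent_prod)
       (simp add: norm_mult norm_power norm_divide mult_ac)
qed

end

(*
For c = a^2 q^(N+1), which is unchanged under (N, a) -> (N + 2, a / q), the function
h(u, v) = v theta(u/v) theta(c/(u v)) is antisymmetric and satisfies Weierstrass' three-term
relation, so Lagrange interpolation holds for products of h(., b_j).  After multiplication by the
denominators in the b_j, the summand with index k is D_k B_k(b), where B_k is a product of factors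
h(., b_j), and the right-hand side is the product over j of (a q^(2-N)/b_j; q^3)_N.

Passing from (N - 2, a q) to (N, a) multiplies the right-hand side by the product over j of
h(a q^(2-N), b_j) / b_j.  Interpolating this at the nodes a q^(|k|+1) and 1/(x_i q^(3 k_i)) turns
B_k into B_k and B_(k + e_i), respectively.  The identity therefore reduces to a recurrence for
D_k, and that recurrence is an instance of the elliptic partial fraction identity of type A.
Both interpolation identities follow from the addition formula of theta, whose two sides differ by
a multiple of a theta product with a p-periodic holomorphic quotient, constant by the maximum
principle.

The induction divides by theta(a x_i q^s) and theta(c x_i x_j q^s), which may vanish under the
hypotheses; this excludes only countably many a, and both sides are continuous in a.
*)
theory Submission
  imports Defs "HOL-Complex_Analysis.Complex_Analysis"
begin

subsection \<open>The theta function\<close>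

text \<open>The range is 2|k| <= N and a step raises |k| by at most one, so N moves by two; the
  start is N = 0 and N = 1, where only the zero tuple occurs. The nodes are forced. The pair
  theta(u/b_j) theta(c/(u b_j)) lengthens the q-string of B_k at both ends if u = a q^(|k|+1), it
  lengthens the two q^3-strings of index i by one factor each if u = 1/(x_i q^(3 k_i)), and it
  lengthens the product on the right-hand side at both ends if u = a q^(2-N). This gives r + 1 nodes
  for r factors, just enough for interpolation. A tuple of the longer range collects contributions
  from itself and from its r predecessors, with weights that add up to 1. Contributions from outside
  the shorter range need no separate treatment, because their weights contain theta(1) = 0.
  Continuity in a cannot supply the conditions that do not involve a, namely that x_i q^(3s) and x_j
  q^(3t) differ modulo p^Z. They are read off from the denominators: from Delta for s = t, and
  otherwise from the tuples with a single nonzero entry.\<close>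

definition qprod :: "complex \<Rightarrow> complex \<Rightarrow> complex" where
  "qprod p x = (\<Prod>j. 1 - p ^ j * x)"

lemma convergent_prod_qprod:
  fixes p x :: complex
  assumes "norm p < 1"
  shows "convergent_prod (\<lambda>j. 1 - p ^ j * x)"
proof -
  have s: "summable (\<lambda>j. norm p ^ j)" using assms by simp
  show ?thesis
    using summable_mult2[OF s, of "norm x"]
    by (intro abs_convergent_prod_imp_convergent_prod summable_imp_abs_convergent_prod)
       (simp add: norm_mult norm_power)
qed

lemma qprod_LIMSEQ:
  assumes "norm p < 1"
  shows "(\<lambda>n. \<Prod>j<n. 1 - p ^ j * x) \<longlonglongrightarrow> qprod p x"
  using convergent_prod_LIMSEQ[OF convergent_prod_qprod[OF assms, of x]]
  unfolding qprod_def LIMSEQ_lessThan_iff_atMost by simp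

lemma qprod_eq_0_iff:
  assumes "norm p < 1"
  shows "qprod p x = 0 \<longleftrightarrow> (\<exists>j. p ^ j * x = 1)"
  using has_prod_eq_0_iff[OF convergent_prod_has_prod[OF convergent_prod_qprod[OF assms, of x]]]
  by (auto simp: qprod_def image_iff)

lemma qprod_shift:
  assumes "norm p < 1"
  shows "qprod p x = (1 - x) * qprod p (p * x)"
proof (rule LIMSEQ_unique)
  show "(\<lambda>n. \<Prod>j<Suc n. 1 - p ^ j * x) \<longlonglongrightarrow> qprod p x"
    using qprod_LIMSEQ[OF assms] by (rule LIMSEQ_Suc)
  have "(\<lambda>n. (1 - x) * (\<Prod>j<n. 1 - p ^ j * (p * x))) \<longlonglongrightarrow> (1 - x) * qprod p (p * x)"
    by (intro tendsto_intros qprod_LIMSEQ assms)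
  moreover have "(\<Prod>j<Suc n. 1 - p ^ j * x) = (1 - x) * (\<Prod>j<n. 1 - p ^ j * (p * x))" for n
    by (subst prod.lessThan_Suc_shift) (simp add: mult_ac)
  ultimately show "(\<lambda>n. \<Prod>j<Suc n. 1 - p ^ j * x) \<longlonglongrightarrow> (1 - x) * qprod p (p * x)" by simp
qed

text \<open>On the unit ball around \<open>x\<close> the factor with index j differs from 1 by at
  most \<open>norm p ^ j * (norm x + 1)\<close>, so the partial products, which are polynomials,
  converge locally uniformly.\<close>

lemma holomorphic_qprod:
  assumes p: "norm p < 1"
  shows "qprod p holomorphic_on UNIV"
proof (rule holomorphic_uniform_sequence)
  show "open (UNIV :: complex set)" by simp
  show "(\<lambda>x. \<Prod>j<n. 1 - p ^ j * x) holomorphic_on UNIV" for n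
    by (intro holomorphic_intros)
  fix x :: complex
  have s: "summable (\<lambda>j. norm p ^ j * (norm x + 1))"
    by (intro summable_mult2) (use p in simp)
  have "uniformly_convergent_on (cball x 1) (\<lambda>N y. \<Prod>j<N. 1 - p ^ j * y)"
  proof (rule uniformly_convergent_on_prod')
    show "continuous_on (cball x 1) (\<lambda>y. 1 - p ^ j * y)" for j
      by (intro continuous_intros)
    show "uniformly_convergent_on (cball x 1) (\<lambda>N y. \<Sum>j<N. norm (1 - p ^ j * y - 1))"
    proof (rule Weierstrass_m_test'[OF _ s])
      fix n y assume "y \<in> cball x 1"
      then have "norm y \<le> norm x + 1"
        by (metis dist_norm mem_cball norm_minus_commute norm_triangle_sub order_trans add_left_mono)
      then show "norm (norm (1 - p ^ n * y - 1)) \<le> norm p ^ n * (norm x + 1)"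
        by (simp add: norm_mult norm_power mult_left_mono)
    qed
  qed auto
  then obtain l where l: "uniform_limit (cball x 1) (\<lambda>N y. \<Prod>j<N. 1 - p ^ j * y) l sequentially"
    by (auto simp: uniformly_convergent_on_def)
  have "l y = qprod p y" if "y \<in> cball x 1" for y
    using tendsto_uniform_limitI[OF l that] qprod_LIMSEQ[OF p, of y] LIMSEQ_unique by blast
  then have "uniform_limit (cball x 1) (\<lambda>N y. \<Prod>j<N. 1 - p ^ j * y) (qprod p) sequentially"
    using l by (subst uniform_limit_cong'[where g = "\<lambda>N y. \<Prod>j<N. 1 - p ^ j * y" and i = l]) auto
  then show "\<exists>d>0. cball x d \<subseteq> UNIV \<and>
      uniform_limit (cball x d) (\<lambda>n x. \<Prod>j<n. 1 - p ^ j * x) (qprod p) sequentially"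
    by (intro exI[of _ 1]) auto
qed

lemma theta_eq_qprod:
  assumes "norm p < 1"
  shows "theta x p = qprod p x * qprod p (p / x)"
  using prodinf_mult[OF convergent_prod_qprod[OF assms, of x]
      convergent_prod_qprod[OF assms, of "p / x"]]
  unfolding theta_def qprod_def by (simp add: mult_ac)

lemma theta_factor:
  assumes "norm p < 1"
  shows "theta x p = (1 - x) * (qprod p (p * x) * qprod p (p / x))"
  using qprod_shift[OF assms, of x] by (simp add: theta_eq_qprod[OF assms])

lemma theta_one [simp]: "norm p < 1 \<Longrightarrow> theta 1 p = 0"
  by (simp add: theta_factor)

lemma theta_inverse:
  assumes "norm p < 1" "x \<noteq> 0"
  shows "theta (1 / x) p = - theta x p / x"
  using assms by (simp add: theta_factor field_simps)

lemma theta_swap: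
  assumes "norm p < 1" "x \<noteq> 0" "y \<noteq> 0"
  shows "theta (y / x) p = - (y / x) * theta (x / y) p"
  using theta_inverse[of p "x / y"] assms by simp

lemma theta_nome:
  assumes "norm p < 1" "p \<noteq> 0" "x \<noteq> 0"
  shows "theta (p * x) p = - theta x p / x"
proof -
  have "theta (p * x) p = qprod p (p * x) * qprod p (1 / x)"
    using assms by (simp add: theta_eq_qprod)
  also have "qprod p (1 / x) = (1 - 1 / x) * qprod p (p / x)"
    using qprod_shift[of p "1 / x"] assms by simp
  finally show ?thesis using assms by (simp add: theta_factor[of p x] field_simps)
qed

lemma holomorphic_theta:
  assumes "norm p < 1"
  shows "(\<lambda>x. theta x p) holomorphic_on - {0}"
proof -
  have "(qprod p \<circ> (\<lambda>x. p / x)) holomorphic_on - {0}"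
    by (rule holomorphic_on_compose_gen[of _ _ _ UNIV])
      (auto intro!: holomorphic_intros holomorphic_qprod assms)
  moreover have "qprod p holomorphic_on - {0}"
    using holomorphic_qprod[OF assms] holomorphic_on_subset by blast
  ultimately have "(\<lambda>x. qprod p x * qprod p (p / x)) holomorphic_on - {0}"
    by (auto simp: o_def intro!: holomorphic_intros)
  then show ?thesis by (simp add: theta_eq_qprod[OF assms])
qed

lemma holomorphic_on_theta [holomorphic_intros]:
  assumes "norm p < 1" "f holomorphic_on S" "\<And>z. z \<in> S \<Longrightarrow> f z \<noteq> 0"
  shows "(\<lambda>z. theta (f z) p) holomorphic_on S"
proof -
  have "f ` S \<subseteq> - {0}" using assms(3) by auto
  from holomorphic_on_compose_gen[OF assms(2) holomorphic_theta[OF assms(1)] this]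
  show ?thesis by (simp add: o_def)
qed

lemma continuous_on_theta [continuous_intros]:
  assumes "norm p < 1" "continuous_on S f" "\<And>z. z \<in> S \<Longrightarrow> f z \<noteq> 0"
  shows "continuous_on S (\<lambda>z. theta (f z) p)"
proof -
  have "f ` S \<subseteq> - {0}" using assms(3) by auto
  from continuous_on_compose2[OF holomorphic_on_imp_continuous_on[OF holomorphic_theta[OF assms(1)]]
      assms(2) this]
  show ?thesis .
qed

section \<open>The zeros of theta: location, countability, simplicity\<close>

lemma theta_eq_0_iff:
  assumes p: "norm p < 1" and x: "x \<noteq> 0"
  shows "theta x p = 0 \<longleftrightarrow> (\<exists>m::int. (p \<noteq> 0 \<or> m = 0) \<and> x = p powi m)"
proof
  assume "theta x p = 0"
  then consider j where "p ^ j * x = 1" | j where "p ^ j * (p / x) = 1"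
    using p by (auto simp: theta_eq_qprod qprod_eq_0_iff)
  then show "\<exists>m::int. (p \<noteq> 0 \<or> m = 0) \<and> x = p powi m"
  proof cases
    case 1
    show ?thesis
    proof (cases "p = 0")
      \<comment> \<open>For p = 0 the equation \<open>p ^ j * x = 1\<close> forces j = 0, so x =
        1.\<close>
      case True
      with 1 show ?thesis by (intro exI[of _ 0]) (cases j; simp)
    next
      case False
      then have "x = p powi (- int j)" using 1 by (simp add: power_int_minus field_simps)
      with False show ?thesis by blast
    qed
  next
    case 2
    then have "p \<noteq> 0" by auto
    then have "x = p powi (int (Suc j))" using 2 x unfolding power_int_of_nat by (simp add: field_simps)
    with \<open>p \<noteq> 0\<close> show ?thesis by blast
  qed
next
  assume "\<exists>m::int. (p \<noteq> 0 \<or> m = 0) \<and> x = p powi m"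
  then obtain m :: int where m: "p \<noteq> 0 \<or> m = 0" "x = p powi m" by blast
  show "theta x p = 0"
  proof (cases "m = 0")
    case True then show ?thesis using m p by simp
  next
    case False
    then have p0: "p \<noteq> 0" using m by auto
    show ?thesis
    proof (cases "m > 0")
      case True
      then obtain j where "m = int (Suc j)" by (metis zero_less_imp_eq_int gr0_conv_Suc)
      then have "p ^ j * (p / x) = 1" using m p0 by (simp add: field_simps power_int_add)
      then show ?thesis using p by (auto simp: theta_eq_qprod qprod_eq_0_iff)
    next
      case False
      then have "m = - int (nat (- m))" by simp
      then obtain j where "m = - int j" by blast
      then have "p ^ j * x = 1" using m p0 by (simp add: power_int_minus)
      then show ?thesis using p by (auto simp: theta_eq_qprod qprod_eq_0_iff)
    qed
  qed
qed

text \<open>The zeros form the group p^Z (only 1 if p = 0). With this and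
  \<open>theta_0_divide\<close>, whether two theta values can vanish together is decided by the
  product or quotient of their arguments, without exponents.\<close>

lemma theta_0_mult:
  assumes "norm p < 1" "x \<noteq> 0" "y \<noteq> 0" "theta x p = 0" "theta y p = 0"
  shows "theta (x * y) p = 0"
proof -
  obtain m n :: int where "(p \<noteq> 0 \<or> m = 0) \<and> x = p powi m" "(p \<noteq> 0 \<or> n = 0) \<and> y = p powi n"
    using assms theta_eq_0_iff by metis
  then have "(p \<noteq> 0 \<or> m + n = 0) \<and> x * y = p powi (m + n)" by (auto simp: power_int_add)
  then show ?thesis using theta_eq_0_iff[of p "x * y"] assms by auto
qed

lemma theta_0_divide:
  assumes "norm p < 1" "x \<noteq> 0" "y \<noteq> 0" "theta x p = 0" "theta y p = 0"
  shows "theta (x / y) p = 0"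
  using theta_0_mult[of p x "1 / y"] theta_inverse[of p y] assms by simp

lemma countable_theta_zeros:
  assumes "norm p < 1"
  shows "countable {x. x \<noteq> 0 \<and> theta x p = 0}"
proof (rule countable_subset)
  show "{x. x \<noteq> 0 \<and> theta x p = 0} \<subseteq> (\<lambda>m::int. p powi m) ` UNIV"
    using theta_eq_0_iff[OF assms] by auto
qed auto

text \<open>The set where two continuous functions differ is open, and a nonempty open set contains
  an uncountable disc. Exceptional sets coming from zeros of theta are countable, so they can be
  discarded in this way.\<close>

lemma eq_off_countable:
  fixes f g :: "complex \<Rightarrow> complex"
  assumes S: "open S" and f: "continuous_on S f" and g: "continuous_on S g" and C: "countable C"
    and eq: "\<And>x. x \<in> S \<Longrightarrow> x \<notin> C \<Longrightarrow> f x = g x" and x: "x \<in> S"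
  shows "f x = g x"
proof (rule ccontr)
  assume "f x \<noteq> g x"
  define U where "U = S \<inter> (\<lambda>x. f x - g x) -` (- {0})"
  have "open U" unfolding U_def
    by (intro continuous_open_preimage continuous_intros f g S)
  moreover have "x \<in> U" using x \<open>f x \<noteq> g x\<close> by (simp add: U_def)
  ultimately obtain e where e: "e > 0" "ball x e \<subseteq> U" by (auto simp: open_contains_ball)
  have "ball x e \<subseteq> C"
  proof
    fix y assume "y \<in> ball x e"
    then have "y \<in> S" "f y \<noteq> g y" using e(2) by (auto simp: U_def)
    then show "y \<in> C" using eq by blast
  qed
  then show False using C e uncountable_ball countable_subset by blast
qed

text \<open>At 1 the factor 1 - x of \<open>theta_factor\<close> gives the derivative
  -(p;p)_infinity^2. The relation theta(px) = -theta(x)/x then carries a simple zero one step up or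
  down the orbit p^Z.\<close>

lemma deriv_theta_at_zero:
  assumes p: "norm p < 1" and x: "x \<noteq> 0" and z: "theta x p = 0"
  shows "\<exists>d. d \<noteq> 0 \<and> ((\<lambda>x. theta x p) has_field_derivative d) (at x)"
proof -
  have D1: "((\<lambda>x. theta x p) has_field_derivative - (qprod p p)\<^sup>2) (at 1)"
  proof -
    have q: "(qprod p has_field_derivative deriv (qprod p) u) (at u)" for u
      using holomorphic_qprod[OF p] by (metis UNIV_I holomorphic_derivI open_UNIV)
    have "((\<lambda>x. (1 - x) * (qprod p (p * x) * qprod p (p / x))) has_field_derivative
        - (qprod p p)\<^sup>2) (at 1)"
      by (rule derivative_eq_intros DERIV_chain2[OF q] refl | simp add: power2_eq_square)+
    then show ?thesis by (simp add: theta_factor[OF p])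
  qed
  have nz: "qprod p p \<noteq> 0"
  proof
    assume "qprod p p = 0"
    then obtain j where "p ^ Suc j = 1" using p by (auto simp: qprod_eq_0_iff power_commutes)
    then have "norm p ^ Suc j = 1" by (metis norm_one norm_power)
    then show False using p power_Suc_less_one[of "norm p" j] by (cases "p = 0") auto
  qed
  obtain m :: int where m: "p \<noteq> 0 \<or> m = 0" "x = p powi m" using z theta_eq_0_iff[OF p x] by blast
  show ?thesis
  proof (cases "p = 0")
    case True
    with m D1 nz show ?thesis by (intro exI[of _ "- (qprod p p)\<^sup>2"]) auto
  next
    case p0: False
    define P where "P u \<longleftrightarrow> (\<exists>d. d \<noteq> 0 \<and> ((\<lambda>x. theta x p) has_field_derivative d) (at u))" for u
    have up: "P (p * u)" if u: "u \<noteq> 0" "theta u p = 0" "P u" for u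
    proof -
      obtain d where d: "d \<noteq> 0" "((\<lambda>x. theta x p) has_field_derivative d) (at u)"
        using u unfolding P_def by blast
      have "((\<lambda>x. theta (x / p) p) has_field_derivative d * (1 / p)) (at (p * u))"
        by (rule DERIV_chain2[where f = "\<lambda>x. theta x p" and g = "\<lambda>x. x / p"])
          (use p0 d in \<open>auto intro!: derivative_eq_intros\<close>)
      from DERIV_divide[OF DERIV_minus[OF this] DERIV_cdivide[OF DERIV_ident, of p "p * u"]]
      have "((\<lambda>x. - theta (x / p) p / (x / p)) has_field_derivative - d / (p * u)) (at (p * u))"
        using p0 u by simp
      \<comment> \<open>The functional equation holds only away from 0, so the two functions are
        compared only near \<open>p * u\<close>.\<close>
      moreover have "\<forall>\<^sub>F x in nhds (p * u). - theta (x / p) p / (x / p) = theta x p"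
        using t1_space_nhds[of "p * u" 0] p0 u
      proof (rule_tac eventually_mono)
        show "- theta (x / p) p / (x / p) = theta x p" if "x \<noteq> 0" for x
          using theta_nome[OF p p0, of "x / p"] that p0 by simp
      qed auto
      ultimately have "((\<lambda>x. theta x p) has_field_derivative - d / (p * u)) (at (p * u))"
        by (subst (asm) DERIV_cong_ev) auto
      then show ?thesis unfolding P_def using d p0 u by (intro exI[of _ "- d / (p * u)"]) auto
    qed
    have down: "P u" if u: "u \<noteq> 0" "theta u p = 0" "P (p * u)" for u
    proof -
      obtain d where d: "d \<noteq> 0" "((\<lambda>x. theta x p) has_field_derivative d) (at (p * u))"
        using u unfolding P_def by blast
      have z: "theta (p * u) p = 0" using u p p0 by (simp add: theta_nome)
      have "((\<lambda>x. theta (p * x) p) has_field_derivative d * p) (at u)"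
        by (rule DERIV_chain2[where f = "\<lambda>x. theta x p" and g = "\<lambda>x. p * x"])
          (use d in \<open>auto intro!: derivative_eq_intros\<close>)
      from DERIV_mult[OF DERIV_minus[OF DERIV_ident] this]
      have "((\<lambda>x. - x * theta (p * x) p) has_field_derivative - u * (d * p)) (at u)"
        using z by (simp add: mult_ac)
      moreover have "\<forall>\<^sub>F x in nhds u. - x * theta (p * x) p = theta x p"
        using t1_space_nhds[of u 0] u
      proof (rule_tac eventually_mono)
        show "- x * theta (p * x) p = theta x p" if "x \<noteq> 0" for x
          using theta_nome[OF p p0, of x] that by simp
      qed auto
      ultimately have "((\<lambda>x. theta x p) has_field_derivative - u * (d * p)) (at u)"
        by (subst (asm) DERIV_cong_ev) auto
      then show ?thesis unfolding P_def using d p0 u by (intro exI[of _ "- u * (d * p)"]) auto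
    qed
    have P1: "P 1" unfolding P_def using D1 nz by (intro exI[of _ "- (qprod p p)\<^sup>2"]) auto
    have zp: "theta (p powi m) p = 0" for m
      using theta_eq_0_iff[of p "p powi m"] p p0 by auto
    have "P (p powi m)"
    proof (induction m rule: int_induct[of _ 0])
      case base show ?case using P1 by simp
    next
      case (step1 i)
      then show ?case using up[of "p powi i"] zp p0 by (simp add: power_int_add mult.commute)
    next
      case (step2 i)
      moreover have "p * p powi (i - 1) = p powi i" using p0 by (simp add: power_int_diff)
      ultimately show ?case using down[of "p powi (i - 1)"] zp p0 by simp
    qed
    then show ?thesis using m unfolding P_def by simp
  qed
qed

subsection \<open>The addition formula\<close>

text \<open>At a zero a of \<open>g\<close> the quotient receives its limit f'(a)/g'(a). Near a it
  equals the quotient of the two difference quotients, which are holomorphic, and the lower one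
  takes the nonzero value g'(a) at a.\<close>

lemma holomorphic_quotient_simple_zeros:
  fixes f g :: "complex \<Rightarrow> complex"
  assumes S: "open S" and f: "f holomorphic_on S" and g: "g holomorphic_on S"
    and zeros: "\<And>z. z \<in> S \<Longrightarrow> g z = 0 \<Longrightarrow> f z = 0 \<and> deriv g z \<noteq> 0"
  obtains F where "F holomorphic_on S" "\<And>z. z \<in> S \<Longrightarrow> f z = g z * F z"
proof
  define F where "F z = (if g z = 0 then deriv f z / deriv g z else f z / g z)" for z
  show "f z = g z * F z" if "z \<in> S" for z using zeros that by (simp add: F_def)
  show "F holomorphic_on S"
  proof (rule holomorphic_onI)
    fix a assume a: "a \<in> S"
    have "F field_differentiable at a"
    proof (cases "g a = 0")
      case False
      define U where "U = S \<inter> g -` (- {0})"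
      have U: "open U" unfolding U_def
        by (intro continuous_open_preimage holomorphic_on_imp_continuous_on g S) auto
      have "(\<lambda>z. f z / g z) holomorphic_on U"
        by (intro holomorphic_intros holomorphic_on_subset[OF f] holomorphic_on_subset[OF g])
          (auto simp: U_def)
      then have "F holomorphic_on U"
        by (rule holomorphic_transform) (auto simp: F_def U_def)
      then show ?thesis using U a False
        by (auto simp: U_def intro: holomorphic_on_imp_differentiable_at)
    next
      case True
      define f1 where "f1 z = (if z = a then deriv f a else (f z - f a) / (z - a))" for z
      define g1 where "g1 z = (if z = a then deriv g a else (g z - g a) / (z - a))" for z
      have hol: "f1 holomorphic_on S" "g1 holomorphic_on S"
        unfolding f1_def g1_def using f g S by (auto intro: pole_lemma_open)
      define U where "U = S \<inter> g1 -` (- {0})"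
      have U: "open U" unfolding U_def
        by (intro continuous_open_preimage holomorphic_on_imp_continuous_on hol S) auto
      have "a \<in> U" using a True zeros by (simp add: U_def g1_def)
      have "(\<lambda>z. f1 z / g1 z) holomorphic_on U"
        by (intro holomorphic_intros holomorphic_on_subset[OF hol(1)] holomorphic_on_subset[OF hol(2)])
          (auto simp: U_def)
      then have "F holomorphic_on U"
      proof (rule holomorphic_transform)
        fix z assume z: "z \<in> U"
        show "f1 z / g1 z = F z"
        proof (cases "z = a")
          case False
          then have "g z \<noteq> 0" using z True by (auto simp: U_def g1_def)
          then show ?thesis using False True zeros a by (simp add: F_def f1_def g1_def)
        qed (simp add: F_def f1_def g1_def True)
      qed
      then show ?thesis using U \<open>a \<in> U\<close>
        by (auto intro: holomorphic_on_imp_differentiable_at)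
    qed
    then show "F field_differentiable at a within S"
      by (rule field_differentiable_at_within)
  qed
qed

text \<open>If s is the logarithm of t to base \<open>\<rho>\<close>, then minus the floor of s is
  the exponent. So every orbit of multiplication by p in the punctured plane meets the closed
  annulus between |p| and 1.\<close>

lemma power_int_annulus:
  fixes t \<rho> :: real
  assumes "0 < \<rho>" "\<rho> < 1" "t > 0"
  shows "\<exists>m::int. \<rho> \<le> t * \<rho> powi m \<and> t * \<rho> powi m \<le> 1"
proof -
  define s where "s = ln t / ln \<rho>"
  have "ln \<rho> < 0" using assms by simp
  then have t: "t = \<rho> powr s" using assms by (simp add: s_def powr_def)
  have "t * \<rho> powi (- \<lfloor>s\<rfloor>) = \<rho> powr (s - of_int \<lfloor>s\<rfloor>)"
    using assms by (simp add: t powr_diff powr_real_of_int' power_int_minus divide_inverse)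
  moreover have "0 \<le> s - of_int \<lfloor>s\<rfloor>" "s - of_int \<lfloor>s\<rfloor> \<le> 1" by linarith+
  then have "\<rho> powr 1 \<le> \<rho> powr (s - of_int \<lfloor>s\<rfloor>)" "\<rho> powr (s - of_int \<lfloor>s\<rfloor>) \<le> \<rho> powr 0"
    using assms by (intro powr_mono'; simp)+
  ultimately show ?thesis using assms by (intro exI[of _ "- \<lfloor>s\<rfloor>"]) auto
qed

text \<open>Such a function lives on the compact torus of nonzero numbers modulo p^Z. Its modulus
  attains a maximum on the annulus \<open>K\<close>, by periodicity this is a maximum over the whole
  punctured plane, and the maximum principle applies.\<close>

lemma holomorphic_nome_periodic_constant:
  fixes F :: "complex \<Rightarrow> complex"
  assumes p: "norm p < 1" "p \<noteq> 0" and F: "F holomorphic_on - {0}"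
    and per: "\<And>x. x \<noteq> 0 \<Longrightarrow> F (p * x) = F x"
  shows "F constant_on - {0}"
proof -
  define K :: "complex set" where "K = cball 0 1 - ball 0 (norm p)"
  have "compact K" unfolding K_def by (intro compact_diff) auto
  moreover have "1 \<in> K" using p by (simp add: K_def)
  moreover have K0: "K \<subseteq> - {0}" using p by (auto simp: K_def)
  then have "continuous_on K (\<lambda>x. norm (F x))"
    by (intro continuous_on_norm holomorphic_on_imp_continuous_on holomorphic_on_subset[OF F])
  ultimately obtain \<xi> where \<xi>: "\<xi> \<in> K" "\<And>y. y \<in> K \<Longrightarrow> norm (F y) \<le> norm (F \<xi>)"
    using continuous_attains_sup[of K "\<lambda>x. norm (F x)"] by auto
  have per': "F (x * p powi m) = F x" if "x \<noteq> 0" for x m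
  proof (induction m rule: int_induct[of _ 0])
    case (step1 i)
    have "x * p powi (i + 1) = p * (x * p powi i)" using p by (simp add: power_int_add)
    then show ?case using step1 per[of "x * p powi i"] that p by (metis mult_eq_0_iff power_int_eq_0_iff)
  next
    case (step2 i)
    have "p * (x * p powi (i - 1)) = x * p powi i" using p by (simp add: power_int_diff)
    then show ?case using step2 per[of "x * p powi (i - 1)"] that p by (metis mult_eq_0_iff power_int_eq_0_iff)
  qed simp
  show ?thesis
  proof (rule maximum_modulus_principle[OF F, where U = "- {0}" and \<xi> = \<xi>])
    show "connected (- {0 :: complex})" by (intro connected_punctured_universe) simp
    show "\<xi> \<in> - {0}" using \<xi> K0 by blast
    fix z :: complex assume "z \<in> - {0}"
    then have z: "z \<noteq> 0" by simp
    obtain m where "norm p \<le> norm z * norm p powi m" "norm z * norm p powi m \<le> 1"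
      using power_int_annulus[of "norm p" "norm z"] p z by auto
    then have "z * p powi m \<in> K" by (simp add: K_def norm_mult norm_power_int)
    then have "norm (F (z * p powi m)) \<le> norm (F \<xi>)" by (rule \<xi>)
    then show "norm (F z) \<le> norm (F \<xi>)" using per'[OF z] by simp
  qed auto
qed

text \<open>Let f be the difference of the two sides as a function of x, and g = theta(xu)
  theta(x/u). Both are divided by x^2 under x -> px. The zeros of g are the orbits of u and 1/u, and
  they are simple because theta(u^2) does not vanish. Now f vanishes at u by inspection and at 1/u
  by the symmetry f(1/x) = f(x)/x^2, so f = g F with F periodic, hence constant. At x = y, f
  vanishes and g does not, so the constant is 0.\<close>

lemma theta_addition_aux:
  assumes p: "norm p < 1" "p \<noteq> 0" and nz: "u \<noteq> 0" "v \<noteq> 0" "x \<noteq> 0" "y \<noteq> 0"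
    and u: "theta (u * u) p \<noteq> 0" and y: "theta (y * u) p \<noteq> 0" "theta (y / u) p \<noteq> 0"
  shows "theta (x * y) p * theta (x / y) p * theta (u * v) p * theta (u / v) p
    - theta (x * v) p * theta (x / v) p * theta (u * y) p * theta (u / y) p
    = u / y * (theta (y * v) p * theta (y / v) p * theta (x * u) p * theta (x / u) p)"
    (is "?A x - ?B x = ?C x")
proof -
  note hn = theta_nome[OF p]
  define f where "f x = ?A x - ?B x - ?C x" for x
  define g where "g x = theta (x * u) p * theta (x / u) p" for x
  have f: "f holomorphic_on - {0}" unfolding f_def using p nz
    by (intro holomorphic_intros) auto
  have g: "g holomorphic_on - {0}" unfolding g_def using p nz
    by (intro holomorphic_intros) auto
  have fp: "f (p * x) = f x / x\<^sup>2" if "x \<noteq> 0" for x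
    using that nz hn[of "x * y"] hn[of "x * v"] hn[of "x * u"] hn[of "x / y"] hn[of "x / v"] hn[of "x / u"]
    by (simp add: f_def mult.assoc diff_divide_distrib power2_eq_square)
  have gp: "g (p * x) = g x / x\<^sup>2" if "x \<noteq> 0" for x
    using that nz hn[of "x * u"] hn[of "x / u"]
    by (simp add: g_def mult.assoc power2_eq_square)
  have fu: "f u = 0" using p nz by (simp add: f_def)
  have fy: "f y = 0" unfolding f_def theta_swap[OF p(1) nz(1,4)]
    using p nz by (simp add: mult_ac)
  have finv: "f (1 / x) = f x / x\<^sup>2" if "x \<noteq> 0" for x
  proof -
    have "theta (1 / x * z) p * theta (1 / x / z) p = theta (x * z) p * theta (x / z) p / x\<^sup>2"
      if z: "z \<noteq> 0" for z
    proof -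
      have 1: "theta (1 / x * z) p = - (z / x) * theta (x / z) p"
        using theta_swap[of p x z] p z \<open>x \<noteq> 0\<close> by simp
      have 2: "theta (1 / x / z) p = - theta (x * z) p / (x * z)"
        using theta_inverse[of p "x * z"] p z \<open>x \<noteq> 0\<close> by simp
      show ?thesis unfolding 1 2 using z \<open>x \<noteq> 0\<close> by (simp add: field_simps power2_eq_square)
    qed
    then have "f (1 / x) = theta (x * y) p * theta (x / y) p / x\<^sup>2 * theta (u * v) p * theta (u / v) p
      - theta (x * v) p * theta (x / v) p / x\<^sup>2 * theta (u * y) p * theta (u / y) p
      - u / y * (theta (y * v) p * theta (y / v) p * (theta (x * u) p * theta (x / u) p / x\<^sup>2))"
      using nz unfolding f_def by (metis (no_types, lifting) mult.assoc)
    then show ?thesis by (simp add: f_def diff_divide_distrib)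
  qed
  have orbit: "f (z * p powi m) = 0" if "f z = 0" "z \<noteq> 0" for z m
  proof (induction m rule: int_induct[of _ 0])
    case (step1 i)
    have "z * p powi (i + 1) = p * (z * p powi i)" using p by (simp add: power_int_add)
    then show ?case using step1 fp[of "z * p powi i"] that p by (metis div_0 mult_eq_0_iff power_int_eq_0_iff)
  next
    case (step2 i)
    have "p * (z * p powi (i - 1)) = z * p powi i" using p by (simp add: power_int_diff)
    then show ?case using step2 fp[of "z * p powi (i - 1)"] that p
      by (metis divide_eq_0_iff mult_eq_0_iff power_eq_0_iff power_int_eq_0_iff)
  qed (use that in simp)
  have dth: "((\<lambda>x. theta (x * c) p) has_field_derivative deriv (\<lambda>x. theta x p) (z * c) * c) (at z)"
    if "z \<noteq> 0" "c \<noteq> 0" for z c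
    by (rule DERIV_chain2[where f = "\<lambda>x. theta x p" and g = "\<lambda>x. x * c"])
       (use that holomorphic_derivI[OF holomorphic_theta[OF p(1)], of "z * c"]
         in \<open>auto intro!: derivative_eq_intros simp: open_Compl\<close>)
  have dnz: "deriv (\<lambda>x. theta x p) z \<noteq> 0" if "z \<noteq> 0" "theta z p = 0" for z
    using deriv_theta_at_zero[OF p(1) that] DERIV_imp_deriv by blast
  have "f z = 0 \<and> deriv g z \<noteq> 0" if zz: "z \<in> - {0}" "g z = 0" for z
  proof -
    have z: "z \<noteq> 0" using zz by simp
    have D: "(g has_field_derivative (deriv (\<lambda>x. theta x p) (z * u) * u * theta (z * (1 / u)) p
        + deriv (\<lambda>x. theta x p) (z * (1 / u)) * (1 / u) * theta (z * u) p)) (at z)"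
      using DERIV_mult[OF dth[of z u] dth[of z "1 / u"]] z nz
      unfolding g_def by (simp add: add.commute)
    consider "theta (z * u) p = 0" | "theta (z / u) p = 0" using zz by (auto simp: g_def)
    then show ?thesis
    proof cases
      case 1
      then obtain m where "z * u = p powi m" using theta_eq_0_iff[of p "z * u"] z nz p by auto
      then have "z = 1 / u * p powi m" using nz by (simp add: field_simps)
      moreover have "f (1 / u) = 0" using finv[of u] fu nz by simp
      ultimately have "f z = 0" using orbit[of "1 / u" m] nz by simp
      moreover have "theta (z / u) p \<noteq> 0"
        using 1 u theta_0_divide[of p "z * u" "z / u"] z nz p by auto
      ultimately show ?thesis using 1 D dnz[of "z * u"] z nz by (auto dest!: DERIV_imp_deriv)
    next
      case 2
      then obtain m where "z / u = p powi m" using theta_eq_0_iff[of p "z / u"] z nz p by auto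
      then have "z = u * p powi m" using nz by (simp add: field_simps)
      then have "f z = 0" using orbit[of u m] nz fu by simp
      moreover have "theta (z * u) p \<noteq> 0"
        using 2 u theta_0_divide[of p "z * u" "z / u"] z nz p by auto
      ultimately show ?thesis using 2 D dnz[of "z / u"] z nz by (auto dest!: DERIV_imp_deriv)
    qed
  qed
  then obtain F where F: "F holomorphic_on - {0}" "\<And>z. z \<in> - {0} \<Longrightarrow> f z = g z * F z"
    using holomorphic_quotient_simple_zeros[OF _ f g] by (auto simp: open_Compl)
  \<comment> \<open>Comparing f = g F at x and at px gives periodicity only where g is nonzero;
    continuity of F covers the countable rest.\<close>
  have "F (p * x) = F x" if x: "x \<noteq> 0" for x
  proof (rule eq_off_countable[where S = "- {0}" and f = "\<lambda>x. F (p * x)" and g = F])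
    show "countable ((\<lambda>w. w / u) ` {x. x \<noteq> 0 \<and> theta x p = 0} \<union> (\<lambda>w. w * u) ` {x. x \<noteq> 0 \<and> theta x p = 0})"
      (is "countable ?C") using countable_theta_zeros[OF p(1)] by auto
    show "continuous_on (- {0}) (\<lambda>x. F (p * x))"
      by (rule continuous_on_compose2[OF holomorphic_on_imp_continuous_on[OF F(1)]])
        (use p in \<open>auto intro!: continuous_intros\<close>)
    fix z assume z: "z \<in> - {0}" "z \<notin> ?C"
    have "theta (z * u) p \<noteq> 0"
    proof
      assume "theta (z * u) p = 0"
      then have "z * u / u \<in> ?C" using z nz by (intro UnI1 imageI) auto
      then show False using z nz by simp
    qed
    moreover have "theta (z / u) p \<noteq> 0"
    proof
      assume "theta (z / u) p = 0"
      then have "z / u * u \<in> ?C" using z nz by (intro UnI2 imageI) auto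
      then show False using z nz by simp
    qed
    ultimately have "g z \<noteq> 0" by (simp add: g_def)
    have "g z / z\<^sup>2 * F (p * z) = f (p * z)"
      using F(2)[of "p * z"] gp[of z] z p by simp
    also have "\<dots> = g z / z\<^sup>2 * F z"
      using F(2)[of z] fp[of z] z by simp
    finally show "F (p * z) = F z" using \<open>g z \<noteq> 0\<close> z by simp
  qed (use x F(1) holomorphic_on_imp_continuous_on in auto)
  then have "F constant_on - {0}" by (rule holomorphic_nome_periodic_constant[OF p F(1)])
  then obtain c where c: "\<And>z. z \<noteq> 0 \<Longrightarrow> F z = c" unfolding constant_on_def by auto
  have "g y * c = 0" using F(2)[of y] c[of y] fy nz by simp
  then have "c = 0" using y by (simp add: g_def)
  then have "f x = 0" using F(2)[of x] c[of x] nz by simp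
  then show ?thesis by (simp add: f_def)
qed

text \<open>The conditions of \<open>theta_addition_aux\<close> exclude countably many y for fixed
  u, and then countably many u, so continuity first in y and then in u removes them.\<close>

lemma theta_addition:
  assumes p: "norm p < 1" and nz: "u \<noteq> 0" "v \<noteq> 0" "x \<noteq> 0" "y \<noteq> 0"
  shows "theta (x * y) p * theta (x / y) p * theta (u * v) p * theta (u / v) p
    - theta (x * v) p * theta (x / v) p * theta (u * y) p * theta (u / y) p
    = u / y * (theta (y * v) p * theta (y / v) p * theta (x * u) p * theta (x / u) p)"
proof (cases "p = 0")
  \<comment> \<open>The annulus argument needs p nonzero. For p = 0 theta is 1 - x and the identity
    is a rational one.\<close>
  case True
  have "theta x 0 = 1 - x" for x
    using theta_factor[of 0 x] by (simp add: qprod_def)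
  then show ?thesis using nz unfolding True by (simp add: divide_simps) (simp add: algebra_simps)
next
  case False
  note p = p False
  let ?Z = "{x. x \<noteq> 0 \<and> theta x p = 0}"
  have Z: "countable ?Z" by (rule countable_theta_zeros[OF p(1)])
  have gen: "theta (x * y) p * theta (x / y) p * theta (u * v) p * theta (u / v) p
      - theta (x * v) p * theta (x / v) p * theta (u * y) p * theta (u / y) p
      = u / y * (theta (y * v) p * theta (y / v) p * theta (x * u) p * theta (x / u) p)"
    if u: "theta (u * u) p \<noteq> 0" "u \<noteq> 0" for u
  proof (rule eq_off_countable[where S = "- {0}" and x = y and
      f = "\<lambda>y. theta (x * y) p * theta (x / y) p * theta (u * v) p * theta (u / v) p
      - theta (x * v) p * theta (x / v) p * theta (u * y) p * theta (u / y) p" and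
      g = "\<lambda>y. u / y * (theta (y * v) p * theta (y / v) p * theta (x * u) p * theta (x / u) p)"])
    show "countable ((\<lambda>w. w / u) ` ?Z \<union> (\<lambda>w. w * u) ` ?Z)" (is "countable ?C") using Z by auto
    fix y assume y: "y \<in> - {0}" "y \<notin> ?C"
    have "theta (y * u) p \<noteq> 0"
    proof
      assume "theta (y * u) p = 0"
      then have "y * u / u \<in> ?C" using y u by (intro UnI1 imageI) auto
      then show False using y u by simp
    qed
    moreover have "theta (y / u) p \<noteq> 0"
    proof
      assume "theta (y / u) p = 0"
      then have "y / u * u \<in> ?C" using y u by (intro UnI2 imageI) auto
      then show False using y u by simp
    qed
    ultimately show "theta (x * y) p * theta (x / y) p * theta (u * v) p * theta (u / v) p
      - theta (x * v) p * theta (x / v) p * theta (u * y) p * theta (u / y) p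
      = u / y * (theta (y * v) p * theta (y / v) p * theta (x * u) p * theta (x / u) p)"
      using theta_addition_aux[OF p, of u v x y] u y nz by auto
  qed (use p nz u in \<open>auto intro!: continuous_intros\<close>)
  show ?thesis
  proof (rule eq_off_countable[where S = "- {0}" and x = u and
      f = "\<lambda>u. theta (x * y) p * theta (x / y) p * theta (u * v) p * theta (u / v) p
      - theta (x * v) p * theta (x / v) p * theta (u * y) p * theta (u / y) p" and
      g = "\<lambda>u. u / y * (theta (y * v) p * theta (y / v) p * theta (x * u) p * theta (x / u) p)"])
    \<comment> \<open>If theta(u^2) = 0, then u is plus or minus the principal root of one of the
      countably many zeros.\<close>
    show "countable (csqrt ` ?Z \<union> (\<lambda>w. - csqrt w) ` ?Z)" (is "countable ?C") using Z by auto
    fix u assume u: "u \<in> - {0}" "u \<notin> ?C"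
    have "theta (u * u) p \<noteq> 0"
    proof
      assume "theta (u * u) p = 0"
      then have "u * u \<in> ?Z" using u by simp
      then have "csqrt (u * u) \<in> ?C" "- csqrt (u * u) \<in> ?C" by blast+
      moreover have "u\<^sup>2 = (csqrt (u * u))\<^sup>2"
        by (simp add: power2_eq_square[of u])
      then have "u = csqrt (u * u) \<or> u = - csqrt (u * u)"
        by (simp only: power2_eq_iff)
      ultimately show False using u(2) by (elim disjE) simp_all
    qed
    then show "theta (x * y) p * theta (x / y) p * theta (u * v) p * theta (u / v) p
      - theta (x * v) p * theta (x / v) p * theta (u * y) p * theta (u / y) p
      = u / y * (theta (y * v) p * theta (y / v) p * theta (x * u) p * theta (x / u) p)"
      using gen u by auto
  qed (use p nz in \<open>auto intro!: continuous_intros\<close>)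
qed

subsection \<open>Interpolation and partial fractions\<close>

text \<open>The three-term relation plays the part of linearity in ordinary Lagrange interpolation.
  The induction removes one factor \<open>m\<close> together with one node \<open>i0\<close>: the
  hypothesis on the other nodes is multiplied by \<open>h v (z m)\<close>, and this factor is split
  at the removed node.\<close>

lemma lagrange_three_term:
  fixes h :: "'a \<Rightarrow> 'a \<Rightarrow> 'b :: field"
  assumes anti: "\<And>u v. u \<in> D \<Longrightarrow> v \<in> D \<Longrightarrow> h u v = - h v u"
    and three: "\<And>x y u v. x \<in> D \<Longrightarrow> y \<in> D \<Longrightarrow> u \<in> D \<Longrightarrow> v \<in> D \<Longrightarrow>
      h x y * h u v - h x v * h u y = h y v * h x u"
    and J: "finite J" "z ` J \<subseteq> D" and I: "card I = Suc (card J)" "y ` I \<subseteq> D"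
    and ne: "\<And>i l. i \<in> I \<Longrightarrow> l \<in> I \<Longrightarrow> i \<noteq> l \<Longrightarrow> h (y i) (y l) \<noteq> 0"
    and v: "v \<in> D"
  shows "(\<Prod>j\<in>J. h v (z j)) =
    (\<Sum>i\<in>I. (\<Prod>l\<in>I - {i}. h v (y l) / h (y i) (y l)) * (\<Prod>j\<in>J. h (y i) (z j)))"
  using J I ne v
proof (induction J arbitrary: I v rule: finite_induct)
  case empty
  then obtain i where "I = {i}" by (auto simp: card_1_singleton_iff)
  then show ?case by simp
next
  case (insert m J)
  then have "card I = Suc (Suc (card J))" by simp
  then obtain i0 I' where I: "I = Set.insert i0 I'" "i0 \<notin> I'" "card I' = Suc (card J)" "finite I'"
    by (metis card_Suc_eq_finite)
  let ?P = "\<lambda>u. \<Prod>j\<in>J. h u (z j)"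
  let ?H = "\<lambda>i. \<Prod>l\<in>I' - {i}. h (y i) (y l)"
  have D: "y i0 \<in> D" "z m \<in> D" "\<And>i. i \<in> I' \<Longrightarrow> y i \<in> D" using insert.prems I by auto
  have n0: "h (y i) (y i0) \<noteq> 0" "h (y i0) (y i) \<noteq> 0" if "i \<in> I'" for i
    using insert.prems(4)[of i i0] insert.prems(4)[of i0 i] that I by auto
  have H: "?H i \<noteq> 0" if "i \<in> I'" for i
    using insert.prems(4) that I by auto
  have IH: "?P v = (\<Sum>i\<in>I'. (\<Prod>l\<in>I' - {i}. h v (y l)) * ?P (y i) / ?H i)" if "v \<in> D" for v
    using insert.IH[of I' v] insert.prems I that by (auto simp: prod_dividef)
  \<comment> \<open>The hypothesis evaluated at the removed node yields the sum \<open>S\<close>,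
    which later assembles the term of \<open>i0\<close>.\<close>
  have "?P (y i0) = - (\<Prod>l\<in>I'. h (y i0) (y l)) * (\<Sum>i\<in>I'. ?P (y i) / (h (y i) (y i0) * ?H i))"
    unfolding IH[OF D(1)] sum_distrib_left
  proof (rule sum.cong)
    fix i assume i: "i \<in> I'"
    have "(\<Prod>l\<in>I'. h (y i0) (y l)) = - h (y i) (y i0) * (\<Prod>l\<in>I' - {i}. h (y i0) (y l))"
      using anti[OF D(1) D(3)[OF i]] i I by (simp add: prod.remove)
    then show "(\<Prod>l\<in>I' - {i}. h (y i0) (y l)) * ?P (y i) / ?H i =
        - (\<Prod>l\<in>I'. h (y i0) (y l)) * (?P (y i) / (h (y i) (y i0) * ?H i))"
      using n0[OF i] by simp
  qed simp
  then have S: "(\<Sum>i\<in>I'. ?P (y i) / (h (y i) (y i0) * ?H i)) = - ?P (y i0) / (\<Prod>l\<in>I'. h (y i0) (y l))"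
    using n0 I by (simp add: field_simps)
  have "h v (z m) * ((\<Prod>l\<in>I' - {i}. h v (y l)) * ?P (y i) / ?H i) =
      (\<Prod>l\<in>I - {i}. h v (y l) / h (y i) (y l)) * (h (y i) (z m) * ?P (y i))
      + h (z m) (y i0) * (\<Prod>l\<in>I'. h v (y l)) * (?P (y i) / (h (y i) (y i0) * ?H i))" if i: "i \<in> I'" for i
  proof -
    have "I - {i} = Set.insert i0 (I' - {i})" using I i by auto
    then have 1: "(\<Prod>l\<in>I - {i}. h v (y l) / h (y i) (y l)) =
        h v (y i0) / h (y i) (y i0) * ((\<Prod>l\<in>I' - {i}. h v (y l)) / ?H i)"
      using I by (simp add: prod_dividef)
    have 2: "(\<Prod>l\<in>I'. h v (y l)) = h v (y i) * (\<Prod>l\<in>I' - {i}. h v (y l))"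
      using i I by (simp add: prod.remove)
    \<comment> \<open>The first summand completes the term of node i in the larger formula. In the
      second, \<open>h v (y i)\<close> fills the gap in the product over the nodes, so what
      multiplies it no longer depends on v and can be summed by \<open>S\<close>.\<close>
    have 3: "h v (z m) = (h v (y i0) * h (y i) (z m) + h (z m) (y i0) * h v (y i)) / h (y i) (y i0)"
      using three[OF insert.prems(5) D(2) D(3)[OF i] D(1)] n0[OF i] by (simp add: field_simps)
    show ?thesis unfolding 1 2 3 using n0[OF i] H[OF i] by (simp add: divide_simps) (simp add: algebra_simps)
  qed
  then have "h v (z m) * ?P v = (\<Sum>i\<in>I'. (\<Prod>l\<in>I - {i}. h v (y l) / h (y i) (y l)) * (h (y i) (z m) * ?P (y i)))
      + h (z m) (y i0) * (\<Prod>l\<in>I'. h v (y l)) * (\<Sum>i\<in>I'. ?P (y i) / (h (y i) (y i0) * ?H i))"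
    unfolding IH[OF insert.prems(5)] sum_distrib_left by (simp add: sum.distrib)
  also have "h (z m) (y i0) * (\<Prod>l\<in>I'. h v (y l)) * (\<Sum>i\<in>I'. ?P (y i) / (h (y i) (y i0) * ?H i)) =
      (\<Prod>l\<in>I - {i0}. h v (y l) / h (y i0) (y l)) * (h (y i0) (z m) * ?P (y i0))"
  proof -
    have "I - {i0} = I'" using I by auto
    then show ?thesis unfolding S using anti[OF D(1,2)] by (simp add: prod_dividef)
  qed
  finally show ?case using insert.hyps I by simp
qed

text \<open>For a fixed value of Y Y' the products theta(x/Y) theta(x/Y') span a space of dimension
  two. The product is expanded in the two members that vanish at x = f and at x = e, with
  coefficients obtained by evaluation at e and f.\<close>

lemma theta_two_dim:
  assumes p: "norm p < 1" and nz: "x \<noteq> 0" "e \<noteq> 0" "f \<noteq> 0" "Y \<noteq> 0" "Y' \<noteq> 0"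
    and ef: "theta (e / f) p \<noteq> 0"
  shows "theta (e * f / (Y * Y')) p * (theta (x / Y) p * theta (x / Y') p) =
    theta (e / Y) p * theta (e / Y') p / theta (e / f) p * (theta (x * f / (Y * Y')) p * theta (x / f) p)
    + theta (f / Y) p * theta (f / Y') p / theta (f / e) p * (theta (x * e / (Y * Y')) p * theta (x / e) p)"
proof -
  \<comment> \<open>Dividing every variable by a root of Y Y' normalizes the product of the two
    zeros to 1, which is the shape theta(xy) theta(x/y) of the addition formula.\<close>
  define g where "g = csqrt (Y * Y')"
  have gg: "g * g = Y * Y'" unfolding g_def by (metis power2_csqrt power2_eq_square)
  then have g: "g \<noteq> 0" using nz by auto
  have Y': "Y' = g * g / Y" using gg nz by (simp add: field_simps)
  define c where "c = theta (f / Y) p * theta (f / Y') p * (theta (x * e / (Y * Y')) p * theta (x / e) p)"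
  have "theta (x / g * (Y / g)) p * theta (x / g / (Y / g)) p * theta (e / g * (f / g)) p * theta (e / g / (f / g)) p
    - theta (x / g * (f / g)) p * theta (x / g / (f / g)) p * theta (e / g * (Y / g)) p * theta (e / g / (Y / g)) p
    = (e / g) / (Y / g) * (theta (Y / g * (f / g)) p * theta (Y / g / (f / g)) p * theta (x / g * (e / g)) p * theta (x / g / (e / g)) p)"
    by (rule theta_addition) (use p nz g in auto)
  moreover have "x / g * (Y / g) = x / Y'" "e / g * (Y / g) = e / Y'" "Y / g * (f / g) = f / Y'"
    using Y' g nz by (auto simp: field_simps)
  moreover have "x / g / (Y / g) = x / Y" "e / g / (f / g) = e / f" "x / g / (f / g) = x / f"
    "e / g / (Y / g) = e / Y" "(e / g) / (Y / g) = e / Y" "Y / g / (f / g) = Y / f" "x / g / (e / g) = x / e"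
    using g by auto
  moreover have "e / g * (f / g) = e * f / (Y * Y')" "x / g * (f / g) = x * f / (Y * Y')"
    "x / g * (e / g) = x * e / (Y * Y')" by (simp_all flip: gg)
  moreover have "theta (Y / f) p = - (Y / f) * theta (f / Y) p" using theta_swap[of p f Y] p nz by simp
  ultimately have main: "theta (x / Y') p * theta (x / Y) p * theta (e * f / (Y * Y')) p * theta (e / f) p
    - theta (x * f / (Y * Y')) p * theta (x / f) p * theta (e / Y') p * theta (e / Y) p = - (e / f) * c"
    using nz by (simp add: c_def)
  have "theta (f / e) p = - (f / e) * theta (e / f) p" using theta_swap[of p e f] p nz by simp
  then have "theta (f / Y) p * theta (f / Y') p / theta (f / e) p * (theta (x * e / (Y * Y')) p * theta (x / e) p)
    = - (e / f) * c / theta (e / f) p" using nz by (simp add: c_def)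
  then show ?thesis unfolding main[symmetric] using ef by (simp add: field_simps)
qed

text \<open>Removing one pole and one zero at a time writes the sum as a combination of two shorter
  balanced ones, as long as some pair of poles is not congruent to a pair of zeros.\<close>

lemma theta_partial_fraction:
  fixes X :: "'i \<Rightarrow> complex" and Y :: "'j \<Rightarrow> complex"
  assumes p: "norm p < 1" and fin: "finite I" "finite J" and card: "card I = card J"
    and X: "\<And>i. i \<in> I \<Longrightarrow> X i \<noteq> 0" and Y: "\<And>j. j \<in> J \<Longrightarrow> Y j \<noteq> 0"
    and ne: "\<And>i l. i \<in> I \<Longrightarrow> l \<in> I \<Longrightarrow> i \<noteq> l \<Longrightarrow> theta (X i / X l) p \<noteq> 0"
    and bal: "(\<Prod>i\<in>I. X i) = (\<Prod>j\<in>J. Y j)"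
  shows "(\<Sum>i\<in>I. (\<Prod>j\<in>J. theta (X i / Y j) p) / (\<Prod>l\<in>I - {i}. theta (X i / X l) p)) = 0"
  using fin card X Y ne bal
proof (induction "card I" arbitrary: I J Y rule: less_induct)
  case less
  consider "card I = 0" | "card I = 1" | "card I = 2" | "card I \<ge> 3" by linarith
  then show ?case
  proof cases
    case 1
    then show ?thesis using less.prems by simp
  next
    case 2
    then obtain i j where "I = {i}" "J = {j}" using less.prems by (metis card_1_singletonE)
    then show ?thesis using less.prems p by simp
  next
    case 3
    then obtain i l where I: "I = {i, l}" "i \<noteq> l" by (meson card_2_iff)
    obtain j m where J: "J = {j, m}" "j \<noteq> m" using 3 less.prems by (metis card_2_iff)
    have nz: "X i \<noteq> 0" "X l \<noteq> 0" "Y j \<noteq> 0" "Y m \<noteq> 0" using less.prems I J by auto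
    have bal: "X i * X l = Y j * Y m" using less.prems I J by simp
    have bal': "Y j * (Y m * c) = X i * (X l * c)" for c using bal by (metis mult.assoc)
    \<comment> \<open>By the balancing condition the arguments seen from one pole are the inverses
      of those seen from the other, so the two terms are opposite.\<close>
    have "X l / Y j = Y m / X i" "X l / Y m = Y j / X i" using bal nz by (auto simp: field_simps)
    moreover have "I - {i} = {l}" "I - {l} = {i}" using I by auto
    ultimately have "?thesis \<longleftrightarrow> theta (X i / Y j) p * theta (X i / Y m) p / theta (X i / X l) p +
      theta (Y m / X i) p * theta (Y j / X i) p / theta (X l / X i) p = 0"
      using I J by (simp add: mult.commute)
    also have "\<dots>" unfolding theta_swap[OF p nz(1,3)] theta_swap[OF p nz(1,4)] theta_swap[OF p nz(1,2)]
      using nz by (simp add: field_simps bal')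
    finally show ?thesis by simp
  next
    case 4
    obtain a b d where abd: "a \<in> I" "b \<in> I" "d \<in> I" "a \<noteq> b" "a \<noteq> d" "b \<noteq> d"
    proof -
      obtain B where B: "B \<subseteq> I" "card B = 3" "finite B"
        by (rule obtain_subset_with_card_n[OF 4])
      from card_3_iff[THEN iffD1, OF B(2)]
      obtain a b d where "B = {a, b, d}" "a \<noteq> b" "b \<noteq> d" "a \<noteq> d" by metis
      then show ?thesis using B(1) by (intro that[of a b d]) simp_all
    qed
    obtain j m where jm: "j \<in> J" "m \<in> J" "j \<noteq> m"
    proof -
      have "2 \<le> card J" using 4 less.prems(3) by linarith
      then obtain B where B: "B \<subseteq> J" "card B = 2" "finite B"
        by (rule obtain_subset_with_card_n)
      from card_2_iff[THEN iffD1, OF B(2)] obtain j m where "B = {j, m}" "j \<noteq> m" by metis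
      then show ?thesis using B(1) by (intro that[of j m]) simp_all
    qed
    have Ynz: "Y j \<noteq> 0" "Y m \<noteq> 0" using less.prems jm by auto
    \<comment> \<open>If the pair a, b is congruent to the chosen pair of zeros, then a, d is not:
      otherwise X_b/X_d would be a zero of theta. This is where a third pole is required.\<close>
    obtain e f where ef: "e \<in> I" "f \<in> I" "e \<noteq> f" "theta (X e * X f / (Y j * Y m)) p \<noteq> 0"
    proof (cases "theta (X a * X b / (Y j * Y m)) p = 0")
      case True
      have "X a * X b / (Y j * Y m) / (X a * X d / (Y j * Y m)) = X b / X d"
        using less.prems abd Ynz by simp
      then have "theta (X a * X d / (Y j * Y m)) p \<noteq> 0"
        using theta_0_divide[of p "X a * X b / (Y j * Y m)" "X a * X d / (Y j * Y m)"]
          True p less.prems abd Ynz by auto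
      then show ?thesis using that[of a d] abd by auto
    qed (use that[of a b] abd in auto)
    define I' where "I' = I - {e, f}"
    define J' where "J' = J - {j, m}"
    have I: "I = insert e (insert f I')" "e \<notin> insert f I'" "f \<notin> I'" "finite I'"
      using ef less.prems by (auto simp: I'_def)
    have J: "J = insert j (insert m J')" "j \<notin> insert m J'" "m \<notin> J'" "finite J'"
      using jm less.prems by (auto simp: J'_def)
    have cIJ: "card I' = card J'" using less.prems(3) I J by simp
    have nz: "X e \<noteq> 0" "X f \<noteq> 0" "\<And>i. i \<in> I' \<Longrightarrow> X i \<noteq> 0" using less.prems I by auto
    have balI: "X e * X f * (\<Prod>i\<in>I'. X i) = Y j * Y m * (\<Prod>j\<in>J'. Y j)"
      using less.prems(7) I J by (simp add: mult.assoc)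
    let ?G = "\<lambda>i. \<Prod>j\<in>J'. theta (X i / Y j) p"
    let ?H = "\<lambda>i. \<Prod>l\<in>I' - {i}. theta (X i / X l) p"
    have Hu: "(\<Prod>l\<in>insert c I' - {c}. theta (X c / X l) p) = ?H c" if "c \<notin> I'" for c
      using that by (simp add: insert_Diff_if)
    have Hi: "(\<Prod>l\<in>insert c I' - {i}. theta (X i / X l) p) = theta (X i / X c) p * ?H i"
      if "i \<in> I'" "c \<notin> I'" for i c
    proof -
      have "insert c I' - {i} = insert c (I' - {i})" using that by auto
      then show ?thesis using I that by simp
    qed
    have IH: "theta (X c * X c' / (Y j * Y m)) p * ?G c / ?H c
        + (\<Sum>i\<in>I'. theta (X i * X c' / (Y j * Y m)) p * ?G i / (theta (X i / X c) p * ?H i)) = 0"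
      if c: "c \<in> {e, f}" "c' \<in> {e, f}" "c \<noteq> c'" for c c'
    proof -
      \<comment> \<open>Dropping the pole \<open>c'\<close> and merging the zeros j and m into the
        single zero Y_j Y_m / X_c' preserves the balancing condition.\<close>
      define Y' where "Y' = Y(j := Y j * Y m / X c')"
      have cI: "c \<notin> I'" "X c \<noteq> 0" "X c' \<noteq> 0" using c I nz by auto
      have xy: "x / (Y j * Y m / X c') = x * X c' / (Y j * Y m)" for x by simp
      have G: "(\<Prod>j\<in>insert j J'. theta (x / Y' j) p) =
          theta (x * X c' / (Y j * Y m)) p * (\<Prod>j\<in>J'. theta (x / Y j) p)" for x
      proof -
        have "(\<Prod>j\<in>J'. theta (x / Y' j) p) = (\<Prod>j\<in>J'. theta (x / Y j) p)"
          using J by (intro prod.cong) (auto simp: Y'_def)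
        then show ?thesis using J by (simp add: Y'_def)
      qed
      have "(\<Sum>i\<in>insert c I'. (\<Prod>j\<in>insert j J'. theta (X i / Y' j) p) /
          (\<Prod>l\<in>insert c I' - {i}. theta (X i / X l) p)) = 0"
      proof (rule less.hyps)
        show "card (insert c I') < card I" using I cI by simp
        show "card (insert c I') = card (insert j J')" using I J cI cIJ by simp
        have "X c * X c' = X e * X f" using c by (auto simp: mult.commute)
        have "(\<Prod>j\<in>J'. Y' j) = (\<Prod>j\<in>J'. Y j)"
          using J by (intro prod.cong) (auto simp: Y'_def)
        then have "(\<Prod>j\<in>insert j J'. Y' j) = Y j * Y m / X c' * (\<Prod>j\<in>J'. Y j)"
          using J by (simp add: Y'_def)
        also have "\<dots> = X e * X f * (\<Prod>i\<in>I'. X i) / X c'" using balI by simp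
        also have "\<dots> = X c * (\<Prod>i\<in>I'. X i)"
          using \<open>X c * X c' = X e * X f\<close> cI by (simp flip: \<open>X c * X c' = X e * X f\<close>)
        finally show "(\<Prod>i\<in>insert c I'. X i) = (\<Prod>j\<in>insert j J'. Y' j)" using I cI by simp
        show "\<And>i l. i \<in> insert c I' \<Longrightarrow> l \<in> insert c I' \<Longrightarrow> i \<noteq> l \<Longrightarrow> theta (X i / X l) p \<noteq> 0"
          using less.prems(6) I c by auto
        show "\<And>k. k \<in> insert j J' \<Longrightarrow> Y' k \<noteq> 0"
          using less.prems(5) J Ynz cI by (auto simp: Y'_def)
      qed (use I J cI nz in auto)
      then show ?thesis using I cI by (simp add: G Hu Hi del: prod.insert)
    qed
    let ?K = "theta (X e * X f / (Y j * Y m)) p"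
    define A where "A = theta (X e / Y j) p * theta (X e / Y m) p / theta (X e / X f) p"
    define B where "B = theta (X f / Y j) p * theta (X f / Y m) p / theta (X f / X e) p"
    have tne: "theta (X e / X f) p \<noteq> 0" "theta (X f / X e) p \<noteq> 0"
      "\<And>i. i \<in> I' \<Longrightarrow> theta (X i / X e) p \<noteq> 0" "\<And>i. i \<in> I' \<Longrightarrow> theta (X i / X f) p \<noteq> 0"
      using less.prems(6) I by auto
    let ?T = "\<lambda>i. (\<Prod>j\<in>J. theta (X i / Y j) p) / (\<Prod>l\<in>I - {i}. theta (X i / X l) p)"
    have PJ: "(\<Prod>j\<in>J. theta (x / Y j) p) =
        theta (x / Y j) p * theta (x / Y m) p * (\<Prod>j\<in>J'. theta (x / Y j) p)" for x
      using J by (simp add: mult.assoc)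
    have Te: "?T e = A * ?G e / ?H e"
    proof -
      have "I - {e} = insert f I'" using I by auto
      then show ?thesis unfolding PJ using I by (simp add: A_def)
    qed
    have Tf: "?T f = B * ?G f / ?H f"
    proof -
      have "I - {f} = insert e I'" using I by auto
      then show ?thesis unfolding PJ using I by (simp add: B_def)
    qed
    have Ti: "?K * ?T i = A * (theta (X i * X f / (Y j * Y m)) p * ?G i / (theta (X i / X e) p * ?H i))
      + B * (theta (X i * X e / (Y j * Y m)) p * ?G i / (theta (X i / X f) p * ?H i))" if i: "i \<in> I'" for i
    proof -
      have "I - {i} = insert e (insert f (I' - {i}))" using I i by auto
      then have T: "?T i = (theta (X i / Y j) p * theta (X i / Y m) p) * ?G i /
          (theta (X i / X e) p * theta (X i / X f) p * ?H i)"
        unfolding PJ using I by (simp add: mult.assoc)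
      have td: "?K * (theta (X i / Y j) p * theta (X i / Y m) p) =
        A * (theta (X i * X f / (Y j * Y m)) p * theta (X i / X f) p)
        + B * (theta (X i * X e / (Y j * Y m)) p * theta (X i / X e) p)"
        using theta_two_dim[of p "X i" "X e" "X f" "Y j" "Y m"] p nz Ynz tne i unfolding A_def B_def by blast
      have "?K * ?T i = ?K * (theta (X i / Y j) p * theta (X i / Y m) p) * ?G i /
          (theta (X i / X e) p * theta (X i / X f) p * ?H i)" unfolding T by simp
      then show ?thesis unfolding td using tne i by (simp add: add_divide_distrib distrib_right)
    qed
    have "?K * (\<Sum>i\<in>I. ?T i) = ?K * ?T e + ?K * ?T f + (\<Sum>i\<in>I'. ?K * ?T i)"
    proof -
      have "(\<Sum>i\<in>I. ?T i) = ?T e + ?T f + (\<Sum>i\<in>I'. ?T i)"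
        by (subst I(1)) (use I in simp)
      then show ?thesis by (simp add: distrib_left sum_distrib_left)
    qed
    also have "(\<Sum>i\<in>I'. ?K * ?T i) =
        A * (\<Sum>i\<in>I'. theta (X i * X f / (Y j * Y m)) p * ?G i / (theta (X i / X e) p * ?H i))
        + B * (\<Sum>i\<in>I'. theta (X i * X e / (Y j * Y m)) p * ?G i / (theta (X i / X f) p * ?H i))"
      unfolding sum_distrib_left sum.distrib[symmetric] by (rule sum.cong[OF refl Ti])
    also have "?K * ?T e + ?K * ?T f + \<dots> = A * (?K * ?G e / ?H e + (\<Sum>i\<in>I'. theta (X i * X f / (Y j * Y m)) p * ?G i / (theta (X i / X e) p * ?H i)))
       + B * (?K * ?G f / ?H f + (\<Sum>i\<in>I'. theta (X i * X e / (Y j * Y m)) p * ?G i / (theta (X i / X f) p * ?H i)))"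
      unfolding Te Tf by (simp add: algebra_simps)
    also have "\<dots> = 0" using IH[of e f] IH[of f e] ef by (simp add: mult.commute[of "X f" "X e"])
    finally show ?thesis using ef by simp
  qed
qed

subsection \<open>Elliptic shifted factorials and the recurrence\<close>

lemma ell_fact_0 [simp]: "ell_fact a q p 0 = 1"
  by (simp add: ell_fact_def)

lemma ell_fact_Suc: "ell_fact a q p (Suc m) = ell_fact a q p m * theta (a * q ^ m) p"
  by (simp add: ell_fact_def)

lemma ell_fact_Suc_left: "ell_fact a q p (Suc m) = theta a p * ell_fact (a * q) q p m"
  by (simp add: ell_fact_def prod.lessThan_Suc_shift mult.assoc del: prod.lessThan_Suc)

lemma ell_fact_add: "ell_fact a q p (m + n) = ell_fact a q p m * ell_fact (a * q ^ m) q p n"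
  by (induction n) (simp_all add: ell_fact_Suc power_add mult.assoc)

lemma ell_fact_eq_0_iff: "ell_fact a q p m = 0 \<longleftrightarrow> (\<exists>j<m. theta (a * q ^ j) p = 0)"
  by (auto simp: ell_fact_def)

section \<open>Products over pairs and the change of one index\<close>

definition pair_prod :: "nat \<Rightarrow> (nat \<Rightarrow> nat \<Rightarrow> 'a :: comm_monoid_mult) \<Rightarrow> 'a" where
  "pair_prod r f = (\<Prod>i=1..r. \<Prod>j=i+1..r. f i j)"

lemma pair_prod_cong:
  assumes "\<And>u v. 1 \<le> u \<Longrightarrow> u < v \<Longrightarrow> v \<le> r \<Longrightarrow> f u v = g u v"
  shows "pair_prod r f = pair_prod r g"
  unfolding pair_prod_def using assms by (intro prod.cong refl) auto

lemma pair_prod_mult: "pair_prod r (\<lambda>u v. f u v * g u v) = pair_prod r f * pair_prod r g"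
  by (simp add: pair_prod_def prod.distrib)

text \<open>Every index other than \<open>m\<close> forms exactly one pair with \<open>m\<close>, in
  one order or the other. This describes the effect of raising a single entry of the tuple on a
  product over pairs.\<close>

lemma pair_prod_star:
  fixes g :: "nat \<Rightarrow> 'a :: comm_monoid_mult"
  assumes m: "m \<in> {1..r}"
  shows "pair_prod r (\<lambda>u v. if u = m then g v else if v = m then g u else 1) = (\<Prod>j\<in>{1..r} - {m}. g j)"
proof -
  have row: "(\<Prod>v=u+1..r. if u = m then g v else if v = m then g u else 1) =
      (if u = m then (\<Prod>v=m+1..r. g v) else if u < m then g u else 1)" if "u \<in> {1..r}" for u
  proof (cases "u < m")
    case True
    then have "(\<Prod>v=u+1..r. if u = m then g v else if v = m then g u else 1) =
        (\<Prod>v=u+1..r. if v = m then g u else 1)" by (intro prod.cong) auto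
    then show ?thesis using True m by (simp add: prod.delta)
  next
    case False
    show ?thesis
    proof (cases "u = m")
      case neq: False
      then have "(\<Prod>v=u+1..r. if u = m then g v else if v = m then g u else 1) = (\<Prod>v=u+1..r. 1)"
        using False by (intro prod.cong) auto
      then show ?thesis using neq False by simp
    qed simp
  qed
  have "pair_prod r (\<lambda>u v. if u = m then g v else if v = m then g u else 1) =
      (\<Prod>u=1..r. if u = m then (\<Prod>v=m+1..r. g v) else if u < m then g u else 1)"
    unfolding pair_prod_def by (rule prod.cong[OF refl row])
  also have "{1..r} = {1..<m} \<union> insert m {m+1..r}" using m by auto
  also have "(\<Prod>u\<in>{1..<m} \<union> insert m {m+1..r}. if u = m then (\<Prod>v=m+1..r. g v) else if u < m then g u else 1) =
      (\<Prod>u\<in>{1..<m}. g u) * (\<Prod>v=m+1..r. g v)"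
  proof (subst prod.union_disjoint)
    have "(\<Prod>u\<in>{1..<m}. if u = m then (\<Prod>v=m+1..r. g v) else if u < m then g u else 1) = (\<Prod>u\<in>{1..<m}. g u)"
      by (intro prod.cong) auto
    moreover have "(\<Prod>u\<in>{m+1..r}. if u = m then (\<Prod>v=m+1..r. g v) else if u < m then g u else 1) = 1"
      by (intro prod.neutral) auto
    ultimately show "(\<Prod>u\<in>{1..<m}. if u = m then (\<Prod>v=m+1..r. g v) else if u < m then g u else 1) *
        (\<Prod>u\<in>insert m {m+1..r}. if u = m then (\<Prod>v=m+1..r. g v) else if u < m then g u else 1) =
        (\<Prod>u\<in>{1..<m}. g u) * (\<Prod>v=m+1..r. g v)" by simp
  qed auto
  also have "\<dots> = (\<Prod>j\<in>{1..<m} \<union> {m+1..r}. g j)" by (rule prod.union_disjoint[symmetric]) auto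
  also have "{1..<m} \<union> {m+1..r} = {1..r} - {m}" using m by auto
  finally show ?thesis .
qed

lemma pair_prod_update:
  fixes f :: "nat \<Rightarrow> nat \<Rightarrow> 'a :: comm_monoid_mult"
  assumes m: "m \<in> {1..r}"
    and eq: "\<And>u v. 1 \<le> u \<Longrightarrow> u < v \<Longrightarrow> v \<le> r \<Longrightarrow>
      f' u v = f u v * (if u = m then g v else if v = m then g u else 1)"
  shows "pair_prod r f' = pair_prod r f * (\<Prod>j\<in>{1..r} - {m}. g j)"
  using pair_prod_star[OF m, of g] pair_prod_cong[of r f', OF eq] by (simp add: pair_prod_mult)

lemma tsum_update:
  assumes "i \<in> {1..r}"
  shows "tsum r (k(i := Suc (k i))) = Suc (tsum r k)"
proof -
  have "tsum r (k(i := Suc (k i))) = (\<Sum>j\<in>{1..r}. k j + (if j = i then 1 else 0))"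
    unfolding tsum_def by (intro sum.cong) auto
  then show ?thesis using assms by (simp add: sum.distrib tsum_def sum.delta)
qed

lemma tsum_ge: "i \<in> {1..r} \<Longrightarrow> k i \<le> tsum r k"
  unfolding tsum_def by (intro member_le_sum) auto

section \<open>The part of the summand that depends on b\<close>

locale theta_setting =
  fixes p q :: complex and r :: nat and x b :: "nat \<Rightarrow> complex"
  assumes p: "norm p < 1" and q0: "q \<noteq> 0"
    and q_pow: "\<And>n. n > 0 \<Longrightarrow> theta (q ^ n) p \<noteq> 0"
    and x0: "\<And>i. i \<in> {1..r} \<Longrightarrow> x i \<noteq> 0"
    and b0: "\<And>i. i \<in> {1..r} \<Longrightarrow> b i \<noteq> 0"
begin

abbreviation th :: "complex \<Rightarrow> complex" where "th u \<equiv> theta u p"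

definition X :: "(nat \<Rightarrow> nat) \<Rightarrow> nat \<Rightarrow> complex" where "X k i = x i * q ^ (3 * k i)"

lemma X0: "i \<in> {1..r} \<Longrightarrow> X k i \<noteq> 0"
  using x0 q0 by (simp add: X_def)

lemma X_update: "X (k(i := Suc (k i))) j = (if j = i then q ^ 3 * X k i else X k j)"
  by (simp add: X_def power_add)

lemma prod_X: "(\<Prod>i=1..r. X k i) = q ^ (3 * tsum r k) * (\<Prod>i=1..r. x i)"
  by (simp add: X_def tsum_def prod.distrib sum_distrib_left flip: power_sum)

text \<open>\<open>Bf\<close> and \<open>Df\<close> are the part of the summand depending on \<open>b\<close> and its coefficient, normalized so
  that \<open>Bf\<close> is free of poles in \<open>b\<close>. Under \<open>(L, a q) \<rightarrow> (L + 2, a)\<close> they change by few factors only.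
  Below, lemmas named \<open>stay\<close> keep the index \<open>k\<close> in this step and those named \<open>move\<close> raise one \<open>k\<^sub>i\<close>.\<close>

definition Bf :: "complex \<Rightarrow> nat \<Rightarrow> (nat \<Rightarrow> nat) \<Rightarrow> complex" where
  "Bf a N k = (\<Prod>j=1..r. ell_fact (a * q ^ (tsum r k + 1) / b j) q p (N - 2 * tsum r k) / b j ^ tsum r k
     * (\<Prod>i=1..r. ell_fact (b j * x i) (q ^ 3) p (k i)
         * ell_fact (a\<^sup>2 * q ^ (N + 1) * x i / b j) (q ^ 3) p (k i)))"

text \<open>Since c = a^2 q^(N+1) is unchanged, only the q-string grows, by one factor at each end.
  The two new factors are theta(w/b_j) and theta(c/(w b_j)) with w = a q^(|k|+1).\<close>

lemma Bf_stay:
  assumes "2 * tsum r k \<le> L"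
  shows "Bf a (L + 2) k = Bf (a * q) L k *
    (\<Prod>j=1..r. th (a * q ^ (tsum r k + 1) / b j) * th (a * q ^ (L + 2) / q ^ tsum r k / b j))"
proof -
  define n where "n = tsum r k"
  obtain d where L: "L = 2 * n + d" using assms le_Suc_ex by (auto simp: n_def)
  have E: "ell_fact (a * q ^ (n + 1) / b j) q p (L + 2 - 2 * n) =
      ell_fact (a * q * q ^ (n + 1) / b j) q p (L - 2 * n) *
      (th (a * q ^ (n + 1) / b j) * th (a * q ^ (L + 2) / q ^ n / b j))" for j
  proof -
    have "q ^ (2 * n) = q ^ n * q ^ n" by (simp add: mult_2 power_add)
    then have 2: "a * q * q ^ (n + 1) / b j * q ^ d = a * q ^ (L + 2) / q ^ n / b j"
      using q0 by (simp add: L power_add power2_eq_square)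
    have 1: "a * q ^ (n + 1) / b j * q = a * q * q ^ (n + 1) / b j" by simp
    have d: "L + 2 - 2 * n = Suc (Suc d)" "L - 2 * n = d" by (simp_all add: L)
    show ?thesis unfolding d
      by (simp only: ell_fact_Suc_left[of _ _ _ "Suc d"] 1 ell_fact_Suc[of _ _ _ d] 2) (simp only: mult_ac)
  qed
  have C: "(a * q)\<^sup>2 * q ^ (L + 1) = a\<^sup>2 * q ^ (L + 2 + 1)"
    by (simp add: power2_eq_square mult_ac)
  show ?thesis
    unfolding Bf_def n_def[symmetric] E C prod.distrib[symmetric] by (intro prod.cong) simp_all
qed

text \<open>Raising |k| by one compensates the change of a and N, so the q-string remains the same.
  What is gained is one factor in each of the two q^3-strings of index i and one more division by
  every b_j.\<close>

lemma Bf_move: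
  assumes "2 * tsum r k \<le> L" and i: "i \<in> {1..r}"
  shows "Bf a (L + 2) (k(i := Suc (k i))) = Bf (a * q) L k *
    (\<Prod>j=1..r. th (b j * X k i) * th (a\<^sup>2 * q ^ (L + 3) * X k i / b j) / b j)"
proof -
  define c where "c = a\<^sup>2 * q ^ (L + 3)"
  have c: "a\<^sup>2 * q ^ (L + 2 + 1) = c" "(a * q)\<^sup>2 * q ^ (L + 1) = c"
    by (simp_all add: c_def power2_eq_square mult_ac numeral_3_eq_3)
  have P: "(\<Prod>l=1..r. ell_fact (b j * x l) (q ^ 3) p ((k(i := Suc (k i))) l)
         * ell_fact (c * x l / b j) (q ^ 3) p ((k(i := Suc (k i))) l)) =
      (\<Prod>l=1..r. ell_fact (b j * x l) (q ^ 3) p (k l) * ell_fact (c * x l / b j) (q ^ 3) p (k l))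
      * (th (b j * X k i) * th (c * X k i / b j))" for j
  proof -
    have "(\<Prod>l=1..r. ell_fact (b j * x l) (q ^ 3) p ((k(i := Suc (k i))) l)
         * ell_fact (c * x l / b j) (q ^ 3) p ((k(i := Suc (k i))) l)) =
      (\<Prod>l=1..r. (ell_fact (b j * x l) (q ^ 3) p (k l) * ell_fact (c * x l / b j) (q ^ 3) p (k l))
        * (if l = i then th (b j * X k i) * th (c * X k i / b j) else 1))"
      by (intro prod.cong) (auto simp: ell_fact_Suc X_def power_mult[of q 3] mult.assoc mult.left_commute)
    then show ?thesis using i by (simp add: prod.distrib prod.delta)
  qed
  show ?thesis
    unfolding Bf_def tsum_update[OF i] c P prod.distrib[symmetric] c_def[symmetric]
    by (intro prod.cong) (simp_all add: mult_ac)
qed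

text \<open>The string for (L, a q) is the string for (L + 2, a) without its two ends v/b_j and c/(v
  b_j), where v = a q^(-L).\<close>

lemma ell_fact_rhs_step:
  "(\<Prod>j=1..r. ell_fact (a * q ^ 2 / q ^ (L + 2) / b j) (q ^ 3) p (L + 2)) =
    (\<Prod>j=1..r. ell_fact (a * q * q ^ 2 / q ^ L / b j) (q ^ 3) p L) *
    (\<Prod>j=1..r. th (a * q ^ 2 / q ^ (L + 2) / b j) * th (a * q ^ (2 * L + 3) / b j))"
proof -
  have "ell_fact (a * q ^ 2 / q ^ (L + 2) / b j) (q ^ 3) p (L + 2) =
    ell_fact (a * q * q ^ 2 / q ^ L / b j) (q ^ 3) p L *
    (th (a * q ^ 2 / q ^ (L + 2) / b j) * th (a * q ^ (2 * L + 3) / b j))" for j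
  proof -
    have 1: "a * q ^ 2 / q ^ (L + 2) / b j * q ^ 3 = a * q * q ^ 2 / q ^ L / b j"
      using q0 by (simp add: power_add power2_eq_square power3_eq_cube field_simps)
    have "(q ^ 3) ^ L = q ^ L * q ^ (2 * L)" by (simp flip: power_mult power_add)
    then have 2: "a * q * q ^ 2 / q ^ L / b j * (q ^ 3) ^ L = a * q ^ (2 * L + 3) / b j"
      using q0 by (simp add: power_add power2_eq_square power3_eq_cube)
    have "ell_fact (a * q ^ 2 / q ^ (L + 2) / b j) (q ^ 3) p (Suc (Suc L)) =
      th (a * q ^ 2 / q ^ (L + 2) / b j) * (ell_fact (a * q * q ^ 2 / q ^ L / b j) (q ^ 3) p L *
        th (a * q ^ (2 * L + 3) / b j))"
      by (simp only: ell_fact_Suc_left[of _ _ _ "Suc L"] 1 ell_fact_Suc[of _ _ _ L] 2)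
    then show ?thesis by (simp add: mult_ac)
  qed
  then show ?thesis by (simp add: prod.distrib)
qed

end

section \<open>Lagrange interpolation in the parameters b\<close>

lemma theta_antisym_three_term:
  assumes p: "norm p < 1" and c: "c \<noteq> 0" and nz: "x \<noteq> 0" "y \<noteq> 0" "u \<noteq> 0" "v \<noteq> 0"
  defines "h \<equiv> \<lambda>u v. v * (theta (u / v) p * theta (c / (u * v)) p)"
  shows "h x y * h u v - h x v * h u y = h y v * h x u" "h u v = - h v u"
proof -
  \<comment> \<open>In the variables divided by a root of c, h(u, v) is -(c/u) theta(uv) theta(u/v),
    so the three-term relation is the addition formula up to prefactors.\<close>
  define g where "g = csqrt c"
  have gg: "c = g * g" unfolding g_def by (metis power2_csqrt power2_eq_square)
  then have g: "g \<noteq> 0" using c by auto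
  have h: "h u v = - (g * g / u) * (theta (u / g * (v / g)) p * theta (u / g / (v / g)) p)"
    if "u \<noteq> 0" "v \<noteq> 0" for u v
  proof -
    have "theta (c / (u * v)) p = - (c / (u * v)) * theta (u * v / c) p"
      using theta_swap[of p "u * v" c] p c that by simp
    moreover have "u / g * (v / g) = u * v / c" "u / g / (v / g) = u / v" using g by (simp_all add: gg)
    ultimately show ?thesis unfolding h_def using that by (simp add: gg)
  qed
  have "theta (x / g * (y / g)) p * theta (x / g / (y / g)) p * theta (u / g * (v / g)) p * theta (u / g / (v / g)) p
    - theta (x / g * (v / g)) p * theta (x / g / (v / g)) p * theta (u / g * (y / g)) p * theta (u / g / (y / g)) p
    = u / g / (y / g) * (theta (y / g * (v / g)) p * theta (y / g / (v / g)) p * theta (x / g * (u / g)) p * theta (x / g / (u / g)) p)"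
    by (rule theta_addition) (use p nz g in auto)
  moreover have "u / g / (y / g) = u / y" using g by simp
  ultimately have *: "theta (x / g * (y / g)) p * theta (x / g / (y / g)) p * (theta (u / g * (v / g)) p * theta (u / g / (v / g)) p)
    - theta (x / g * (v / g)) p * theta (x / g / (v / g)) p * (theta (u / g * (y / g)) p * theta (u / g / (y / g)) p)
    = u / y * (theta (y / g * (v / g)) p * theta (y / g / (v / g)) p * (theta (x / g * (u / g)) p * theta (x / g / (u / g)) p))"
    (is "?a * ?b - ?c * ?d = _ * (?e * ?f)")
    by (simp only: mult.assoc)
  have ring: "(- (G / x) * A) * (- (G / u) * B) - (- (G / x) * C) * (- (G / u) * D) =
      G * G / (x * u) * (A * B - C * D)" for A B C D G :: complex
    by (simp add: algebra_simps diff_divide_distrib)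
  have "h x y * h u v - h x v * h u y = (g * g) * (g * g) / (x * u) * (?a * ?b - ?c * ?d)"
    unfolding h[OF nz(1,2)] h[OF nz(3,4)] h[OF nz(1,4)] h[OF nz(3,2)] by (rule ring)
  also have "\<dots> = h y v * h x u"
    unfolding * h[OF nz(2,4)] h[OF nz(1,3)] using nz by (simp add: mult_ac)
  finally show "h x y * h u v - h x v * h u y = h y v * h x u" .
  show "h u v = - h v u"
    using theta_swap[of p u v] p nz by (simp add: h_def mult.commute[of u v])
qed

context theta_setting
begin

text \<open>\<open>Lf0\<close> and \<open>Lf\<close> are the Lagrange coefficients at the nodes \<open>w\<close> and \<open>1 / X\<^sub>i\<close>.\<close>

definition Lf0 :: "complex \<Rightarrow> complex \<Rightarrow> complex \<Rightarrow> (nat \<Rightarrow> nat) \<Rightarrow> complex" where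
  "Lf0 c v w k = (\<Prod>l=1..r. (th (v * X k l) * th (c / v * X k l)) / (th (w * X k l) * th (c / w * X k l)))"

definition Lf :: "complex \<Rightarrow> complex \<Rightarrow> complex \<Rightarrow> (nat \<Rightarrow> nat) \<Rightarrow> nat \<Rightarrow> complex" where
  "Lf c v w k i = (- 1 / X k i) ^ r * (th (v / w) * th (c / (v * w)) / (th (1 / (w * X k i)) * th (c / w * X k i)))
    * (\<Prod>l\<in>{1..r} - {i}. th (v * X k l) * th (c / v * X k l) / (th (X k l / X k i) * th (c * X k i * X k l)))"

text \<open>The node \<open>w\<close> gets index 0 and the node 1/X_i index i, which makes r + 1
  nodes for the r factors h(v, b_j). The product of the b_j contained in the definition of h is
  common to all terms and cancels.\<close>

lemma theta_lagrange:
  assumes c: "c \<noteq> 0" and v: "v \<noteq> 0" and w: "w \<noteq> 0"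
    and wX: "\<And>i. i \<in> {1..r} \<Longrightarrow> th (w * X k i) \<noteq> 0 \<and> th (c / w * X k i) \<noteq> 0"
    and XX: "\<And>i l. i \<in> {1..r} \<Longrightarrow> l \<in> {1..r} \<Longrightarrow> i \<noteq> l \<Longrightarrow>
      th (X k l / X k i) \<noteq> 0 \<and> th (c * X k i * X k l) \<noteq> 0"
  shows "(\<Prod>j=1..r. th (v / b j) * th (c / v / b j)) =
    Lf0 c v w k * (\<Prod>j=1..r. th (w / b j) * th (c / w / b j))
    + (\<Sum>i=1..r. Lf c v w k i * (\<Prod>j=1..r. th (b j * X k i) * th (c * X k i / b j) / b j))"
proof -
  define h where "h = (\<lambda>u v. v * (th (u / v) * th (c / (u * v))))"
  define y where "y i = (if i = 0 then w else 1 / X k i)" for i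
  have y0: "y i \<noteq> 0" if "i \<le> r" for i using that w X0 by (auto simp: y_def)
  have hy: "h u (y i) = 1 / X k i * (th (u * X k i) * th (c / u * X k i))" if "i \<in> {1..r}" for u i
    using that by (simp add: h_def y_def)
  have h0: "h (1 / X k i) w = w * (th (1 / (w * X k i)) * th (c / w * X k i))" for i
    by (simp add: h_def mult.commute)
  have anti: "h u v = - h v u" if "u \<noteq> 0" "v \<noteq> 0" for u v
    unfolding h_def using theta_antisym_three_term(2)[OF p c, of 1 1 u v] that by simp
  have hw: "h w (y i) \<noteq> 0" if "i \<in> {1..r}" for i using that wX X0 by (simp add: hy)
  have hXX: "h (1 / X k i) (y l) = 1 / X k l * (th (X k l / X k i) * th (c * X k i * X k l))"
    if "i \<in> {1..r}" "l \<in> {1..r}" for i l using that X0 by (simp add: hy)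
  have ne: "h (y i) (y l) \<noteq> 0" if il: "i \<in> {0..r}" "l \<in> {0..r}" "i \<noteq> l" for i l
  proof -
    consider "i = 0" "l \<in> {1..r}" | "l = 0" "i \<in> {1..r}" | "i \<in> {1..r}" "l \<in> {1..r}"
      using il by fastforce
    then show ?thesis
    proof cases
      case 1 then show ?thesis using hw by (simp add: y_def)
    next
      case 2 then show ?thesis using hw[of i] anti[of "y i" "y l"] y0[of i] y0[of l] by (simp add: y_def)
    next
      case 3 then show ?thesis using hXX[of i l] XX[of i l] il X0[of l] by (simp add: y_def)
    qed
  qed
  have "(\<Prod>j\<in>{1..r}. h v (b j)) =
    (\<Sum>i\<in>{0..r}. (\<Prod>l\<in>{0..r} - {i}. h v (y l) / h (y i) (y l)) * (\<Prod>j\<in>{1..r}. h (y i) (b j)))"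
  proof (rule lagrange_three_term[where D = "- {0}" and h = h and y = y and z = b and I = "{0..r}" and J = "{1..r}" and v = v])
    show "h u v = - h v u" if "u \<in> - {0}" "v \<in> - {0}" for u v
      by (rule anti) (use that in auto)
    show "h x y * h u v - h x v * h u y = h y v * h x u"
      if "x \<in> - {0}" "y \<in> - {0}" "u \<in> - {0}" "v \<in> - {0}" for x y u v
      using theta_antisym_three_term(1)[OF p c, of x y u v] that unfolding h_def by simp
    show "y ` {0..r} \<subseteq> - {0}" using y0 by auto
    show "b ` {1..r} \<subseteq> - {0}" using b0 by auto
    show "v \<in> - {0}" using v by simp
    show "h (y i) (y l) \<noteq> 0" if "i \<in> {0..r}" "l \<in> {0..r}" "i \<noteq> l" for i l using ne that .
  qed simp_all
  also have "{0..r} = insert 0 {1..r}" by auto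
  also have "(\<Sum>i\<in>insert 0 {1..r}. (\<Prod>l\<in>insert 0 {1..r} - {i}. h v (y l) / h (y i) (y l)) * (\<Prod>j\<in>{1..r}. h (y i) (b j))) =
      (\<Prod>l\<in>insert 0 {1..r} - {0}. h v (y l) / h (y 0) (y l)) * (\<Prod>j=1..r. h (y 0) (b j)) +
      (\<Sum>i=1..r. (\<Prod>l\<in>insert 0 {1..r} - {i}. h v (y l) / h (y i) (y l)) * (\<Prod>j=1..r. h (y i) (b j)))"
    by (rule sum.insert) auto
  also have "insert 0 {1..r} - {0} = {1..r}" by auto
  also have "y 0 = w" by (simp add: y_def)
  finally have main: "(\<Prod>j=1..r. h v (b j)) =
      (\<Prod>l=1..r. h v (y l) / h w (y l)) * (\<Prod>j=1..r. h w (b j)) +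
      (\<Sum>i=1..r. (\<Prod>l\<in>insert 0 {1..r} - {i}. h v (y l) / h (y i) (y l)) * (\<Prod>j=1..r. h (y i) (b j)))" .
  define P where "P = (\<Prod>j=1..r. b j)"
  have P: "P \<noteq> 0" using b0 by (simp add: P_def)
  have hb: "(\<Prod>j=1..r. h u (b j)) = P * (\<Prod>j=1..r. th (u / b j) * th (c / u / b j))" for u
    by (simp add: h_def P_def prod.distrib)
  have 0: "(\<Prod>l=1..r. h v (y l) / h w (y l)) = Lf0 c v w k"
    unfolding Lf0_def by (intro prod.cong refl) (use X0 in \<open>simp add: hy\<close>)
  have i: "(\<Prod>l\<in>insert 0 {1..r} - {i}. h v (y l) / h (y i) (y l)) * (\<Prod>j=1..r. h (y i) (b j))
    = P * (Lf c v w k i * (\<Prod>j=1..r. th (b j * X k i) * th (c * X k i / b j) / b j))" if i: "i \<in> {1..r}" for i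
  proof -
    have yi: "y i = 1 / X k i" using i by (simp add: y_def)
    have e: "insert 0 {1..r} - {i} = insert 0 ({1..r} - {i})" using i by auto
    have 1: "h v (y 0) / h (y i) (y 0) = th (v / w) * th (c / (v * w)) / (th (1 / (w * X k i)) * th (c / w * X k i))"
      using w unfolding yi by (simp add: y_def h0) (simp add: h_def)
    have 2: "(\<Prod>l\<in>{1..r} - {i}. h v (y l) / h (y i) (y l)) =
      (\<Prod>l\<in>{1..r} - {i}. th (v * X k l) * th (c / v * X k l) / (th (X k l / X k i) * th (c * X k i * X k l)))"
      unfolding yi by (intro prod.cong refl) (use X0 i hXX in \<open>simp add: hy\<close>)
    \<comment> \<open>Inverting theta(1/(X_i b_j)) costs -1/X_i for each j; together these make the
      power \<open>(- 1 / X k i) ^ r\<close> in \<open>Lf\<close>.\<close>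
    have "h (y i) (b j) = b j * ((- 1 / X k i) * (th (b j * X k i) * th (c * X k i / b j) / b j))"
      if j: "j \<in> {1..r}" for j
    proof -
      have "th (1 / (X k i * b j)) = - th (X k i * b j) / (X k i * b j)"
        by (rule theta_inverse[OF p]) (use X0 i b0 j in simp)
      then show ?thesis unfolding yi h_def using b0[OF j] X0[OF i, of k]
        by (simp add: mult.commute[of "X k i" "b j"])
    qed
    then have "(\<Prod>j=1..r. h (y i) (b j)) =
        (\<Prod>j=1..r. b j * ((- 1 / X k i) * (th (b j * X k i) * th (c * X k i / b j) / b j)))"
      by (rule prod.cong[OF refl])
    then have 3: "(\<Prod>j=1..r. h (y i) (b j)) = P * ((- 1 / X k i) ^ r * (\<Prod>j=1..r. th (b j * X k i) * th (c * X k i / b j) / b j))"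
      unfolding P_def prod.distrib prod_constant by simp
    have 4: "(\<Prod>l\<in>insert 0 {1..r} - {i}. h v (y l) / h (y i) (y l)) =
        h v (y 0) / h (y i) (y 0) * (\<Prod>l\<in>{1..r} - {i}. h v (y l) / h (y i) (y l))"
      unfolding e by (rule prod.insert) auto
    show ?thesis unfolding 4 1 2 3 Lf_def by (simp only: mult_ac)
  qed
  have iS: "(\<Sum>i=1..r. (\<Prod>l\<in>insert 0 {1..r} - {i}. h v (y l) / h (y i) (y l)) * (\<Prod>j=1..r. h (y i) (b j))) =
      (\<Sum>i=1..r. P * (Lf c v w k i * (\<Prod>j=1..r. th (b j * X k i) * th (c * X k i / b j) / b j)))"
    by (rule sum.cong[OF refl i])
  have "P * (\<Prod>j=1..r. th (v / b j) * th (c / v / b j)) =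
     P * (Lf0 c v w k * (\<Prod>j=1..r. th (w / b j) * th (c / w / b j))
    + (\<Sum>i=1..r. Lf c v w k i * (\<Prod>j=1..r. th (b j * X k i) * th (c * X k i / b j) / b j)))"
    using main unfolding iS 0 unfolding hb by (simp only: distrib_left sum_distrib_left mult.left_commute)
  then show ?thesis using P by simp
qed

section \<open>The coefficient of the b-part and its change from N to N + 2\<close>

definition Ef :: "complex \<Rightarrow> (nat \<Rightarrow> nat) \<Rightarrow> complex" where
  "Ef c k = Delta r (X k) p / Delta r x p
    * (\<Prod>i=1..r. \<Prod>j=i+1..r. 1 / ell_fact (c * x i * x j) (q ^ 3) p (k i + k j))
    * (\<Prod>i=1..r. \<Prod>j=1..r. 1 / ell_fact (q ^ 3 * x i / x j) (q ^ 3) p (k i))"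

text \<open>\<open>Ef\<close> collects the factors that depend on a and N only through c, so it is
  the same on both sides of the step as long as the index stays. When k_i is raised, only the pairs
  containing i and the row i of the double product change.\<close>

lemma Ef_move:
  fixes k c i
  defines "K \<equiv> k(i := Suc (k i))"
  assumes i: "i \<in> {1..r}"
    and ne: "\<And>j. j \<in> {1..r} - {i} \<Longrightarrow> th (X k i / X k j) \<noteq> 0"
    and neK: "\<And>j. j \<in> {1..r} - {i} \<Longrightarrow> th (X K i / X k j) \<noteq> 0"
    and nx: "\<And>j. j \<in> {1..r} \<Longrightarrow> th (X K i / x j) \<noteq> 0"
    and cX: "\<And>j. j \<in> {1..r} - {i} \<Longrightarrow> th (c * X k i * X k j) \<noteq> 0"
  shows "Ef c k = Ef c K
    * (\<Prod>j\<in>{1..r} - {i}. th (X k i / X k j) * th (c * X k i * X k j) / th (X K i / X k j))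
    * (\<Prod>j=1..r. th (X K i / x j))"
proof -
  have XK: "X K j = (if j = i then q ^ 3 * X k i else X k j)" for j
    unfolding K_def by (rule X_update)
  have D: "Delta r (X k) p = Delta r (X K) p * (\<Prod>j\<in>{1..r} - {i}. th (X k i / X k j) / th (X K i / X k j))"
    unfolding Delta_def pair_prod_def[symmetric]
  proof (rule pair_prod_update[OF i])
    fix u v assume uv: "1 \<le> u" "u < v" "v \<le> r"
    \<comment> \<open>The pair factor x_j theta(x_i/x_j) of Delta is antisymmetric, so its ratio
      before and after the change does not depend on the order of the pair.\<close>
    have sw: "u' * th (s / u') = - (s * th (u' / s))" if "s \<noteq> 0" "u' \<noteq> 0" for s u'
      using theta_swap[OF p, of u' s] that by (simp add: field_simps)
    consider "u = i" | "v = i" "u \<noteq> i" | "u \<noteq> i" "v \<noteq> i" by blast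
    then show "X k v * th (X k u / X k v) = X K v * th (X K u / X K v) *
      (if u = i then th (X k i / X k v) / th (X K i / X k v)
       else if v = i then th (X k i / X k u) / th (X K i / X k u) else 1)"
    proof cases
      case 1 then show ?thesis using neK[of v] uv by (simp add: XK[of v])
    next
      case 2
      then have "X K u = X k u" "X k u \<noteq> 0" "X k i \<noteq> 0" "X K i \<noteq> 0" "th (X K i / X k u) \<noteq> 0"
        using uv i neK[of u] by (simp_all add: X0 XK[of u])
      then show ?thesis using 2 sw[of "X k u" "X k i"] sw[of "X k u" "X K i"] by simp
    qed (simp add: XK)
  qed
  have C: "(\<Prod>u=1..r. \<Prod>v=u+1..r. 1 / ell_fact (c * x u * x v) (q ^ 3) p (k u + k v)) =
    (\<Prod>u=1..r. \<Prod>v=u+1..r. 1 / ell_fact (c * x u * x v) (q ^ 3) p (K u + K v))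
    * (\<Prod>j\<in>{1..r} - {i}. th (c * X k i * X k j))"
    unfolding pair_prod_def[symmetric]
  proof (rule pair_prod_update[OF i])
    fix u v assume uv: "1 \<le> u" "u < v" "v \<le> r"
    have S: "ell_fact (c * x u * x v) (q ^ 3) p (Suc (k u + k v)) =
      ell_fact (c * x u * x v) (q ^ 3) p (k u + k v) * th (c * X k u * X k v)"
      by (simp add: ell_fact_Suc X_def power_add power_mult[of q 3] mult.assoc mult.left_commute)
    consider "u = i" | "v = i" "u \<noteq> i" | "u \<noteq> i" "v \<noteq> i" by blast
    then show "1 / ell_fact (c * x u * x v) (q ^ 3) p (k u + k v) =
       1 / ell_fact (c * x u * x v) (q ^ 3) p (K u + K v) *
       (if u = i then th (c * X k i * X k v) else if v = i then th (c * X k i * X k u) else 1)"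
    proof cases
      case 1 then show ?thesis using uv cX[of v] S by (simp add: K_def)
    next
      case 2
      then have "th (c * X k u * X k i) = th (c * X k i * X k u)" by (simp add: mult_ac)
      then show ?thesis using uv cX[of u] S 2 by (simp add: K_def)
    qed (simp add: K_def)
  qed
  have Q: "(\<Prod>u=1..r. \<Prod>v=1..r. 1 / ell_fact (q ^ 3 * x u / x v) (q ^ 3) p (k u)) =
    (\<Prod>u=1..r. \<Prod>v=1..r. 1 / ell_fact (q ^ 3 * x u / x v) (q ^ 3) p (K u)) * (\<Prod>j=1..r. th (X K i / x j))"
  proof -
    have "(\<Prod>v=1..r. 1 / ell_fact (q ^ 3 * x u / x v) (q ^ 3) p (k u)) =
      (\<Prod>v=1..r. 1 / ell_fact (q ^ 3 * x u / x v) (q ^ 3) p (K u)) *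
      (if u = i then \<Prod>j=1..r. th (X K i / x j) else 1)" if "u \<in> {1..r}" for u
    proof (cases "u = i")
      case True
      have "ell_fact (q ^ 3 * x i / x v) (q ^ 3) p (K i) =
        ell_fact (q ^ 3 * x i / x v) (q ^ 3) p (k i) * th (X K i / x v)" for v
        by (simp add: K_def ell_fact_Suc X_def power_mult[of q 3] power_add mult.assoc mult.left_commute
            del: mult_Suc_right)
      then show ?thesis using True nx unfolding prod.distrib[symmetric]
        by (auto intro!: prod.cong simp flip: prod.distrib)
    qed (simp add: K_def)
    then have "(\<Prod>u=1..r. \<Prod>v=1..r. 1 / ell_fact (q ^ 3 * x u / x v) (q ^ 3) p (k u)) =
      (\<Prod>u=1..r. (\<Prod>v=1..r. 1 / ell_fact (q ^ 3 * x u / x v) (q ^ 3) p (K u)) *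
      (if u = i then \<Prod>j=1..r. th (X K i / x j) else 1))" by (rule prod.cong[OF refl])
    then show ?thesis using i by (simp only: prod.distrib) (simp add: prod.delta)
  qed
  show ?thesis unfolding Ef_def D C Q
    by (simp add: prod.distrib prod_dividef mult_ac)
qed

text \<open>The monomial left over when all shifted factorials with an inverted argument have been
  reflected; \<open>power_part\<close> identifies it.\<close>

definition Pw :: "complex \<Rightarrow> nat \<Rightarrow> (nat \<Rightarrow> nat) \<Rightarrow> complex" where
  "Pw a N k = (- a) ^ tsum r k * q ^ (2 * tsum r k) / q ^ (N * tsum r k)
    * (\<Prod>i=1..r. q ^ (3 * (k i choose 2)) * x i ^ k i) / (\<Prod>i=1..r. x i) ^ tsum r k"

text \<open>Reflected, (q^(-N);q)_(2n) runs over the exponents N-2n+1, ..., N, and (q^(N+1);q)_n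
  continues it to a single string of length 3n. The quotient of powers avoids truncated
  subtraction.\<close>

definition F1 :: "nat \<Rightarrow> nat \<Rightarrow> complex" where
  "F1 N n = ell_fact (q ^ (N + 1) / q ^ (2 * n)) q p (3 * n)"

text \<open>The string (a x_i q^(2-N); q^3)_N without its first k_i factors.\<close>

definition F2 :: "complex \<Rightarrow> nat \<Rightarrow> (nat \<Rightarrow> nat) \<Rightarrow> nat \<Rightarrow> complex" where
  "F2 a N k i = ell_fact (a * X k i * q ^ 2 / q ^ N) (q ^ 3) p (N - k i)"

text \<open>The string of a x_i q^s for |k| <= s <= N - |k| + 3 k_i. It is what
  \<open>x_part\<close> leaves of the three q-factorials in a x_i.\<close>

definition F3 :: "complex \<Rightarrow> nat \<Rightarrow> (nat \<Rightarrow> nat) \<Rightarrow> nat \<Rightarrow> complex" where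
  "F3 a N k i = ell_fact (a * x i * q ^ tsum r k) q p (N - 2 * tsum r k + 3 * k i + 1)"

definition Df :: "complex \<Rightarrow> nat \<Rightarrow> (nat \<Rightarrow> nat) \<Rightarrow> complex" where
  "Df a N k = Pw a N k * F1 N (tsum r k) * Ef (a\<^sup>2 * q ^ (N + 1)) k
    * (\<Prod>i=1..r. th (a * X k i * q ^ tsum r k) * F2 a N k i / F3 a N k i)"

lemma Pw_stay: "Pw (a * q) L k = q ^ (3 * tsum r k) * Pw a (L + 2) k"
proof -
  define n where "n = tsum r k"
  define T where "T = (\<Prod>i=1..r. q ^ (3 * (k i choose 2)) * x i ^ k i)"
  define U where "U = (\<Prod>i=1..r. x i)"
  have 1: "(- (a * q)) ^ n = (- a) ^ n * q ^ n" by (simp flip: power_mult_distrib)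
  have 2: "q ^ ((L + 2) * n) = q ^ (L * n) * (q ^ n * q ^ n)"
    by (simp add: distrib_right power_add mult_2)
  have "3 * n = n + (n + n)" by simp
  then have 3: "q ^ (3 * n) = q ^ n * (q ^ n * q ^ n)" by (simp only: power_add)
  show ?thesis
    unfolding Pw_def n_def[symmetric] T_def[symmetric] U_def[symmetric] 1 2 3 using q0 by simp
qed

text \<open>Raising k_i adds k_i to the binomial \<open>k i choose 2\<close>, so the monomial of
  index i gains q^(3 k_i) x_i = X_i.\<close>

lemma Pw_move:
  assumes i: "i \<in> {1..r}" and a: "a \<noteq> 0"
  shows "Pw (a * q) L k = Pw a (L + 2) (k(i := Suc (k i)))
    * (- (q ^ (L + 3 * tsum r k + 3) * (\<Prod>j=1..r. x j)) / (a * (q ^ 3 * X k i)))"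
proof -
  define n where "n = tsum r k"
  define T where "T = (\<Prod>i=1..r. q ^ (3 * (k i choose 2)) * x i ^ k i)"
  define U where "U = (\<Prod>i=1..r. x i)"
  have U: "U \<noteq> 0" unfolding U_def using x0 by auto
  have "(\<Prod>j=1..r. q ^ (3 * ((k(i := Suc (k i))) j choose 2)) * x j ^ (k(i := Suc (k i))) j) =
     (\<Prod>j=1..r. (q ^ (3 * (k j choose 2)) * x j ^ k j) * (if j = i then X k i else 1))"
    by (intro prod.cong)
      (auto simp: X_def numeral_2_eq_2 distrib_left power_add mult_ac)
  then have T: "(\<Prod>j=1..r. q ^ (3 * ((k(i := Suc (k i))) j choose 2)) * x j ^ (k(i := Suc (k i))) j) = T * X k i"
    using i by (simp add: T_def prod.distrib prod.delta)
  have 1: "(- (a * q)) ^ n = (- a) ^ n * q ^ n" by (simp flip: power_mult_distrib)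
  have 2: "q ^ ((L + 2) * Suc n) = q ^ (L * n) * (q ^ n * q ^ n) * (q ^ L * q ^ 2)"
    by (simp add: distrib_right power_add mult_2 power2_eq_square mult_ac)
  have "L + 3 * n + 3 = L + (n + (n + n)) + 3" by simp
  then have 3: "q ^ (L + 3 * n + 3) = q ^ L * (q ^ n * (q ^ n * q ^ n)) * q ^ 3"
    by (simp only: power_add)
  have 4: "q ^ (2 * Suc n) = q ^ (2 * n) * q ^ 2" by (simp flip: power_add)
  show ?thesis
    unfolding Pw_def tsum_update[OF i] T n_def[symmetric] T_def[symmetric] U_def[symmetric] 1 2 3 4
    using q0 a U X0[OF i, of k] by (simp add: field_simps)
qed

text \<open>The string of length 3n + 2 starting at q^(L+1-2n) is split in two ways: two factors off
  its end, or two off its start.\<close>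

lemma F1_stay:
  "F1 L n * (th (q ^ (L + n + 1)) * th (q ^ (L + n + 2))) =
    th (q ^ (L + 1) / q ^ (2 * n)) * th (q ^ (L + 2) / q ^ (2 * n)) * F1 (L + 2) n"
proof -
  define s where "s = q ^ (L + 1) / q ^ (2 * n)"
  have q3: "q ^ (3 * n) = q ^ n * q ^ (2 * n)" by (simp flip: power_add)
  have e: "s * q = q ^ (L + 2) / q ^ (2 * n)" "s * q * q = q ^ (L + 2 + 1) / q ^ (2 * n)"
    "s * q ^ (3 * n) = q ^ (L + n + 1)" "s * q ^ Suc (3 * n) = q ^ (L + n + 2)"
    using q0 by (simp_all add: s_def q3 power_add)
  have "ell_fact s q p (Suc (Suc (3 * n))) = ell_fact s q p (3 * n) * th (s * q ^ (3 * n)) * th (s * q ^ Suc (3 * n))"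
    by (simp only: ell_fact_Suc)
  moreover have "ell_fact s q p (Suc (Suc (3 * n))) = th s * (th (s * q) * ell_fact (s * q * q) q p (3 * n))"
    by (simp only: ell_fact_Suc_left)
  ultimately show ?thesis unfolding F1_def e unfolding s_def by (simp add: mult_ac)
qed

lemma F1_move:
  "F1 (L + 2) (Suc n) = F1 L n * (th (q ^ (L + n + 1)) * th (q ^ (L + n + 2)) * th (q ^ (L + n + 3)))"
proof -
  define s where "s = q ^ (L + 1) / q ^ (2 * n)"
  have q3: "q ^ (3 * n) = q ^ n * q ^ (2 * n)" by (simp flip: power_add)
  have s: "q ^ (L + 2 + 1) / q ^ (2 * Suc n) = s"
    using q0 by (simp add: s_def power2_eq_square power_add)
  have e: "s * q ^ (3 * n) = q ^ (L + n + 1)" "s * q ^ Suc (3 * n) = q ^ (L + n + 2)"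
    "s * q ^ Suc (Suc (3 * n)) = q ^ (L + n + 3)"
    using q0 by (simp_all add: s_def q3 power_add eval_nat_numeral)
  have d: "3 * Suc n = Suc (Suc (Suc (3 * n)))" by simp
  show ?thesis
    unfolding F1_def s d ell_fact_Suc e unfolding s_def by (simp only: mult.assoc)
qed

lemma F2_stay:
  assumes "k i \<le> L"
  shows "F2 a (L + 2) k i =
    th (a * q ^ 2 / q ^ (L + 2) * X k i) * F2 (a * q) L k i * th (a * x i * q ^ (2 * L + 3))"
proof -
  obtain d where L: "L = k i + d" using assms le_Suc_ex by blast
  define s where "s = a * q ^ 2 / q ^ (L + 2) * X k i"
  have s: "a * X k i * q ^ 2 / q ^ (L + 2) = s" by (simp add: s_def)
  have s3: "s * q ^ 3 = a * q * X k i * q ^ 2 / q ^ L"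
    using q0 by (simp add: s_def power_add eval_nat_numeral)
  have "q ^ (3 * k i) * q ^ (3 * d) = q ^ (2 * L) * q ^ L"
    by (simp add: L flip: power_add)
  then have "X k i * (q ^ 3) ^ d = x i * q ^ (2 * L) * q ^ L"
    by (simp add: X_def power_mult[of q 3 d, symmetric] mult.assoc)
  then have "s * q ^ 3 * (q ^ 3) ^ d = a * q * q ^ 2 / q ^ L * (x i * q ^ (2 * L) * q ^ L)"
    unfolding s3 by (simp add: mult_ac)
  also have "\<dots> = a * x i * q ^ (2 * L + 3)"
    using q0 by (simp add: power_add eval_nat_numeral)
  finally have e: "s * q ^ 3 * (q ^ 3) ^ d = a * x i * q ^ (2 * L + 3)" .
  have d: "L + 2 - k i = Suc (Suc d)" "L - k i = d" by (simp_all add: L)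
  have "ell_fact s (q ^ 3) p (Suc (Suc d)) = th s * (ell_fact (s * q ^ 3) (q ^ 3) p d * th (s * q ^ 3 * (q ^ 3) ^ d))"
    by (simp only: ell_fact_Suc_left[of _ _ _ "Suc d"] ell_fact_Suc[of _ _ _ d])
  then show ?thesis unfolding F2_def d s unfolding e unfolding s3 s_def[symmetric] by (simp only: mult.assoc)
qed

lemma F2_move:
  assumes "k i \<le> L"
  shows "F2 a (L + 2) (k(i := Suc (k i))) i = F2 (a * q) L k i * th (a * x i * q ^ (2 * L + 3))"
proof -
  obtain d where L: "L = k i + d" using assms le_Suc_ex by blast
  define s where "s = a * q * X k i * q ^ 2 / q ^ L"
  have s: "a * X (k(i := Suc (k i))) i * q ^ 2 / q ^ (L + 2) = s"
    using q0 by (simp add: s_def X_update power_add eval_nat_numeral)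
  have "q ^ (3 * k i) * q ^ (3 * d) = q ^ (2 * L) * q ^ L"
    by (simp add: L flip: power_add)
  then have "X k i * (q ^ 3) ^ d = x i * q ^ (2 * L) * q ^ L"
    by (simp add: X_def power_mult[of q 3 d, symmetric] mult.assoc)
  then have "s * (q ^ 3) ^ d = a * q * q ^ 2 / q ^ L * (x i * q ^ (2 * L) * q ^ L)"
    unfolding s_def by (simp add: mult_ac)
  also have "\<dots> = a * x i * q ^ (2 * L + 3)"
    using q0 by (simp add: power_add eval_nat_numeral)
  finally have e: "s * (q ^ 3) ^ d = a * x i * q ^ (2 * L + 3)" .
  have d: "L + 2 - (k(i := Suc (k i))) i = Suc d" "L - k i = d" by (simp_all add: L)
  show ?thesis unfolding F2_def d s ell_fact_Suc e unfolding s_def ..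
qed

lemma F3_stay:
  assumes "2 * tsum r k \<le> L"
  shows "F3 a (L + 2) k i = th (a * x i * q ^ tsum r k) * F3 (a * q) L k i *
    th (a * q ^ (L + 2) / q ^ tsum r k * X k i)"
proof -
  define n where "n = tsum r k"
  obtain d where L: "L = 2 * n + d" using assms le_Suc_ex n_def by blast
  define s where "s = a * x i * q ^ n"
  have sq: "s * q = a * q * x i * q ^ n" by (simp add: s_def)
  have "q ^ (2 * n) = q ^ n * q ^ n" by (simp add: mult_2 power_add)
  then have e: "s * q * q ^ Suc (d + 3 * k i) = a * q ^ (L + 2) / q ^ n * X k i"
    using q0 by (simp add: s_def L X_def power_add power2_eq_square)
  have d: "L + 2 - 2 * n + 3 * k i + 1 = Suc (Suc (Suc (d + 3 * k i)))"
    "L - 2 * n + 3 * k i + 1 = Suc (d + 3 * k i)" by (simp_all add: L)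
  have "ell_fact s q p (Suc (Suc (Suc (d + 3 * k i)))) =
      th s * (ell_fact (s * q) q p (Suc (d + 3 * k i)) * th (s * q * q ^ Suc (d + 3 * k i)))"
    by (simp only: ell_fact_Suc_left[of _ _ _ "Suc (Suc (d + 3 * k i))"] ell_fact_Suc[of _ _ _ "Suc (d + 3 * k i)"])
  then show ?thesis unfolding F3_def n_def[symmetric] d s_def[symmetric] unfolding e unfolding sq by (simp only: mult.assoc)
qed

text \<open>For j other than i both the starting point a x_j q^(|k|+1) and the length are unchanged;
  for j = i three factors are appended, because of the 3 k_i in the length.\<close>

lemma F3_move:
  assumes "2 * tsum r k \<le> L" and i: "i \<in> {1..r}"
  shows "F3 a (L + 2) (k(i := Suc (k i))) i = F3 (a * q) L k i *
    (th (a * q ^ (L + 2) / q ^ tsum r k * X k i) * th (a * q ^ (L + 3) / q ^ tsum r k * X k i)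
      * th (a * q ^ (L + 4) / q ^ tsum r k * X k i))"
    and "j \<noteq> i \<Longrightarrow> F3 a (L + 2) (k(i := Suc (k i))) j = F3 (a * q) L k j"
proof -
  define n where "n = tsum r k"
  obtain d where L: "L = 2 * n + d" using assms le_Suc_ex n_def by blast
  have s: "a * x j * q ^ Suc n = a * q * x j * q ^ n" for j by simp
  show "j \<noteq> i \<Longrightarrow> F3 a (L + 2) (k(i := Suc (k i))) j = F3 (a * q) L k j"
    unfolding F3_def tsum_update[OF i] n_def[symmetric] s by (simp add: L)
  define s where "s = a * q * x i * q ^ n"
  have "q ^ (2 * n) = q ^ n * q ^ n" by (simp add: mult_2 power_add)
  then have e: "s * q ^ (Suc (d + 3 * k i)) = a * q ^ (L + 2) / q ^ n * X k i"
    "s * q ^ (Suc (Suc (d + 3 * k i))) = a * q ^ (L + 3) / q ^ n * X k i"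
    "s * q ^ (Suc (Suc (Suc (d + 3 * k i)))) = a * q ^ (L + 4) / q ^ n * X k i"
    using q0 by (simp_all add: s_def L X_def power_add eval_nat_numeral)
  have d: "L + 2 - 2 * Suc n + 3 * (k(i := Suc (k i))) i + 1 = Suc (Suc (Suc (Suc (d + 3 * k i))))"
    "L - 2 * n + 3 * k i + 1 = Suc (d + 3 * k i)" by (simp_all add: L)
  show "F3 a (L + 2) (k(i := Suc (k i))) i = F3 (a * q) L k i *
    (th (a * q ^ (L + 2) / q ^ tsum r k * X k i) * th (a * q ^ (L + 3) / q ^ tsum r k * X k i)
      * th (a * q ^ (L + 4) / q ^ tsum r k * X k i))"
    unfolding F3_def tsum_update[OF i] n_def[symmetric] d \<open>\<And>j. a * x j * q ^ Suc n = a * q * x j * q ^ n\<close>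
      s_def[symmetric] ell_fact_Suc[of _ _ _ "Suc (Suc (Suc (d + 3 * k i)))"]
      ell_fact_Suc[of _ _ _ "Suc (Suc (d + 3 * k i))"] ell_fact_Suc[of _ _ _ "Suc (d + 3 * k i)"] e
    by (simp only: mult.assoc)
qed

section \<open>Transition weights and genericity\<close>

definition Af0 :: "complex \<Rightarrow> nat \<Rightarrow> (nat \<Rightarrow> nat) \<Rightarrow> complex" where
  "Af0 a L k = q ^ (3 * tsum r k) * (th (q ^ (L + 1) / q ^ (2 * tsum r k)) * th (q ^ (L + 2) / q ^ (2 * tsum r k)))
    / (th (q ^ (L + tsum r k + 1)) * th (q ^ (L + tsum r k + 2)))
    * (\<Prod>i=1..r. th (a * X k i * q ^ (2 * L + 3)) * th (a * x i * q ^ tsum r k)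
        / (th (a * X k i * q ^ tsum r k) * th (a * x i * q ^ (2 * L + 3))))"

text \<open>\<open>Af0\<close> and \<open>Af\<close> are the weights with which the term of index k
  in the longer sum is produced by the same index and by the index with k_i lowered.
  \<open>Af\<close> is written in the new index, so that for a fixed target the contributions form a
  sum over i.\<close>

definition Af :: "complex \<Rightarrow> nat \<Rightarrow> (nat \<Rightarrow> nat) \<Rightarrow> nat \<Rightarrow> complex" where
  "Af a L k i = th (q ^ (2 * L + 3) / q ^ tsum r k) / (th (q ^ (L + tsum r k + 1)) * th (q ^ (L + tsum r k + 2)))
    * (th (a * X k i * q ^ (L + 1) / q ^ tsum r k) * th (a * X k i * q ^ (L + 2) / q ^ tsum r k)
       / (th (a * X k i * q ^ tsum r k) * th (a * x i * q ^ (2 * L + 3))))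
    * (\<Prod>j\<in>{1..r} - {i}. th (a * X k j * q ^ (2 * L + 3)) / th (a * x j * q ^ (2 * L + 3)))
    * ((\<Prod>j=1..r. th (X k i / x j)) / (\<Prod>j\<in>{1..r} - {i}. th (X k i / X k j)))"

text \<open>Vanishing of these theta values is excluded only for the induction. The last condition does not
  involve \<open>a\<close>, and its bound \<open>M\<close> stays fixed while \<open>N\<close> decreases.\<close>

definition generic :: "complex \<Rightarrow> nat \<Rightarrow> nat \<Rightarrow> bool" where
  "generic a N M \<longleftrightarrow> a \<noteq> 0 \<and>
    (\<forall>i\<in>{1..r}. \<forall>m l. th (a * x i * q ^ m / q ^ l) \<noteq> 0) \<and>
    (\<forall>i\<in>{1..r}. \<forall>j\<in>{1..r}. i \<noteq> j \<longrightarrow> (\<forall>m. th (a\<^sup>2 * q ^ (N + 1) * x i * x j * q ^ m) \<noteq> 0)) \<and>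
    (\<forall>i\<in>{1..r}. \<forall>j\<in>{1..r}. i \<noteq> j \<longrightarrow>
      (\<forall>s t. 2 * (s + t) \<le> M \<longrightarrow> th (x i * q ^ (3 * s) / (x j * q ^ (3 * t))) \<noteq> 0))"

lemma generic_a0: "generic a N M \<Longrightarrow> a \<noteq> 0"
  by (simp add: generic_def)

lemma generic_ax: "generic a N M \<Longrightarrow> i \<in> {1..r} \<Longrightarrow> th (a * x i * q ^ m) \<noteq> 0"
  unfolding generic_def by (metis div_by_1 power_0)

lemma generic_aX: "generic a N M \<Longrightarrow> i \<in> {1..r} \<Longrightarrow> th (a * X k i * q ^ m / q ^ l) \<noteq> 0"
proof -
  assume "generic a N M" "i \<in> {1..r}"
  then have "th (a * x i * q ^ (3 * k i + m) / q ^ l) \<noteq> 0" unfolding generic_def by blast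
  then show ?thesis by (simp add: X_def power_add mult_ac)
qed

lemma generic_aX': "generic a N M \<Longrightarrow> i \<in> {1..r} \<Longrightarrow> th (a * X k i * q ^ m) \<noteq> 0"
  using generic_aX[of a N M i k m 0] by simp

lemma generic_cXX:
  assumes "generic a N M" "i \<in> {1..r}" "j \<in> {1..r}" "i \<noteq> j"
  shows "th (a\<^sup>2 * q ^ (N + 1) * X k i * X k j) \<noteq> 0"
proof -
  have "th (a\<^sup>2 * q ^ (N + 1) * x i * x j * q ^ (3 * k i + 3 * k j)) \<noteq> 0"
    using assms unfolding generic_def by blast
  then show ?thesis by (simp add: X_def power_add mult_ac)
qed

lemma generic_XX:
  assumes "generic a N M" "i \<in> {1..r}" "j \<in> {1..r}" "i \<noteq> j" "2 * tsum r k \<le> M"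
  shows "th (X k i / X k j) \<noteq> 0"
proof -
  have "k i + k j = (\<Sum>l\<in>{i, j}. k l)" using assms by simp
  also have "\<dots> \<le> tsum r k" unfolding tsum_def using assms by (intro sum_mono2) auto
  finally have "2 * (k i + k j) \<le> M" using assms by simp
  then show ?thesis using assms unfolding generic_def X_def by blast
qed

lemma generic_Xx:
  assumes "generic a N M" "i \<in> {1..r}" "j \<in> {1..r}" "2 * tsum r k \<le> M" "k i > 0"
  shows "th (X k i / x j) \<noteq> 0"
proof (cases "i = j")
  case True
  then show ?thesis using q_pow[of "3 * k i"] x0[OF assms(2)] assms by (simp add: X_def)
next
  case False
  have "2 * (k i + 0) \<le> M" using tsum_ge[OF assms(2), of k] assms by simp
  then have "th (x i * q ^ (3 * k i) / (x j * q ^ (3 * 0))) \<noteq> 0"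
    using assms False unfolding generic_def by blast
  then show ?thesis by (simp add: X_def)
qed

text \<open>The replacement of a by a q shifts an exponent within a family that is already
  quantified over all exponents, and c is invariant.\<close>

lemma generic_step:
  assumes "generic a (L + 2) M"
  shows "generic (a * q) L M"
proof -
  have 1: "a * q * x i * q ^ m / q ^ l = a * x i * q ^ Suc m / q ^ l" for i m l by simp
  have 2: "(a * q)\<^sup>2 * q ^ (L + 1) = a\<^sup>2 * q ^ (L + 2 + 1)" by (simp add: power2_eq_square)
  have "a * q \<noteq> 0" using assms q0 by (simp add: generic_def)
  moreover have "\<forall>i\<in>{1..r}. \<forall>m l. th (a * q * x i * q ^ m / q ^ l) \<noteq> 0"
  proof (intro ballI allI)
    fix i m l assume "i \<in> {1..r}"
    then have "th (a * x i * q ^ Suc m / q ^ l) \<noteq> 0" using assms unfolding generic_def by blast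
    then show "th (a * q * x i * q ^ m / q ^ l) \<noteq> 0" unfolding 1 .
  qed
  moreover have "\<forall>i\<in>{1..r}. \<forall>j\<in>{1..r}. i \<noteq> j \<longrightarrow>
      (\<forall>m. th ((a * q)\<^sup>2 * q ^ (L + 1) * x i * x j * q ^ m) \<noteq> 0)"
    using assms unfolding generic_def 2 by (elim conjE)
  ultimately show ?thesis using assms unfolding generic_def by (intro conjI; elim conjE)
qed

lemma Df_stay:
  assumes gen: "generic a (L + 2) M" and k: "2 * tsum r k \<le> L"
  shows "Df (a * q) L k * Lf0 (a\<^sup>2 * q ^ (L + 3)) (a * q ^ 2 / q ^ (L + 2)) (a * q ^ (tsum r k + 1)) k
    = Af0 a L k * Df a (L + 2) k"
proof -
  define n where "n = tsum r k"
  define v where "v = a * q ^ 2 / q ^ (L + 2)"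
  define w where "w = a * q ^ (n + 1)"
  define c where "c = a\<^sup>2 * q ^ (L + 3)"
  have a: "a \<noteq> 0" using gen by (rule generic_a0)
  have "2 * L + 3 + 2 = (L + 3) + (L + 2)" by simp
  then have "q ^ (2 * L + 3) * q ^ 2 = q ^ (L + 3) * q ^ (L + 2)"
    by (simp only: power_add[symmetric])
  then have cv: "c / v = a * q ^ (2 * L + 3)"
    unfolding c_def v_def power2_eq_square[of a] using a q0 by (simp add: divide_simps)
  have "L + 3 = L + 2 + 1" by simp
  then have "q ^ (L + 3) = q ^ (L + 2) * q" by (simp only: power_add power_one_right)
  then have "c = w * (a * q ^ (L + 2) / q ^ n)"
    unfolding c_def w_def power2_eq_square[of a] power_add[of q n] using q0 by (simp only:) simp
  then have cw: "c / w = a * q ^ (L + 2) / q ^ n"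
    using a q0 by (simp add: w_def)
  have c: "a\<^sup>2 * q ^ (L + 2 + 1) = c" "(a * q)\<^sup>2 * q ^ (L + 1) = c"
    by (simp_all add: c_def power_mult_distrib power_add power2_eq_square power3_eq_cube)
  have ratio: "th (a * q * X k i * q ^ n) * F2 (a * q) L k i / F3 (a * q) L k i
      * (th (v * X k i) * th (c / v * X k i) / (th (w * X k i) * th (c / w * X k i))) =
    th (a * X k i * q ^ (2 * L + 3)) * th (a * x i * q ^ n)
        / (th (a * X k i * q ^ n) * th (a * x i * q ^ (2 * L + 3)))
      * (th (a * X k i * q ^ n) * F2 a (L + 2) k i / F3 a (L + 2) k i)" if i: "i \<in> {1..r}" for i
  proof -
    have ki: "k i \<le> L" using tsum_ge[OF i, of k] k by simp
    have e: "a * q * X k i * q ^ n = w * X k i" "c / v * X k i = a * X k i * q ^ (2 * L + 3)"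
      unfolding cv by (simp_all add: w_def)
    have wX: "a * X k i * q ^ (n + 1) = w * X k i" by (simp add: w_def)
    note nz = generic_aX'[OF gen i, of k "n + 1", unfolded wX] generic_aX'[OF gen i, of k n]
      generic_ax[OF gen i, of n] generic_ax[OF gen i, of "2 * L + 3"]
    have alg: "W * F / G * (V * Q / (W * C)) = Q * A / (B * D) * (B * (V * F * D) / (A * G * C))"
      if "W \<noteq> 0" "B \<noteq> 0" "A \<noteq> 0" "D \<noteq> 0" for A B C D F G Q V W :: complex
      using that by simp
    show ?thesis
      unfolding F2_stay[of k i L, OF ki] F3_stay[OF k] n_def[symmetric] v_def[symmetric] e cw
      by (rule alg[OF nz])
  qed
  have F: "F1 L n = th (q ^ (L + 1) / q ^ (2 * n)) * th (q ^ (L + 2) / q ^ (2 * n))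
      / (th (q ^ (L + n + 1)) * th (q ^ (L + n + 2))) * F1 (L + 2) n"
  proof -
    have "th (q ^ (L + n + 1)) * th (q ^ (L + n + 2)) \<noteq> 0"
      by (intro no_zero_divisors q_pow) simp_all
    from nonzero_eq_divide_eq[OF this, THEN iffD2, OF F1_stay]
    show ?thesis by (simp only: times_divide_eq_left)
  qed
  have prods: "(\<Prod>i=1..r. th (a * q * X k i * q ^ n) * F2 (a * q) L k i / F3 (a * q) L k i) * Lf0 c v w k =
    (\<Prod>i=1..r. th (a * X k i * q ^ (2 * L + 3)) * th (a * x i * q ^ n)
        / (th (a * X k i * q ^ n) * th (a * x i * q ^ (2 * L + 3)))) *
    (\<Prod>i=1..r. th (a * X k i * q ^ n) * F2 a (L + 2) k i / F3 a (L + 2) k i)"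
    unfolding Lf0_def prod.distrib[symmetric] by (rule prod.cong[OF refl ratio])
  have "Df (a * q) L k * Lf0 c v w k = Pw (a * q) L k * F1 L n * Ef c k *
     ((\<Prod>i=1..r. th (a * q * X k i * q ^ n) * F2 (a * q) L k i / F3 (a * q) L k i) * Lf0 c v w k)"
    unfolding Df_def n_def[symmetric] c by (simp only: mult.assoc)
  also have "\<dots> = Af0 a L k * Df a (L + 2) k"
  proof -
    have alg: "Q * P * (T / D * G) * E * (R * S) = Q * T / D * R * (P * G * E * S)"
      for D E G P Q R S T :: complex
      by simp
    show ?thesis
      unfolding prods unfolding Pw_stay F n_def[symmetric] Df_def Af0_def c by (rule alg)
  qed
  finally show ?thesis unfolding c_def v_def w_def n_def .
qed

text \<open>The thetas cancel index by index: the factors gained by \<open>Ef_move\<close> meet the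
  denominators of \<open>Lf\<close>, and \<open>F1\<close>, \<open>F2\<close>, \<open>F3\<close>
  supply the rest. The remaining monomials and signs are dealt with separately in
  \<open>scal\<close>.\<close>

lemma Df_move:
  fixes k :: "nat \<Rightarrow> nat"
  assumes gen: "generic a (L + 2) M" and LM: "L + 2 \<le> M" and k: "2 * tsum r k \<le> L" and i: "i \<in> {1..r}"
  defines "K \<equiv> k(i := Suc (k i))"
  shows "Df (a * q) L k * Lf (a\<^sup>2 * q ^ (L + 3)) (a * q ^ 2 / q ^ (L + 2)) (a * q ^ (tsum r k + 1)) k i
    = Af a L K i * Df a (L + 2) K"
proof -
  define n where "n = tsum r k"
  define v where "v = a * q ^ 2 / q ^ (L + 2)"
  define w where "w = a * q ^ (n + 1)"
  define c where "c = a\<^sup>2 * q ^ (L + 3)"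
  define Q where "Q = q ^ (2 * L + 3)"
  define S where "S = {1..r} - {i}"
  have tK: "tsum r K = Suc n" unfolding K_def n_def by (rule tsum_update[OF i])
  have a: "a \<noteq> 0" using gen by (rule generic_a0)
  have "2 * L + 3 + 2 = (L + 3) + (L + 2)" by simp
  then have "q ^ (2 * L + 3) * q ^ 2 = q ^ (L + 3) * q ^ (L + 2)"
    by (simp only: power_add[symmetric])
  then have cv: "c / v = a * Q"
    unfolding c_def v_def Q_def power2_eq_square[of a] using a q0 by (simp add: divide_simps)
  have "L + 3 = L + 2 + 1" by simp
  then have "q ^ (L + 3) = q ^ (L + 2) * q" by (simp only: power_add power_one_right)
  then have "c = w * (a * q ^ (L + 2) / q ^ n)"
    unfolding c_def w_def power2_eq_square[of a] power_add[of q n] using q0 by (simp only:) simp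
  then have cw: "c / w = a * q ^ (L + 2) / q ^ n"
    using a q0 by (simp add: w_def)
  have cc: "a\<^sup>2 * q ^ (L + 2 + 1) = c" "(a * q)\<^sup>2 * q ^ (L + 1) = c"
    by (simp_all add: c_def power_mult_distrib power_add power2_eq_square power3_eq_cube)
  have kl: "k j \<le> L" if "j \<in> {1..r}" for j using tsum_ge[OF that, of k] k by simp
  have XK: "X K j = (if j = i then q ^ 3 * X k i else X k j)" for j
    unfolding K_def by (rule X_update)
  have kM: "2 * tsum r k \<le> M" "2 * tsum r K \<le> M" using k LM tK by (simp_all add: n_def)
  have Si: "j \<in> S \<Longrightarrow> j \<in> {1..r} \<and> j \<noteq> i" for j by (simp add: S_def)
  have neXX: "th (X k i / X k j) \<noteq> 0" if "j \<in> S" for j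
    using generic_XX[OF gen i _ _ kM(1)] Si[OF that] by simp
  have neXK: "th (X K i / X k j) \<noteq> 0" if "j \<in> S" for j
    using generic_XX[OF gen i _ _ kM(2), of j] Si[OF that] XK[of j] by simp
  have nec: "th (c * X k i * X k j) \<noteq> 0" if "j \<in> S" for j
    using generic_cXX[OF gen i, of j k] Si[OF that] unfolding cc by simp
  have K0: "K i > 0" by (simp add: K_def)
  define s1 where "s1 = - (q ^ (L + 3 * n + 3) * (\<Prod>j=1..r. x j)) / (a * (q ^ 3 * X k i))"
  define \<sigma> where "\<sigma> = (\<Prod>j\<in>S. - (X k i / X k j))"
  define t1 where "t1 = th (q ^ (L + n + 1))"
  define t2 where "t2 = th (q ^ (L + n + 2))"
  define t3 where "t3 = th (q ^ (L + n + 3))"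
  have t: "t1 \<noteq> 0" "t2 \<noteq> 0" "t3 \<noteq> 0" unfolding t1_def t2_def t3_def by (rule q_pow; simp)+
  define \<tau> where "\<tau> = th (Q / q ^ Suc n)"
  define C2 where "C2 = th (a * q ^ (L + 2) / q ^ n * X k i)"
  define C3 where "C3 = th (a * q ^ (L + 3) / q ^ n * X k i)"
  define C4 where "C4 = th (a * q ^ (L + 4) / q ^ n * X k i)"
  define Y where "Y = th (a * X K i * q ^ Suc n)"
  define W where "W = th (w * X k i)"
  define E where "E = th (a * x i * Q)"
  have C: "C3 \<noteq> 0" "C4 \<noteq> 0"
    unfolding C3_def C4_def using generic_aX[OF gen i, of k "L + 3" n] generic_aX[OF gen i, of k "L + 4" n]
    by (simp_all only: times_divide_eq_left times_divide_eq_right mult.assoc mult.commute[of "X k i"] not_False_eq_True)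
  have wX: "a * X k i * q ^ (n + 1) = w * X k i" by (simp add: w_def)
  have nz: "W \<noteq> 0" "Y \<noteq> 0" "E \<noteq> 0"
    unfolding W_def Y_def E_def Q_def
    using generic_aX'[OF gen i, of k "n + 1", unfolded wX] generic_aX'[OF gen i] generic_ax[OF gen i] by blast+
  define G where "G j = th (a * q * X k j * q ^ n) * F2 (a * q) L k j / F3 (a * q) L k j" for j
  define GK where "GK j = th (a * X K j * q ^ Suc n) * F2 a (L + 2) K j / F3 a (L + 2) K j" for j
  have Gi: "G i = W * F2 (a * q) L k i / F3 (a * q) L k i"
    by (simp add: G_def W_def w_def mult_ac)
  have "F2 a (L + 2) K i = F2 (a * q) L k i * E"
    unfolding K_def E_def Q_def by (rule F2_move[of k i L, OF kl[OF i]])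
  moreover have "F3 a (L + 2) K i = F3 (a * q) L k i * (C2 * C3 * C4)"
    unfolding K_def C2_def C3_def C4_def n_def by (rule F3_move(1)[OF k i])
  ultimately have GKi: "GK i = Y * (F2 (a * q) L k i * E) / (F3 (a * q) L k i * (C2 * C3 * C4))"
    by (simp only: GK_def Y_def)
  define P1 where "P1 = (\<Prod>j\<in>S. th (X k i / X k j) * th (c * X k i * X k j) / th (X K i / X k j))"
  define P2 where "P2 = (\<Prod>j=1..r. th (X K i / x j))"
  define P3 where "P3 = (\<Prod>l\<in>S. th (v * X k l) * th (c / v * X k l) / (th (X k l / X k i) * th (c * X k i * X k l)))"
  define P4 where "P4 = (\<Prod>j\<in>S. th (a * X K j * Q) / th (a * x j * Q))"
  define P5 where "P5 = (\<Prod>j\<in>S. th (X K i / X K j))"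
  \<comment> \<open>For j other than i, theta(c X_i X_j) cancels, and theta(X_i/X_j) cancels its
    swapped counterpart theta(X_j/X_i) up to the monomial -X_i/X_j, which is collected in
    \<open>\<sigma>\<close>.\<close>
  have point: "th (X k i / X k j) * th (c * X k i * X k j) / th (X K i / X k j) * G j *
      (th (v * X k j) * th (c / v * X k j) / (th (X k j / X k i) * th (c * X k i * X k j)))
      = - (X k i / X k j) * (th (a * X K j * Q) / th (a * x j * Q)) * GK j / th (X K i / X K j)" if j: "j \<in> S" for j
  proof -
    have jr: "j \<in> {1..r}" "j \<noteq> i" using Si[OF j] by auto
    have e: "X K j = X k j" using XK jr by simp
    have f2: "F2 a (L + 2) K j = th (v * X k j) * F2 (a * q) L k j * th (a * x j * Q)"
    proof -
      have "F2 a (L + 2) K j = F2 a (L + 2) k j" unfolding F2_def e using jr by (simp add: K_def)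
      then show ?thesis unfolding v_def Q_def using F2_stay[of k j L a, OF kl[OF jr(1)]] by simp
    qed
    have f3: "F3 a (L + 2) K j = F3 (a * q) L k j"
      unfolding K_def by (rule F3_move(2)[OF k i jr(2)])
    have sw: "th (X k j / X k i) = - (X k j / X k i) * th (X k i / X k j)"
      by (rule theta_swap[OF p X0[OF i] X0[OF jr(1)]])
    have u: "a * q * X k j * q ^ n = a * X k j * q ^ Suc n" "c / v * X k j = a * X k j * Q"
      unfolding cv by simp_all
    have alg: "A * B / Z * (H * F / F') * (V * R / (- (y / x) * A * B)) = - (x / y) * (R / D) * (H * (V * F * D) / F') / Z"
      if "A \<noteq> 0" "B \<noteq> 0" "D \<noteq> 0" "x \<noteq> 0" "y \<noteq> 0" for A B D F F' H R V Z x y :: complex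
      using that by (simp add: mult_ac)
    have D: "th (a * x j * Q) \<noteq> 0" unfolding Q_def by (rule generic_ax[OF gen jr(1)])
    show ?thesis
      unfolding G_def GK_def f2 f3 sw e u
      by (rule alg[OF neXX[OF j] nec[OF j] D X0[OF i] X0[OF jr(1)]])
  qed
  have prods: "P1 * (\<Prod>j\<in>S. G j) * P3 = \<sigma> * P4 * (\<Prod>j\<in>S. GK j) / P5"
    unfolding P1_def P3_def P4_def P5_def \<sigma>_def prod.distrib[symmetric] prod_dividef[symmetric]
    by (rule prod.cong[OF refl point])
  \<comment> \<open>The monomials come from \<open>Pw_move\<close>, from the power in
    \<open>Lf\<close>, from the swaps in \<open>\<sigma>\<close> and from the inversions of
    theta(v/w) and theta(1/(w X_i)). They cancel because the product of all X_j is q^(3|k|) times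
    that of the x_j, which is what the denominator of \<open>Pw\<close> is made for.\<close>
  have scal: "s1 * (- 1 / X k i) ^ r * \<sigma> * (w * X k i / q ^ (L + n + 1)) = 1"
  proof -
    define xp where "xp = (\<Prod>j=1..r. x j)"
    have xp: "xp \<noteq> 0" using x0 by (simp add: xp_def)
    have r: "r = Suc (card S)" using i by (simp add: S_def)
    have "(- 1 / X k i) ^ card S * \<sigma> = (\<Prod>j\<in>S. (- 1 / X k i) * - (X k i / X k j))"
      unfolding \<sigma>_def prod.distrib by (simp only: prod_constant)
    also have "\<dots> = (\<Prod>j\<in>S. 1 / X k j)" using X0[OF i] by (intro prod.cong) simp_all
    finally have "(- 1 / X k i) ^ r * \<sigma> = - 1 / X k i * (\<Prod>j\<in>S. 1 / X k j)"
      by (subst r) simp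
    also have "\<dots> = - 1 / (X k i * (\<Prod>j\<in>S. X k j))" by (simp add: prod_dividef)
    also have "X k i * (\<Prod>j\<in>S. X k j) = (\<Prod>j=1..r. X k j)"
      unfolding S_def using i by (simp add: prod.remove)
    also have "\<dots> = q ^ (3 * n) * xp" unfolding prod_X n_def xp_def ..
    finally have \<sigma>: "(- 1 / X k i) ^ r * \<sigma> = - 1 / (q ^ (3 * n) * xp)" .
    have "q ^ (L + 3 * n + 3) * q ^ (n + 1) = q ^ (L + n + 1) * (q ^ (3 * n) * q ^ 3)"
      unfolding power_add[symmetric] by (rule arg_cong[where f = "power q"]) simp
    moreover have "s1 * (- 1 / X k i) ^ r * \<sigma> * (w * X k i / q ^ (L + n + 1)) =
       s1 * ((- 1 / X k i) ^ r * \<sigma>) * (w * X k i / q ^ (L + n + 1))" by (simp only: mult.assoc)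
    then have "s1 * (- 1 / X k i) ^ r * \<sigma> * (w * X k i / q ^ (L + n + 1)) =
       (q ^ (L + 3 * n + 3) * q ^ (n + 1)) / (q ^ (L + n + 1) * (q ^ (3 * n) * q ^ 3))"
      unfolding \<sigma> s1_def w_def xp_def[symmetric] using a X0[OF i, of k] xp q0 by simp
    ultimately show ?thesis using q0 by simp
  qed
  have F1e: "F1 L n = F1 (L + 2) (Suc n) / (t1 * t2 * t3)"
    using t unfolding t1_def t2_def t3_def F1_move by simp
  have Pe: "Pw (a * q) L k = Pw a (L + 2) K * s1"
    unfolding K_def s1_def n_def by (rule Pw_move[OF i a])
  have Ee: "Ef c k = Ef c K * P1 * P2"
    unfolding P1_def P2_def K_def S_def
  proof (rule Ef_move[OF i], fold K_def S_def)
    show "th (X K i / x j) \<noteq> 0" if "j \<in> {1..r}" for j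
      by (rule generic_Xx[OF gen i that kM(2) K0])
  qed (use neXX neXK nec in auto)
  have prodS: "(\<Prod>j=1..r. g j) = g i * (\<Prod>j\<in>S. g j)" for g :: "nat \<Rightarrow> complex"
    unfolding S_def using i by (simp add: prod.remove)
  have De: "Df (a * q) L k = Pw (a * q) L k * F1 L n * Ef c k * (G i * (\<Prod>j\<in>S. G j))"
    unfolding Df_def cc n_def[symmetric] prodS G_def ..
  have DK: "Df a (L + 2) K = Pw a (L + 2) K * F1 (L + 2) (Suc n) * Ef c K * (GK i * (\<Prod>j\<in>S. GK j))"
    unfolding Df_def cc tK prodS GK_def ..
  have Le: "Lf c v w k i = (- 1 / X k i) ^ r * (- t1 / q ^ (L + n + 1) * \<tau> / (- W / (w * X k i) * C2)) * P3"
  proof -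
    have "v / w = 1 / q ^ (L + n + 1)"
      using a q0 by (simp add: v_def w_def power_add power2_eq_square)
    then have 1: "th (v / w) = - t1 / q ^ (L + n + 1)"
      unfolding t1_def using theta_inverse[OF p, of "q ^ (L + n + 1)"] q0 by simp
    have "c / (v * w) = c / v / w" by simp
    also have "\<dots> = Q / q ^ Suc n" unfolding cv using a by (simp add: w_def)
    finally have 2: "th (c / (v * w)) = \<tau>" by (simp add: \<tau>_def)
    have 3: "th (1 / (w * X k i)) = - W / (w * X k i)"
      unfolding W_def by (rule theta_inverse[OF p]) (use X0[OF i] a q0 in \<open>simp add: w_def\<close>)
    have 4: "th (c / w * X k i) = C2" unfolding cw C2_def ..
    show ?thesis unfolding Lf_def 1 2 3 4 P3_def S_def ..
  qed
  have Ae: "Af a L K i = \<tau> / (t2 * t3) * (C3 * C4 / (Y * E)) * P4 * (P2 / P5)"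
  proof -
    have 1: "th (q ^ (L + Suc n + 1)) = t2" "th (q ^ (L + Suc n + 2)) = t3"
      unfolding t2_def t3_def by (rule arg_cong[where f = th], rule arg_cong[where f = "power q"], simp)+
    have 2: "th (a * X K i * q ^ (L + 1) / q ^ Suc n) = C3"
      unfolding C3_def XK by (rule arg_cong[where f = th]) (use q0 in \<open>simp add: power_add eval_nat_numeral\<close>)
    have 3: "th (a * X K i * q ^ (L + 2) / q ^ Suc n) = C4"
      unfolding C4_def XK by (rule arg_cong[where f = th]) (use q0 in \<open>simp add: power_add eval_nat_numeral\<close>)
    show ?thesis unfolding Af_def tK 1 2 3 S_def[symmetric] Q_def[symmetric] \<tau>_def P4_def P2_def P5_def Y_def E_def ..
  qed
  have w0: "w * X k i \<noteq> 0" "q ^ (L + n + 1) \<noteq> 0" using X0[OF i] a q0 by (simp_all add: w_def)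
  have alg: "(PK * s) * (FK / (t1 * t2 * t3)) * (EK * P1 * P2) * ((W * F / F') * GS)
      * (\<rho> * (- t1 / \<kappa> * \<tau> / (- W / \<omega> * C2)) * P3) =
      \<tau> / (t2 * t3) * (C3 * C4 / (Y * E)) * P4 * (P2 / P5)
      * (PK * FK * EK * (Y * (F * E) / (F' * (C2 * C3 * C4)) * GKS))"
    if "t1 \<noteq> 0" "W \<noteq> 0" "Y \<noteq> 0" "E \<noteq> 0" "C3 \<noteq> 0" "C4 \<noteq> 0" "\<omega> \<noteq> 0" "\<kappa> \<noteq> 0"
      and pr: "P1 * GS * P3 = sg * P4 * GKS / P5" and sc: "s * \<rho> * sg * (\<omega> / \<kappa>) = 1"
    for PK s FK t1 t2 t3 EK P1 P2 P3 P4 P5 W F F' GS GKS \<rho> \<kappa> \<tau> \<omega> C2 C3 C4 Y E sg :: complex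
  proof -
    have "(PK * s) * (FK / (t1 * t2 * t3)) * (EK * P1 * P2) * ((W * F / F') * GS)
      * (\<rho> * (- t1 / \<kappa> * \<tau> / (- W / \<omega> * C2)) * P3) =
      PK * FK * EK * P2 * (F / F') * (\<tau> / (t2 * t3 * C2)) * (s * \<rho> * (\<omega> / \<kappa>)) * (P1 * GS * P3)"
      using that(1-8) by (simp add: mult_ac)
    also have "\<dots> = PK * FK * EK * P2 * (F / F') * (\<tau> / (t2 * t3 * C2)) * (s * \<rho> * sg * (\<omega> / \<kappa>)) * (P4 * GKS / P5)"
      unfolding pr by (simp add: mult_ac)
    also have "\<dots> = \<tau> / (t2 * t3) * (C3 * C4 / (Y * E)) * P4 * (P2 / P5)
      * (PK * FK * EK * (Y * (F * E) / (F' * (C2 * C3 * C4)) * GKS))"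
      unfolding sc using that(1-8) by (simp add: mult_ac)
    finally show ?thesis .
  qed
  have "Df (a * q) L k * Lf c v w k i = Af a L K i * Df a (L + 2) K"
    unfolding De DK Le Ae Pe F1e Ee Gi GKi
    by (rule alg[OF t(1) nz C w0 prods scal])
  then show ?thesis unfolding c_def v_def w_def n_def .
qed

section \<open>The recurrence of the coefficients\<close>

lemma theta_nonzero_swap: "u \<noteq> 0 \<Longrightarrow> v \<noteq> 0 \<Longrightarrow> th (u / v) \<noteq> 0 \<Longrightarrow> th (v / u) \<noteq> 0"
  using theta_swap[OF p, of u v] by simp

text \<open>The coefficient recurrence is the partial fraction identity with poles \<open>X\<^sub>i\<close>,
  \<open>1 / (a q^n)\<close>, \<open>1 / (a q^(2 N - 1))\<close> and zeros \<open>x\<^sub>j\<close>, \<open>q^(n + 1 - N) / a\<close>, \<open>q^(n - N) / a\<close>,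
  where \<open>N = L + 2\<close> and \<open>n = \<bar>k\<bar>\<close>.\<close>

lemma sum_Af:
  assumes gen: "generic a (L + 2) M" and LM: "L + 2 \<le> M" and k: "2 * tsum r k \<le> L + 2"
  shows "Af0 a L k + (\<Sum>i=1..r. Af a L k i) = 1"
proof -
  define m where "m = tsum r k"
  define Q where "Q = q ^ (2 * L + 3)"
  have a: "a \<noteq> 0" using gen by (rule generic_a0)
  have Q0: "Q \<noteq> 0" using q0 by (simp add: Q_def)
  define qm where "qm = q ^ m"
  have qm0: "qm \<noteq> 0" using q0 by (simp add: qm_def)
  have xr: "x j \<noteq> 0" "X k j \<noteq> 0" "th (a * x j * qm) \<noteq> 0" "th (a * x j * Q) \<noteq> 0"
    "th (a * X k j * qm) \<noteq> 0" "th (a * X k j * Q) \<noteq> 0" if "j \<in> {1..r}" for j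
    unfolding qm_def Q_def
    using x0[OF that] X0[OF that] generic_ax[OF gen that] generic_aX'[OF gen that] by blast+
  define S where "S = {1..r}"
  \<comment> \<open>The indices 0 and \<open>Suc r\<close> lie outside {1..r} and carry the two
    additional poles; in \<open>YY\<close> they carry the two additional zeros.\<close>
  define XX where "XX i = (if i = 0 then 1 / (a * qm) else if i = Suc r then 1 / (a * Q) else X k i)" for i
  define YY where "YY j = (if j = 0 then qm / (a * q ^ (L + 1)) else if j = Suc r then qm / (a * q ^ (L + 2)) else x j)" for j
  have XX0: "XX 0 = 1 / (a * qm)" and XXr: "XX (Suc r) = 1 / (a * Q)" and XXS: "\<And>i. i \<in> S \<Longrightarrow> XX i = X k i"
    by (auto simp: XX_def S_def)
  have YY0: "YY 0 = qm / (a * q ^ (L + 1))" and YYr: "YY (Suc r) = qm / (a * q ^ (L + 2))"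
    and YYS: "\<And>i. i \<in> S \<Longrightarrow> YY i = x i"
    by (auto simp: YY_def S_def)
  have fS: "finite S" "0 \<notin> S" "Suc r \<notin> S" "0 \<noteq> Suc r" by (auto simp: S_def)
  define I where "I = insert 0 (insert (Suc r) S)"
  have prodI: "(\<Prod>j\<in>I. g j) = g 0 * (g (Suc r) * (\<Prod>j\<in>S. g j))" for g :: "nat \<Rightarrow> complex"
    unfolding I_def using fS by simp
  have sumI: "(\<Sum>j\<in>I. g j) = g 0 + (g (Suc r) + (\<Sum>j\<in>S. g j))" for g :: "nat \<Rightarrow> complex"
    unfolding I_def using fS by simp
  have QL: "Q * q ^ 2 = q ^ (L + 3) * q ^ (L + 2)" "Q = q ^ (L + 1) * q ^ (L + 2)"
    unfolding Q_def power_add[symmetric] by (rule arg_cong[where f = "power q"]; simp)+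
  define \<tau> where "\<tau> = th (Q / qm)"
  \<comment> \<open>This separates the two additional poles: their quotient is q^(2L+3-m), and 2m <=
    L + 2 makes the exponent positive.\<close>
  have \<tau>: "\<tau> \<noteq> 0"
  proof -
    have "m \<le> 2 * L + 3" "2 * L + 3 - m > 0" using k by (simp_all add: m_def)
    then have "Q / qm = q ^ (2 * L + 3 - m)" unfolding Q_def qm_def using q0 by (simp add: power_diff)
    then show ?thesis unfolding \<tau>_def using q_pow[of "2 * L + 3 - m"] \<open>2 * L + 3 - m > 0\<close> by simp
  qed
  define t1 where "t1 = th (q ^ (L + m + 1))"
  define t2 where "t2 = th (q ^ (L + m + 2))"
  have t: "t1 \<noteq> 0" "t2 \<noteq> 0" unfolding t1_def t2_def by (rule q_pow; simp)+
  have zero: "(\<Sum>i\<in>I. (\<Prod>j\<in>I. th (XX i / YY j)) / (\<Prod>l\<in>I - {i}. th (XX i / XX l))) = 0"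
  proof (rule theta_partial_fraction[OF p])
    show "finite I" by (simp add: I_def fS)
    show nzX: "XX i \<noteq> 0" if "i \<in> I" for i
      using that xr a Q0 qm0 by (auto simp: I_def XX0 XXr XXS) (simp add: S_def)
    show "YY i \<noteq> 0" if "i \<in> I" for i
      using that xr a Q0 qm0 q0 by (auto simp: I_def YY0 YYr YYS) (simp add: S_def)
    have i0: "th (XX i / XX 0) \<noteq> 0" "th (XX i / XX (Suc r)) \<noteq> 0" if "i \<in> S" for i
    proof -
      have "XX i / XX 0 = a * X k i * qm" "XX i / XX (Suc r) = a * X k i * Q"
        using that by (simp_all add: XX0 XXr XXS mult_ac)
      then show "th (XX i / XX 0) \<noteq> 0" "th (XX i / XX (Suc r)) \<noteq> 0" using xr[of i] that by (simp_all add: S_def)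
    qed
    have r0: "th (XX 0 / XX (Suc r)) \<noteq> 0"
    proof -
      have "XX 0 / XX (Suc r) = Q / qm" using a by (simp add: XX0 XXr)
      then show ?thesis using \<tau> by (simp add: \<tau>_def)
    qed
    have SS: "th (XX i / XX l) \<noteq> 0" if "i \<in> S" "l \<in> S" "i \<noteq> l" for i l
      using generic_XX[OF gen, of i l k] that k LM by (simp add: XXS) (simp add: S_def)
    show "th (XX i / XX l) \<noteq> 0" if il: "i \<in> I" "l \<in> I" "i \<noteq> l" for i l
    proof -
      have sw: "th (XX i / XX l) \<noteq> 0" if "th (XX l / XX i) \<noteq> 0"
        using theta_nonzero_swap[OF nzX[OF il(2)] nzX[OF il(1)] that] .
      consider "i \<in> S" "l \<in> S" | "i \<in> S" "l = 0" | "i \<in> S" "l = Suc r" | "i = 0" "l = Suc r"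
        | "l \<in> S" "i = 0" | "l \<in> S" "i = Suc r" | "l = 0" "i = Suc r"
        using il by (auto simp: I_def)
      then show ?thesis
        by cases (use SS[of i l] il sw i0[of i] i0[of l] r0 in \<open>simp_all\<close>)
    qed
    have "(\<Prod>i\<in>S. XX i) = (\<Prod>i\<in>S. X k i)" by (rule prod.cong[OF refl XXS])
    also have "\<dots> = q ^ (3 * m) * (\<Prod>i\<in>S. x i)" unfolding S_def prod_X m_def ..
    finally have PX: "(\<Prod>i\<in>S. XX i) = q ^ (3 * m) * (\<Prod>i\<in>S. x i)" .
    have PY: "(\<Prod>i\<in>S. YY i) = (\<Prod>i\<in>S. x i)" by (rule prod.cong[OF refl YYS])
    have "3 * m = m + (m + m)" by simp
    then have m3: "q ^ (3 * m) = qm * (qm * qm)" unfolding qm_def by (simp only: power_add)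
    have alg: "1 / (a * u) * (1 / (a * (v * w)) * (u * (u * u) * z)) = u / (a * v) * (u / (a * w) * z)"
      if "u \<noteq> 0" for u v w z :: complex
      using that by simp
    \<comment> \<open>The X_i exceed the x_i by \<open>qm\<close> cubed. One \<open>qm\<close> is
      absorbed by the pole 0 and two by the numerators of the additional zeros; the denominators
      agree because Q = q^(L+1) q^(L+2).\<close>
    show "(\<Prod>i\<in>I. XX i) = (\<Prod>i\<in>I. YY i)"
      unfolding prodI PX PY XX0 XXr YY0 YYr m3 QL(2) by (rule alg[OF qm0])
  qed (simp_all add: I_def fS)
  define R where "R u = (\<Prod>j\<in>S. th (a * x j * u) / th (a * X k j * u))" for u
  \<comment> \<open>Inverting the thetas in numerator and denominator leaves the ratios X_j/x_j,
    whose product is q^(3m). In \<open>T0\<close> this becomes the power of q in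
    \<open>Af0\<close>.\<close>
  have Rinv: "(\<Prod>j\<in>S. th (1 / (a * u) / x j)) / (\<Prod>j\<in>S. th (1 / (a * u) / X k j)) = q ^ (3 * m) * R u"
    if u: "u \<noteq> 0" for u
  proof -
    have "th (1 / (a * u) / x j) / th (1 / (a * u) / X k j) = X k j * (1 / x j) * (th (a * x j * u) / th (a * X k j * u))"
      if "j \<in> S" for j
    proof -
      have nz: "x j \<noteq> 0" "X k j \<noteq> 0" using that xr by (auto simp: S_def)
      have "th (1 / (a * u) / y) = - th (a * y * u) / (a * y * u)" if "y \<noteq> 0" for y
        using theta_inverse[OF p, of "a * y * u"] a u that by (simp add: mult_ac)
      then show ?thesis using nz a u by simp
    qed
    then have "(\<Prod>j\<in>S. th (1 / (a * u) / x j) / th (1 / (a * u) / X k j)) =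
        (\<Prod>j\<in>S. X k j * (1 / x j) * (th (a * x j * u) / th (a * X k j * u)))" by (rule prod.cong[OF refl])
    also have "\<dots> = (\<Prod>j\<in>S. X k j) * (1 / (\<Prod>j\<in>S. x j)) * R u"
      unfolding prod.distrib R_def by (simp add: prod_dividef)
    also have "(\<Prod>j\<in>S. X k j) = q ^ (3 * m) * (\<Prod>j\<in>S. x j)" unfolding S_def prod_X m_def ..
    also have "(\<Prod>j\<in>S. x j) \<noteq> 0" using xr by (auto simp: S_def)
    then have "q ^ (3 * m) * (\<Prod>j\<in>S. x j) * (1 / (\<Prod>j\<in>S. x j)) * R u = q ^ (3 * m) * R u" by simp
    finally show ?thesis by (simp only: prod_dividef)
  qed
  have SY: "(\<Prod>j\<in>S. th (u / YY j)) = (\<Prod>j\<in>S. th (u / x j))" for u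
    by (rule prod.cong) (simp_all add: YYS)
  have SX: "(\<Prod>l\<in>S - {i}. th (u / XX l)) = (\<Prod>l\<in>S - {i}. th (u / X k l))" for u i
    by (rule prod.cong) (simp_all add: XXS)
  have SX': "(\<Prod>l\<in>S. th (u / XX l)) = (\<Prod>l\<in>S. th (u / X k l))" for u
    by (rule prod.cong) (simp_all add: XXS)
  let ?T = "\<lambda>i. (\<Prod>j\<in>I. th (XX i / YY j)) / (\<Prod>l\<in>I - {i}. th (XX i / XX l))"
  have T0: "?T 0 = q ^ (3 * m) * R qm * (th (q ^ (L + 1) / q ^ (2 * m)) * th (q ^ (L + 2) / q ^ (2 * m))) / \<tau>"
  proof -
    have "q ^ (2 * m) = qm * qm" unfolding qm_def by (simp add: mult_2 power_add)
    then have 1: "XX 0 / YY 0 = q ^ (L + 1) / q ^ (2 * m)" "XX 0 / YY (Suc r) = q ^ (L + 2) / q ^ (2 * m)"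
      "XX 0 / XX (Suc r) = Q / qm"
      using a by (simp_all add: XX0 YY0 YYr XXr mult_ac)
    have e: "I - {0} = insert (Suc r) S" using fS by (auto simp: I_def)
    have 2: "(\<Prod>l\<in>I - {0}. th (XX 0 / XX l)) = \<tau> * (\<Prod>l\<in>S. th (1 / (a * qm) / X k l))"
      unfolding e prod.insert[OF fS(1) fS(3)] 1 SX' \<tau>_def unfolding XX0 ..
    have alg: "A * (B * C) / (D * E) = C / E * (A * B) / D" for A B C D E :: complex by (simp add: mult_ac)
    show ?thesis unfolding prodI 2 1 SY unfolding XX0 alg Rinv[OF qm0] ..
  qed
  have Tr: "?T (Suc r) = - (R Q * (t1 * t2) / \<tau>)"
  proof -
    have "XX (Suc r) / YY 0 = q ^ (L + 1) / (Q * qm)" using a by (simp add: XXr YY0 mult_ac)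
    also have "\<dots> = 1 / q ^ (L + m + 2)"
      unfolding QL(2) qm_def using q0 by (simp add: power_add mult_ac)
    finally have 1: "th (XX (Suc r) / YY 0) = - t2 / q ^ (L + m + 2)"
      unfolding t2_def using theta_inverse[OF p, of "q ^ (L + m + 2)"] q0 by simp
    have "XX (Suc r) / YY (Suc r) = q ^ (L + 2) / (Q * qm)" using a by (simp add: XXr YYr mult_ac)
    also have "\<dots> = 1 / q ^ (L + m + 1)"
      unfolding QL(2) qm_def using q0 by (simp add: power_add mult_ac)
    finally have 2: "th (XX (Suc r) / YY (Suc r)) = - t1 / q ^ (L + m + 1)"
      unfolding t1_def using theta_inverse[OF p, of "q ^ (L + m + 1)"] q0 by simp
    have "XX (Suc r) / XX 0 = qm / Q" using a by (simp add: XX0 XXr)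
    then have 3: "th (XX (Suc r) / XX 0) = - (qm / Q) * \<tau>"
      unfolding \<tau>_def using theta_swap[OF p, of Q qm] Q0 qm0 by simp
    have e: "I - {Suc r} = insert 0 S" using fS by (auto simp: I_def)
    have 4: "(\<Prod>l\<in>I - {Suc r}. th (XX (Suc r) / XX l)) =
        - (qm / Q) * \<tau> * (\<Prod>l\<in>S. th (1 / (a * Q) / X k l))"
      unfolding e prod.insert[OF fS(1) fS(2)] 3 SX' unfolding XXr ..
    have m3: "q ^ (3 * m) * Q = qm * (q ^ (L + m + 1) * q ^ (L + m + 2))"
      unfolding qm_def Q_def power_add[symmetric] by (rule arg_cong[where f = "power q"]) simp
    have alg: "- A / B * (- C / D * E) / (- (u / V) * \<tau> * F) = - (E / F * (V / (u * (D * B))) * (C * A) / \<tau>)"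
      for A B C D E F u V :: complex by (simp add: mult_ac)
    have "?T (Suc r) = - (q ^ (3 * m) * R Q * (Q / (qm * (q ^ (L + m + 1) * q ^ (L + m + 2)))) * (t1 * t2) / \<tau>)"
      unfolding prodI 1 2 4 SY unfolding XXr alg Rinv[OF Q0] ..
    also have "q ^ (3 * m) * R Q * (Q / (qm * (q ^ (L + m + 1) * q ^ (L + m + 2)))) =
        R Q * (q ^ (3 * m) * Q / (qm * (q ^ (L + m + 1) * q ^ (L + m + 2))))" by simp
    also have "q ^ (3 * m) * Q / (qm * (q ^ (L + m + 1) * q ^ (L + m + 2))) = 1"
      unfolding m3 using qm0 q0 by simp
    finally show ?thesis by simp
  qed
  have Ti: "?T i = (th (a * X k i * q ^ (L + 1) / qm) * th (a * X k i * q ^ (L + 2) / qm))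
      / (th (a * X k i * qm) * th (a * X k i * Q))
      * ((\<Prod>j\<in>S. th (X k i / x j)) / (\<Prod>j\<in>S - {i}. th (X k i / X k j)))" if i: "i \<in> S" for i
  proof -
    have 1: "XX i / YY 0 = a * X k i * q ^ (L + 1) / qm" "XX i / YY (Suc r) = a * X k i * q ^ (L + 2) / qm"
      "XX i / XX 0 = a * X k i * qm" "XX i / XX (Suc r) = a * X k i * Q"
      using i by (simp_all add: XX0 XXr XXS YY0 YYr mult_ac)
    have "I - {i} = insert 0 (insert (Suc r) (S - {i}))" using fS i by (auto simp: I_def)
    then have 2: "(\<Prod>l\<in>I - {i}. th (XX i / XX l)) = th (a * X k i * qm) * (th (a * X k i * Q) *
        (\<Prod>j\<in>S - {i}. th (X k i / X k j)))"
      using fS i by (simp add: 1[simplified] SX) (simp add: XXS)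
    have alg: "A * (B * C) / (D * (E * F)) = (A * B) / (D * E) * (C / F)" for A B C D E F :: complex by (simp add: mult_ac)
    show ?thesis unfolding prodI 2 1 SY unfolding XXS[OF i] alg ..
  qed
  define P where "P = (\<Prod>j\<in>S. th (a * X k j * Q) / th (a * x j * Q))"
  \<comment> \<open>With this the term of the pole \<open>Suc r\<close> becomes -1 after
    multiplication by P tau / (t1 t2), so the vanishing sum turns into a sum of weights equal to
    1.\<close>
  have PR: "P * R Q = 1"
    unfolding P_def R_def prod.distrib[symmetric] by (rule prod.neutral) (use xr in \<open>auto simp: S_def\<close>)
  have A0: "Af0 a L k = P * \<tau> / (t1 * t2) * ?T 0"
  proof -
    have "(\<Prod>i=1..r. th (a * X k i * q ^ (2 * L + 3)) * th (a * x i * q ^ tsum r k)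
        / (th (a * X k i * q ^ tsum r k) * th (a * x i * q ^ (2 * L + 3)))) = P * R qm"
      unfolding P_def R_def prod.distrib[symmetric] S_def Q_def qm_def m_def
      by (rule prod.cong) (simp_all add: mult_ac)
    then show ?thesis
      unfolding T0 Af0_def m_def[symmetric] t1_def[symmetric] t2_def[symmetric] using \<tau> by simp
  qed
  have Ai: "Af a L k i = P * \<tau> / (t1 * t2) * ?T i" if i: "i \<in> S" for i
  proof -
    have "P = th (a * X k i * Q) / th (a * x i * Q) * (\<Prod>j\<in>S - {i}. th (a * X k j * Q) / th (a * x j * Q))"
      unfolding P_def using i fS by (simp add: prod.remove)
    moreover have "th (a * X k i * Q) \<noteq> 0" using xr i by (simp add: S_def)
    ultimately show ?thesis
      unfolding Ti[OF i] Af_def m_def[symmetric] t1_def[symmetric] t2_def[symmetric] S_def[symmetric]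
        Q_def[symmetric] qm_def[symmetric] \<tau>_def[symmetric] by (simp add: mult_ac)
  qed
  have "Af0 a L k + (\<Sum>i=1..r. Af a L k i) = P * \<tau> / (t1 * t2) * (?T 0 + (\<Sum>i\<in>S. ?T i))"
    unfolding A0 S_def[symmetric] distrib_left sum_distrib_left by (simp only: sum.cong[OF refl Ai])
  also have "?T 0 + (\<Sum>i\<in>S. ?T i) = - ?T (Suc r)"
  proof -
    have "u + (v + w) = 0 \<Longrightarrow> u + w = - v" for u v w :: complex by (simp add: eq_neg_iff_add_eq_0 add_ac)
    from this[OF zero[unfolded sumI]] show ?thesis .
  qed
  also have "P * \<tau> / (t1 * t2) * - ?T (Suc r) = P * R Q"
    unfolding Tr using \<tau> t by simp
  finally show ?thesis unfolding PR .
qed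

end

subsection \<open>The normalized summation formula\<close>

lemma sum_range_mono: "L \<le> N \<Longrightarrow> sum_range r L \<subseteq> sum_range r N"
  by (auto simp: sum_range_def)

text \<open>Raising k_i maps the shorter range bijectively onto the tuples of the longer range with
  k_i > 0, since 2|k| <= L is the same as 2(|k| + 1) <= L + 2.\<close>

lemma sum_range_shift:
  fixes f :: "(nat \<Rightarrow> nat) \<Rightarrow> 'a :: comm_monoid_add"
  assumes i: "i \<in> {1..r}" and 0: "\<And>k. k \<in> sum_range r (L + 2) \<Longrightarrow> k i = 0 \<Longrightarrow> f k = 0"
  shows "(\<Sum>k\<in>sum_range r L. f (k(i := Suc (k i)))) = (\<Sum>k\<in>sum_range r (L + 2). f k)"
proof -
  let ?u = "\<lambda>k :: nat \<Rightarrow> nat. k(i := Suc (k i))"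
  have "(\<Sum>k\<in>sum_range r L. f (?u k)) = (\<Sum>k\<in>{k \<in> sum_range r (L + 2). k i > 0}. f k)"
  proof (rule sum.reindex_bij_witness[where j = ?u and i = "\<lambda>k. k(i := k i - 1)"])
    fix k assume "k \<in> sum_range r L"
    then show "?u k \<in> {k \<in> sum_range r (L + 2). k i > 0}"
      using i tsum_update[OF i, of k] by (auto simp: sum_range_def PiE_iff extensional_def)
  next
    fix k assume k: "k \<in> {k \<in> sum_range r (L + 2). k i > 0}"
    then have e: "?u (k(i := k i - 1)) = k" by auto
    then have "tsum r k = Suc (tsum r (k(i := k i - 1)))" using tsum_update[OF i, of "k(i := k i - 1)"] by simp
    then show "k(i := k i - 1) \<in> sum_range r L"
      using i k by (auto simp: sum_range_def PiE_iff extensional_def)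
    show "?u (k(i := k i - 1)) = k" by (fact e)
  qed auto
  also have "\<dots> = (\<Sum>k\<in>sum_range r (L + 2). f k)"
    using 0 by (intro sum.mono_neutral_left) (auto simp: finite_sum_range)
  finally show ?thesis .
qed

context theta_setting
begin

lemma Df_Bf_base:
  assumes gen: "generic a N M" and N: "N < 2"
  shows "(\<Sum>k\<in>sum_range r N. Df a N k * Bf a N k) =
    (\<Prod>j=1..r. ell_fact (a * q ^ 2 / q ^ N / b j) (q ^ 3) p N)"
proof -
  define k where "k = (\<lambda>i\<in>{1..r}. 0 :: nat)"
  have ki: "k i = 0" if "i \<in> {1..r}" for i using that by (simp add: k_def)
  have "sum_range r N = {k}"
  proof
    show "{k} \<subseteq> sum_range r N" by (auto simp: sum_range_def k_def tsum_def)
    show "sum_range r N \<subseteq> {k}"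
    proof
      fix l assume l: "l \<in> sum_range r N"
      then have "tsum r l = 0" using N by (simp add: sum_range_def)
      then have "l i = k i" for i
        using l tsum_ge[of i r l] by (cases "i \<in> {1..r}") (auto simp: k_def sum_range_def PiE_iff extensional_def)
      then show "l \<in> {k}" by auto
    qed
  qed
  moreover have n: "tsum r k = 0" using ki by (simp add: tsum_def)
  have Xk: "X k i = x i" if "i \<in> {1..r}" for i using ki[OF that] by (simp add: X_def)
  have "Pw a N k = 1" unfolding Pw_def n using ki by (simp add: numeral_2_eq_2)
  moreover have "F1 N 0 = 1" by (simp add: F1_def)
  moreover have "Ef (a\<^sup>2 * q ^ (N + 1)) k = 1"
  proof -
    have "Delta r (X k) p = Delta r x p"
      unfolding Delta_def using Xk by (intro prod.cong refl) auto
    moreover have "Delta r x p \<noteq> 0"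
      unfolding Delta_def using generic_XX[OF gen, of _ _ k] Xk n x0 by (auto simp: prod_zero_iff)
    ultimately show ?thesis unfolding Ef_def using ki by (auto intro!: prod.neutral)
  qed
  moreover have "(\<Prod>i=1..r. th (a * X k i * q ^ 0) * F2 a N k i / F3 a N k i) = 1"
  proof (rule prod.neutral, rule ballI)
    fix i assume i: "i \<in> {1..r}"
    define u where "u = a * x i"
    have u: "th u \<noteq> 0" "th (u * q) \<noteq> 0"
      using generic_ax[OF gen i, of 0] generic_ax[OF gen i, of 1] by (simp_all add: u_def)
    \<comment> \<open>For N = 0 the quotient is theta(u)/theta(u), for N = 1 it is theta(u)
      theta(uq) over the string of length two at u.\<close>
    have "N = 0 \<or> N = 1" using N by auto
    then show "th (a * X k i * q ^ 0) * F2 a N k i / F3 a N k i = 1"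
      unfolding F2_def F3_def n Xk[OF i] ki[OF i] u_def[symmetric] using u q0
      by (auto simp: ell_fact_Suc power2_eq_square)
  qed
  moreover have "Bf a N k = (\<Prod>j=1..r. ell_fact (a * q ^ 2 / q ^ N / b j) (q ^ 3) p N)"
  proof -
    have "N = 0 \<or> N = 1" using N by auto
    then show ?thesis
      unfolding Bf_def n using ki q0 by (auto intro!: prod.cong simp: ell_fact_Suc power2_eq_square)
  qed
  ultimately show ?thesis by (simp add: Df_def n)
qed

text \<open>The induction hypothesis is applied at a q, hence a is arbitrary in it. The nodes depend
  on |k| and the X_i, so the factor supplied by \<open>ell_fact_rhs_step\<close> is interpolated
  anew in every summand, and only then are the terms collected by their target index.\<close>

theorem Df_Bf_sum:
  assumes "generic a N M" "N \<le> M"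
  shows "(\<Sum>k\<in>sum_range r N. Df a N k * Bf a N k) =
    (\<Prod>j=1..r. ell_fact (a * q ^ 2 / q ^ N / b j) (q ^ 3) p N)"
  using assms
proof (induction N arbitrary: a rule: less_induct)
  case (less N)
  show ?case
  proof (cases "N < 2")
    case True
    then show ?thesis using Df_Bf_base less.prems by blast
  next
    case False
    then obtain L where N: "N = L + 2" by (metis add.commute le_Suc_ex not_less)
    note gen = less.prems(1)[unfolded N] and LM = less.prems(2)[unfolded N]
    define v where "v = a * q ^ 2 / q ^ (L + 2)"
    define c where "c = a\<^sup>2 * q ^ (L + 3)"
    define G where "G k = Df a (L + 2) k * Bf a (L + 2) k" for k
    have a: "a \<noteq> 0" using gen by (rule generic_a0)
    have v0: "v \<noteq> 0" "c \<noteq> 0" using a q0 by (simp_all add: v_def c_def)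
    have "2 * L + 3 + 2 = (L + 3) + (L + 2)" by simp
    then have "q ^ (2 * L + 3) * q ^ 2 = q ^ (L + 3) * q ^ (L + 2)"
      by (simp only: power_add[symmetric])
    then have cv: "c / v = a * q ^ (2 * L + 3)"
      unfolding c_def v_def power2_eq_square[of a] using a q0 by (simp add: divide_simps)
    have cc: "a\<^sup>2 * q ^ (L + 2 + 1) = c"
      by (simp add: c_def power_mult_distrib power_add power2_eq_square power3_eq_cube)
    have step: "Df (a * q) L k * Bf (a * q) L k * (\<Prod>j=1..r. th (v / b j) * th (c / v / b j)) =
      Af0 a L k * G k + (\<Sum>i=1..r. Af a L (k(i := Suc (k i))) i * G (k(i := Suc (k i))))"
      if k: "k \<in> sum_range r L" for k
    proof -
      have n: "2 * tsum r k \<le> L" "2 * tsum r k \<le> M" using k LM by (auto simp: sum_range_def)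
      define w where "w = a * q ^ (tsum r k + 1)"
      have w0: "w \<noteq> 0" using a q0 by (simp add: w_def)
      have "L + 3 = L + 2 + 1" by simp
      then have "q ^ (L + 3) = q ^ (L + 2) * q" by (simp only: power_add power_one_right)
      then have "c = w * (a * q ^ (L + 2) / q ^ tsum r k)"
        unfolding c_def w_def power2_eq_square[of a] power_add[of q "tsum r k"] using q0 by (simp only:) simp
      then have cw: "c / w = a * q ^ (L + 2) / q ^ tsum r k" using w0 by simp
      have lag: "(\<Prod>j=1..r. th (v / b j) * th (c / v / b j)) =
        Lf0 c v w k * (\<Prod>j=1..r. th (w / b j) * th (c / w / b j))
        + (\<Sum>i=1..r. Lf c v w k i * (\<Prod>j=1..r. th (b j * X k i) * th (c * X k i / b j) / b j))"
      proof (rule theta_lagrange[OF v0(2,1) w0])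
        fix i assume i: "i \<in> {1..r}"
        have "a * X k i * q ^ (tsum r k + 1) = w * X k i" by (simp add: w_def)
        moreover have "a * X k i * q ^ (L + 2) / q ^ tsum r k = c / w * X k i" by (simp add: cw)
        ultimately show "th (w * X k i) \<noteq> 0 \<and> th (c / w * X k i) \<noteq> 0"
          using generic_aX'[OF gen i, of k "tsum r k + 1"] generic_aX[OF gen i, of k "L + 2" "tsum r k"]
          by metis
        fix l assume l: "l \<in> {1..r}" "i \<noteq> l"
        show "th (X k l / X k i) \<noteq> 0 \<and> th (c * X k i * X k l) \<noteq> 0"
          using generic_XX[OF gen l(1) i l(2)[symmetric] n(2)] generic_cXX[OF gen i l, of k]
          unfolding cc by blast
      qed
      have stay: "Df (a * q) L k * Lf0 c v w k = Af0 a L k * Df a (L + 2) k"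
        unfolding c_def v_def w_def by (rule Df_stay[OF gen n(1)])
      have move: "Df (a * q) L k * Lf c v w k i = Af a L (k(i := Suc (k i))) i * Df a (L + 2) (k(i := Suc (k i)))"
        if "i \<in> {1..r}" for i
        unfolding c_def v_def w_def by (rule Df_move[OF gen LM n(1) that])
      have B0: "Bf (a * q) L k * (\<Prod>j=1..r. th (w / b j) * th (c / w / b j)) = Bf a (L + 2) k"
        unfolding cw unfolding w_def by (rule Bf_stay[OF n(1), symmetric])
      have B1: "Bf (a * q) L k * (\<Prod>j=1..r. th (b j * X k i) * th (c * X k i / b j) / b j) =
         Bf a (L + 2) (k(i := Suc (k i)))" if "i \<in> {1..r}" for i
        unfolding c_def by (rule Bf_move[OF n(1) that, symmetric])
      have alg: "D * B * (L * P) = (D * L) * (B * P)" for D B L P :: complex by simp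
      have S: "(\<Sum>i=1..r. Df (a * q) L k * Lf c v w k i * (Bf (a * q) L k *
          (\<Prod>j=1..r. th (b j * X k i) * th (c * X k i / b j) / b j))) =
        (\<Sum>i=1..r. Af a L (k(i := Suc (k i))) i * G (k(i := Suc (k i))))"
      proof (rule sum.cong[OF refl])
        fix i assume i: "i \<in> {1..r}"
        show "Df (a * q) L k * Lf c v w k i * (Bf (a * q) L k *
          (\<Prod>j=1..r. th (b j * X k i) * th (c * X k i / b j) / b j)) =
          Af a L (k(i := Suc (k i))) i * G (k(i := Suc (k i)))"
          unfolding move[OF i] B1[OF i] G_def by (rule mult.assoc)
      qed
      show ?thesis
        unfolding lag distrib_left sum_distrib_left alg S unfolding stay B0 G_def
        by (simp only: mult.assoc)
    qed
    have "(\<Prod>j=1..r. ell_fact (a * q ^ 2 / q ^ N / b j) (q ^ 3) p N) =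
      (\<Prod>j=1..r. ell_fact (a * q * q ^ 2 / q ^ L / b j) (q ^ 3) p L) *
      (\<Prod>j=1..r. th (v / b j) * th (c / v / b j))"
      unfolding N cv unfolding v_def by (rule ell_fact_rhs_step)
    also have "(\<Prod>j=1..r. ell_fact (a * q * q ^ 2 / q ^ L / b j) (q ^ 3) p L) =
      (\<Sum>k\<in>sum_range r L. Df (a * q) L k * Bf (a * q) L k)"
      using less.IH[of L "a * q"] generic_step[OF gen] LM N by simp
    also have "\<dots> * (\<Prod>j=1..r. th (v / b j) * th (c / v / b j)) =
      (\<Sum>k\<in>sum_range r L. Af0 a L k * G k + (\<Sum>i=1..r. Af a L (k(i := Suc (k i))) i * G (k(i := Suc (k i)))))"
      unfolding sum_distrib_right by (rule sum.cong[OF refl step])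
    also have "\<dots> = (\<Sum>k\<in>sum_range r L. Af0 a L k * G k) +
      (\<Sum>i=1..r. \<Sum>k\<in>sum_range r L. Af a L (k(i := Suc (k i))) i * G (k(i := Suc (k i))))"
      unfolding sum.distrib by (subst sum.swap) (rule refl)
    \<comment> \<open>On the new layer 2|k| is L + 1 or L + 2, and one of the first two thetas of
      \<open>Af0\<close> is theta(1) = 0.\<close>
    also have "(\<Sum>k\<in>sum_range r L. Af0 a L k * G k) = (\<Sum>k\<in>sum_range r (L + 2). Af0 a L k * G k)"
    proof (rule sum.mono_neutral_left)
      show "\<forall>k\<in>sum_range r (L + 2) - sum_range r L. Af0 a L k * G k = 0"
      proof
        fix k assume "k \<in> sum_range r (L + 2) - sum_range r L"
        then have "2 * tsum r k = L + 1 \<or> 2 * tsum r k = L + 2" by (auto simp: sum_range_def)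
        then have "th (q ^ (L + 1) / q ^ (2 * tsum r k)) * th (q ^ (L + 2) / q ^ (2 * tsum r k)) = 0"
          by (elim disjE) (simp_all only: divide_self[OF power_not_zero[OF q0]] theta_one[OF p]
              mult_zero_left mult_zero_right)
        then show "Af0 a L k * G k = 0" unfolding Af0_def by simp
      qed
    qed (simp_all add: finite_sum_range sum_range_mono)
    also have "(\<Sum>i=1..r. \<Sum>k\<in>sum_range r L. Af a L (k(i := Suc (k i))) i * G (k(i := Suc (k i)))) =
      (\<Sum>i=1..r. \<Sum>k\<in>sum_range r (L + 2). Af a L k i * G k)"
    proof (rule sum.cong[OF refl])
      fix i assume i: "i \<in> {1..r}"
      show "(\<Sum>k\<in>sum_range r L. Af a L (k(i := Suc (k i))) i * G (k(i := Suc (k i)))) =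
        (\<Sum>k\<in>sum_range r (L + 2). Af a L k i * G k)"
      \<comment> \<open>A target with k_i = 0 has no predecessor in direction i; its weight contains
        theta(X_i/x_i) = theta(1) = 0.\<close>
      proof (rule sum_range_shift[OF i, where f = "\<lambda>k. Af a L k i * G k"])
        fix k :: "nat \<Rightarrow> nat" assume "k i = 0"
        then have "th (X k i / x i) = 0" using x0[OF i] p by (simp add: X_def)
        then have "(\<Prod>j=1..r. th (X k i / x j)) = 0" using i by (intro prod_zero) auto
        then show "Af a L k i * G k = 0" unfolding Af_def by simp
      qed
    qed
    also have "(\<Sum>k\<in>sum_range r (L + 2). Af0 a L k * G k) + (\<Sum>i=1..r. \<Sum>k\<in>sum_range r (L + 2). Af a L k i * G k) =
      (\<Sum>k\<in>sum_range r (L + 2). (Af0 a L k + (\<Sum>i=1..r. Af a L k i)) * G k)"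
      unfolding distrib_right sum.distrib sum_distrib_right by (subst sum.swap) (rule refl)
    also have "\<dots> = (\<Sum>k\<in>sum_range r (L + 2). G k)"
    proof (rule sum.cong[OF refl])
      fix k assume "k \<in> sum_range r (L + 2)"
      then have "Af0 a L k + (\<Sum>i=1..r. Af a L k i) = 1"
        by (intro sum_Af[OF gen LM]) (simp add: sum_range_def)
      then show "(Af0 a L k + (\<Sum>i=1..r. Af a L k i)) * G k = G k" by simp
    qed
    finally show ?thesis unfolding N G_def by (rule sym)
  qed
qed

end

subsection \<open>The original normalization\<close>

lemma prod_power_lessThan: "(\<Prod>s<n. (q :: 'a :: comm_semiring_1) ^ s) = q ^ (n choose 2)"
  by (induction n) (simp_all add: numeral_2_eq_2 power_add mult_ac)

text \<open>Each factor is inverted by theta(1/z) = -theta(z)/z and the order of the factors is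
  reversed. The arguments 1/z, accumulated over the string, give the monomial in front.\<close>

lemma ell_fact_reflect:
  assumes p: "norm p < 1" and y: "y \<noteq> 0" and q: "q \<noteq> 0"
  shows "ell_fact (1 / (y * q ^ n)) q p n = (- 1 / (y * q ^ n)) ^ n * q ^ (n choose 2) * ell_fact (y * q) q p n"
proof -
  have "theta (1 / (y * q ^ n) * q ^ s) p =
      - 1 / (y * q ^ n) * q ^ s * theta (y * q * q ^ (n - Suc s)) p" if "s < n" for s
  proof -
    have "q ^ n = q ^ s * q ^ Suc (n - Suc s)" using that by (simp flip: power_add power_Suc)
    then have "1 / (y * q ^ n) * q ^ s = 1 / (y * q * q ^ (n - Suc s))" using q by simp
    moreover have "theta (1 / (y * q * q ^ (n - Suc s))) p =
        - theta (y * q * q ^ (n - Suc s)) p / (y * q * q ^ (n - Suc s))"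
      by (rule theta_inverse) (use p y q in auto)
    ultimately have "theta (1 / (y * q ^ n) * q ^ s) p = - (1 / (y * q ^ n) * q ^ s) * theta (y * q * q ^ (n - Suc s)) p"
      by simp
    then show ?thesis by simp
  qed
  then have "ell_fact (1 / (y * q ^ n)) q p n =
      (\<Prod>s<n. - 1 / (y * q ^ n) * q ^ s * theta (y * q * q ^ (n - Suc s)) p)"
    unfolding ell_fact_def by (intro prod.cong) auto
  also have "\<dots> = (- 1 / (y * q ^ n)) ^ n * q ^ (n choose 2) * (\<Prod>s<n. theta (y * q * q ^ (n - Suc s)) p)"
    unfolding prod.distrib prod_power_lessThan prod_constant card_lessThan ..
  also have "(\<Prod>s<n. theta (y * q * q ^ (n - Suc s)) p) = ell_fact (y * q) q p n"
    unfolding ell_fact_def by (rule prod.nat_diff_reindex)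
  finally show ?thesis .
qed

lemma tsum_square: "(tsum r k)\<^sup>2 = (\<Sum>i=1..r. (k i)\<^sup>2) + 2 * e2 r k"
proof (induction r)
  case 0
  show ?case by (simp add: tsum_def e2_def)
next
  case (Suc r)
  have "e2 (Suc r) k = (\<Sum>i=1..r. \<Sum>j=i+1..Suc r. k i * k j)"
    by (simp add: e2_def)
  also have "\<dots> = (\<Sum>i=1..r. (\<Sum>j=i+1..r. k i * k j) + k i * k (Suc r))"
    by (intro sum.cong) auto
  also have "\<dots> = e2 r k + tsum r k * k (Suc r)"
    by (simp add: sum.distrib e2_def tsum_def sum_distrib_right)
  finally have e: "e2 (Suc r) k = e2 r k + tsum r k * k (Suc r)" .
  have t: "tsum (Suc r) k = tsum r k + k (Suc r)" by (simp add: tsum_def)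
  show ?case unfolding e t using Suc by (simp add: power2_sum algebra_simps)
qed

lemma two_times_choose_two: "2 * (n choose 2) + n = n\<^sup>2"
  by (induction n) (simp_all add: numeral_2_eq_2)

text \<open>An additive form of the quadratic expansion, kept free of subtraction on the right so
  that it can be summed over natural numbers.\<close>

lemma choose_two_diff:
  assumes "k \<le> n"
  shows "((n - k) choose 2) + n * k = (n choose 2) + (k choose 2) + k"
proof -
  obtain d where n: "n = k + d" using assms le_Suc_ex by blast
  have "2 * (d choose 2) + d + 2 * ((k + d) * k) = 2 * ((k + d) choose 2) + 2 * (k choose 2) + 2 * k + d"
    using two_times_choose_two[of d] two_times_choose_two[of k] two_times_choose_two[of "k + d"]
    by (simp add: power2_eq_square algebra_simps)
  then show ?thesis by (simp add: n)
qed

text \<open>This balances the powers of q in \<open>power_part\<close>, with every exponent moved to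
  the side where it is positive. The second symmetric function enters through |k|^2 = sum of the
  k_i^2 + 2 e_2; this is the origin of q^(|k| - 2 e_2) in the summand.\<close>

lemma exponent_identity:
  fixes r :: nat and k :: "nat \<Rightarrow> nat"
  defines "n \<equiv> tsum r k"
  shows "n + (\<Sum>i=1..r. (n - k i) choose 2) + ((2 * n) choose 2) =
    2 * e2 r k + r * (n choose 2) + 2 * n + 3 * (\<Sum>i=1..r. k i choose 2)"
proof -
  have sn: "(\<Sum>i=1..r. k i) = n" by (simp add: n_def tsum_def)
  have "(\<Sum>i=1..r. ((n - k i) choose 2) + n * k i) = (\<Sum>i=1..r. (n choose 2) + (k i choose 2) + k i)"
    unfolding n_def by (intro sum.cong refl choose_two_diff tsum_ge)
  then have 1: "(\<Sum>i=1..r. (n - k i) choose 2) + n\<^sup>2 = r * (n choose 2) + (\<Sum>i=1..r. k i choose 2) + n"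
    unfolding sum.distrib sum_distrib_left[symmetric] sn by (simp add: power2_eq_square)
  have 2: "2 * ((2 * n) choose 2) + 2 * n = 4 * n\<^sup>2"
    using two_times_choose_two[of "2 * n"] by (simp add: power_mult_distrib)
  have "(\<Sum>i=1..r. (k i)\<^sup>2) = (\<Sum>i=1..r. 2 * (k i choose 2) + k i)"
    by (simp add: two_times_choose_two)
  also have "\<dots> = 2 * (\<Sum>i=1..r. k i choose 2) + n"
    unfolding sum.distrib sum_distrib_left[symmetric] sn ..
  finally have 3: "n\<^sup>2 = 2 * (\<Sum>i=1..r. k i choose 2) + n + 2 * e2 r k"
    using tsum_square[of r k] by (simp add: n_def)
  show ?thesis using 1 2 3 by linarith
qed

context theta_setting
begin

definition summand :: "complex \<Rightarrow> nat \<Rightarrow> (nat \<Rightarrow> nat) \<Rightarrow> complex" where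
  "summand a N k =
        Delta r (\<lambda>i. x i * q ^ (3 * k i)) p / Delta r x p
        * q powi (int (tsum r k) - 2 * int (e2 r k))
        * (\<Prod>i=1..r. \<Prod>j=i+1..r.
             1 / ell_fact (a^2 * x i * x j * q ^ (N + 1)) (q^3) p (k i + k j))
        * (\<Prod>i=1..r.
             theta (a * x i * q ^ (tsum r k + 3 * k i)) p / theta (a * x i) p
             * (ell_fact (a * x i) q p (tsum r k)
                * ell_fact (q powi (- int N) / (a * x i)) q p (tsum r k - k i))
             / (ell_fact (a * q / b i) q p (tsum r k)
                * ell_fact (b i * q powi (- int N) / a) q p (tsum r k)
                * ell_fact (q powi (int (k i) - int (tsum r k) + int N + 1) * a * x i)
                    q p (2 * k i)))
        * (ell_fact (q ^ (N + 1)) q p (tsum r k)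
           * ell_fact (q powi (- int N)) q p (2 * tsum r k)
           / (\<Prod>i=1..r. ell_fact (a * x i * q powi (2 - int N)) (q^3) p (k i)))
        * (\<Prod>i=1..r. \<Prod>j=1..r.
             ell_fact (b j * x i) (q^3) p (k i)
             * ell_fact (a^2 * x i * q ^ (N + 1) / b j) (q^3) p (k i)
             / ell_fact (q^3 * x i / x j) (q^3) p (k i))"

text \<open>The factor independent of k that separates the original normalization from the one by
  \<open>Df\<close> and \<open>Bf\<close>; it also connects the two right-hand sides.\<close>

definition norm_factor :: "complex \<Rightarrow> nat \<Rightarrow> complex" where
  "norm_factor a N = (\<Prod>i=1..r. ell_fact (a * x i * q) q p N /
     (ell_fact (a * q / b i) q p N * ell_fact (a * x i * q ^ 2 / q ^ N) (q ^ 3) p N))"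

text \<open>Up to a monomial, the reflected factorial consists of the last n factors of (a q/b_j;
  q)_N. The denominator therefore removes n factors at each end of this string, and the middle part
  of length N - 2n is the one in \<open>Bf\<close>.\<close>

lemma b_part:
  assumes a: "a \<noteq> 0" and j: "j \<in> {1..r}" and n: "2 * n \<le> N" and nz: "ell_fact (a * q / b j) q p N \<noteq> 0"
  shows "1 / (ell_fact (a * q / b j) q p n * ell_fact (b j * (1 / q ^ N) / a) q p n) =
    (- (a * q ^ N)) ^ n / q ^ (n choose 2) *
    (ell_fact (a * q ^ (n + 1) / b j) q p (N - 2 * n) / b j ^ n / ell_fact (a * q / b j) q p N)"
proof -
  obtain d where N: "N = n + (d + n)" using n by (metis add.assoc add.commute le_Suc_ex mult_2)
  define y where "y = a * q ^ (n + d) / b j"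
  have bj: "b j \<noteq> 0" by (rule b0[OF j])
  have y: "y \<noteq> 0" using a q0 bj by (simp add: y_def)
  have "b j * (1 / q ^ N) / a = 1 / (y * q ^ n)"
    using a q0 bj by (simp add: y_def N power_add)
  then have R: "ell_fact (b j * (1 / q ^ N) / a) q p n =
      (- 1 / (y * q ^ n)) ^ n * q ^ (n choose 2) * ell_fact (y * q) q p n"
    using ell_fact_reflect[OF p y q0, of n] by simp
  have e: "a * q / b j * q ^ n = a * q ^ (n + 1) / b j" "a * q ^ (n + 1) / b j * q ^ d = y * q"
    by (simp_all add: y_def power_add)
  have S: "ell_fact (a * q / b j) q p N = ell_fact (a * q / b j) q p n *
      (ell_fact (a * q ^ (n + 1) / b j) q p d * ell_fact (y * q) q p n)"
    by (simp only: N ell_fact_add e)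
  have d: "N - 2 * n = d" by (simp add: N)
  have "y * q ^ n = a * q ^ N / b j" by (simp add: y_def N power_add)
  then have yn: "(- 1 / (y * q ^ n)) ^ n * (- (a * q ^ N)) ^ n = b j ^ n"
    using a q0 bj by (simp add: flip: power_mult_distrib)
  have alg: "1 / (A * (u * Q * C)) = v / Q * (B / w / (A * (B * C)))"
    if "A * (B * C) \<noteq> 0" "u * v = w" "w \<noteq> 0" "Q \<noteq> 0" for A B C Q u v w :: complex
    using that by (auto simp: field_simps)
  show ?thesis
    unfolding R d S by (rule alg[OF nz[unfolded S] yn]) (use bj q0 in simp_all)
qed

text \<open>With u = a x_i and e = N - |k| + k_i, multiplication by (u;q)_(e+1) completes the
  reflected factorial to the string of exponents 0, ..., N and the factorial of length 2 k_i to the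
  string 0, ..., e + 2 k_i. The first is theta(u) (uq;q)_N, the second is (u;q)_|k| times
  \<open>F3\<close>.\<close>

lemma x_part:
  assumes gen: "generic a N M" and i: "i \<in> {1..r}" and n: "2 * tsum r k \<le> N"
  shows "ell_fact (a * x i) q p (tsum r k) * ell_fact (1 / q ^ N / (a * x i)) q p (tsum r k - k i)
     / (th (a * x i) * ell_fact (q ^ k i * q ^ N * q / q ^ tsum r k * a * x i) q p (2 * k i)) =
    (- 1 / (a * x i * q ^ N)) ^ (tsum r k - k i) * q ^ ((tsum r k - k i) choose 2) *
    (ell_fact (a * x i * q) q p N / F3 a N k i)"
proof -
  define n where "n = tsum r k"
  define u where "u = a * x i"
  have a: "a \<noteq> 0" using gen by (rule generic_a0)
  have u: "u \<noteq> 0" using a x0[OF i] by (simp add: u_def)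
  have un: "th (u * q ^ m) \<noteq> 0" for m unfolding u_def by (rule generic_ax[OF gen i])
  have ue: "ell_fact u q p m \<noteq> 0" for m using un by (auto simp: ell_fact_eq_0_iff)
  obtain m where m: "n = k i + m" using tsum_ge[OF i, of k] le_Suc_ex n_def by blast
  obtain d where N: "N = 2 * n + d" using assms(3) le_Suc_ex n_def by blast
  define e where "e = n + d + k i"
  define y where "y = u * q ^ e"
  have y: "y \<noteq> 0" using u q0 by (simp add: y_def)
  have Ne: "N = e + m" by (simp add: N e_def m)
  have "1 / q ^ N / u = 1 / (y * q ^ m)" by (simp add: y_def Ne power_add)
  then have R: "ell_fact (1 / q ^ N / u) q p m = (- 1 / (y * q ^ m)) ^ m * q ^ (m choose 2) * ell_fact (y * q) q p m"
    using ell_fact_reflect[OF p y q0, of m] by simp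
  have yN: "y * q ^ m = u * q ^ N" by (simp add: y_def Ne power_add)
  have "q ^ k i * q ^ N * q / q ^ n * a * x i = q ^ (k i + N + 1) / q ^ n * u"
    by (simp add: u_def power_add)
  also have "k i + N + 1 = n + (e + 1)" by (simp add: N e_def)
  also have "q ^ (n + (e + 1)) / q ^ n * u = y * q" using q0 by (simp add: y_def power_add)
  finally have C: "q ^ k i * q ^ N * q / q ^ n * a * x i = y * q" .
  have 1: "ell_fact u q p (Suc e) * ell_fact (y * q) q p m = th u * ell_fact (u * q) q p N"
  proof -
    have "ell_fact u q p (Suc e + m) = th u * ell_fact (u * q) q p N"
      unfolding Ne by (simp add: ell_fact_Suc_left)
    then show ?thesis unfolding ell_fact_add by (simp add: y_def mult_ac)
  qed
  have 2: "ell_fact u q p (Suc e) * ell_fact (y * q) q p (2 * k i) = ell_fact u q p n * F3 a N k i"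
  proof -
    have "N - 2 * n + 3 * k i + 1 = d + 3 * k i + 1" by (simp add: N)
    then have F: "F3 a N k i = ell_fact (u * q ^ n) q p (d + 3 * k i + 1)"
      by (simp add: F3_def n_def[symmetric] u_def)
    have "Suc e + 2 * k i = n + (d + 3 * k i + 1)" by (simp add: e_def)
    then have "ell_fact u q p (Suc e + 2 * k i) = ell_fact u q p (n + (d + 3 * k i + 1))" by (rule arg_cong)
    then show ?thesis unfolding F ell_fact_add by (simp add: y_def mult_ac)
  qed
  have alg: "D * (w * B) / (t * C) = w * (P / F)"
    if "A * B = t * P" "A * C = D * F" "A \<noteq> 0" "D \<noteq> 0" "t \<noteq> 0" for A B C D F P t w :: complex
  proof -
    have "D * (w * B) / (t * C) = w * D * (A * B) / (t * (A * C))" using that(3) by simp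
    also have "\<dots> = w * (P / F)" unfolding that(1,2) using that(4,5) by simp
    finally show ?thesis .
  qed
  have t: "th u \<noteq> 0" using un[of 0] by simp
  have nm: "n - k i = m" by (simp add: m)
  show ?thesis
    unfolding n_def[symmetric] C nm unfolding u_def[symmetric] R yN
    by (rule alg[OF 1 2 ue ue t])
qed

text \<open>The three reflections, in \<open>b_part\<close>, \<open>x_part\<close> and the factorial
  of q^(-N), contribute these monomials. For each i all but k_i of the factors -a q^N cancel; the
  powers of q are compared in \<open>exponent_identity\<close>.\<close>

lemma power_part:
  assumes a: "a \<noteq> 0"
  shows "q powi (int (tsum r k) - 2 * int (e2 r k))
    * (\<Prod>i=1..r. (- 1 / (a * x i * q ^ N)) ^ (tsum r k - k i) * q ^ ((tsum r k - k i) choose 2)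
        * ((- (a * q ^ N)) ^ tsum r k / q ^ (tsum r k choose 2)))
    * ((- 1 / q ^ N) ^ (2 * tsum r k) * q ^ ((2 * tsum r k) choose 2)) = Pw a N k"
proof -
  define n where "n = tsum r k"
  have point: "(- 1 / (a * x i * q ^ N)) ^ (n - k i) * q ^ ((n - k i) choose 2)
      * ((- (a * q ^ N)) ^ n / q ^ (n choose 2)) =
     (- (a * q ^ N)) ^ k i * (x i ^ k i / x i ^ n) * (q ^ ((n - k i) choose 2) / q ^ (n choose 2))"
    if i: "i \<in> {1..r}" for i
  proof -
    obtain m where m: "n = k i + m" using tsum_ge[OF i, of k] le_Suc_ex n_def by blast
    have 1: "(- 1 / (a * x i * q ^ N)) ^ m * (- (a * q ^ N)) ^ m = 1 / x i ^ m"
      using a q0 by (simp add: power_one_over flip: power_mult_distrib)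
    have nm: "n - k i = m" by (simp add: m)
    have h: "(- 1 / (a * x i * q ^ N)) ^ m * (- (a * q ^ N)) ^ n = (- (a * q ^ N)) ^ k i * (x i ^ k i / x i ^ n)"
    proof -
      have "(- 1 / (a * x i * q ^ N)) ^ m * (- (a * q ^ N)) ^ n = (- (a * q ^ N)) ^ k i *
          ((- 1 / (a * x i * q ^ N)) ^ m * (- (a * q ^ N)) ^ m)"
        unfolding m power_add by (simp only: mult_ac)
      then show ?thesis unfolding 1 unfolding m power_add using x0[OF i] by simp
    qed
    have alg: "A * B * (C / D) = A * C * (B / D)" for A B C D :: complex by simp
    show ?thesis unfolding nm h[symmetric] by (rule alg)
  qed
  define C where "C = (\<Sum>i=1..r. k i choose 2)"
  define D where "D = (\<Sum>i=1..r. (n - k i) choose 2)"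
  define U where "U = (\<Prod>i=1..r. x i)"
  define V where "V = (\<Prod>i=1..r. x i ^ k i)"
  have kn: "(\<Sum>i=1..r. k i) = n" by (simp add: n_def tsum_def)
  have P: "(\<Prod>i=1..r. (- 1 / (a * x i * q ^ N)) ^ (n - k i) * q ^ ((n - k i) choose 2)
      * ((- (a * q ^ N)) ^ n / q ^ (n choose 2))) =
      (- (a * q ^ N)) ^ n * (V / U ^ n) * (q ^ D / q ^ (r * (n choose 2)))"
  proof -
    have "(\<Prod>i=1..r. (- 1 / (a * x i * q ^ N)) ^ (n - k i) * q ^ ((n - k i) choose 2)
      * ((- (a * q ^ N)) ^ n / q ^ (n choose 2))) =
      (\<Prod>i=1..r. (- (a * q ^ N)) ^ k i * (x i ^ k i / x i ^ n) * (q ^ ((n - k i) choose 2) / q ^ (n choose 2)))"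
      by (rule prod.cong[OF refl point])
    moreover have "(\<Prod>i=1..r. q ^ (n choose 2)) = q ^ (r * (n choose 2))"
      by (simp add: mult.commute flip: power_mult)
    ultimately show ?thesis
      unfolding prod.distrib prod_dividef D_def V_def U_def
      by (simp add: prod_power_distrib kn[unfolded One_nat_def] flip: power_sum)
  qed
  have Pw: "Pw a N k = (- a) ^ n * q ^ (2 * n) / q ^ (N * n) * (q ^ (3 * C) * V) / U ^ n"
  proof -
    have "(\<Prod>i=1..r. q ^ (3 * (k i choose 2)) * x i ^ k i) = q ^ (3 * C) * V"
      by (simp add: prod.distrib C_def V_def sum_distrib_left flip: power_sum)
    then show ?thesis unfolding Pw_def n_def[symmetric] U_def by simp
  qed
  have q1: "q powi (int n - 2 * int (e2 r k)) = q ^ n / q ^ (2 * e2 r k)"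
    using q0 by (simp add: power_int_diff flip: power_int_of_nat)
  have E: "q ^ n * q ^ D * q ^ ((2 * n) choose 2) = q ^ (2 * e2 r k) * q ^ (r * (n choose 2)) * q ^ (2 * n) * q ^ (3 * C)"
    unfolding power_add[symmetric] D_def C_def n_def by (rule arg_cong[where f = "power q", OF exponent_identity])
  have 2: "(- (a * q ^ N)) ^ n = (- a) ^ n * q ^ (N * n)" by (simp add: power_mult flip: power_mult_distrib)
  have 3: "(- 1 / q ^ N) ^ (2 * n) = 1 / (q ^ (N * n) * q ^ (N * n))"
    unfolding power_mult[of _ 2 n] power_mult[of q N n] by (simp add: power2_eq_square power_divide power_mult_distrib)
  have alg: "A / B * (al * T * (V / U) * (D / R)) * (1 / (T * T) * F) = al * W / T * (Z * V) / U"
    if "A * D * F = B * R * W * Z" "B \<noteq> 0" "R \<noteq> 0" "T \<noteq> 0" for A B D F R T U V W Z al :: complex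
  proof -
    have "A / B * (al * T * (V / U) * (D / R)) * (1 / (T * T) * F) = al * V / (U * T * (B * R)) * (A * D * F)"
      using that(4) by (simp add: mult_ac)
    also have "\<dots> = al * W / T * (Z * V) / U" unfolding that(1) using that(2,3) by (simp add: mult_ac)
    finally show ?thesis .
  qed
  show ?thesis
    unfolding n_def[symmetric] P Pw q1 3 unfolding 2 by (rule alg[OF E]) (use q0 in simp_all)
qed

lemma summand_eq:
  assumes gen: "generic a N M" and k: "k \<in> sum_range r N"
    and nz: "\<And>i. i \<in> {1..r} \<Longrightarrow> ell_fact (a * q / b i) q p N \<noteq> 0"
  shows "summand a N k = norm_factor a N * (Df a N k * Bf a N k)"
proof -
  define n where "n = tsum r k"
  have n: "2 * tsum r k \<le> N" "2 * n \<le> N" using k by (simp_all add: sum_range_def n_def)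
  have a: "a \<noteq> 0" using gen by (rule generic_a0)
  define w where "w i = (- 1 / (a * x i * q ^ N)) ^ (n - k i) * q ^ ((n - k i) choose 2)" for i
  define v where "v = (- (a * q ^ N)) ^ n / q ^ (n choose 2)"
  define Bp where "Bp i = ell_fact (a * q ^ (n + 1) / b i) q p (N - 2 * n) / b i ^ n" for i
  define R where "R i = ell_fact (a * x i * q ^ 2 / q ^ N) (q ^ 3) p N" for i
  define P where "P i = ell_fact (a * x i * q) q p N" for i
  define EN where "EN i = ell_fact (a * q / b i) q p N" for i
  have qm: "q powi (- int N) = 1 / q ^ N" by (simp add: power_int_minus divide_inverse)
  have q2: "q powi (2 - int N) = q ^ 2 / q ^ N"
    using q0 by (simp add: power_int_diff)
  have q3: "q powi (int (k i) - int n + int N + 1) = q ^ k i * q ^ N * q / q ^ n" for i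
    using q0 by (simp add: power_int_diff power_int_add)
  define M1 where "M1 i = th (a * x i * q ^ (n + 3 * k i)) / th (a * x i)
      * (ell_fact (a * x i) q p n * ell_fact (1 / q ^ N / (a * x i)) q p (n - k i))
      / (ell_fact (a * q / b i) q p n * ell_fact (b i * (1 / q ^ N) / a) q p n
         * ell_fact (q ^ k i * q ^ N * q / q ^ n * a * x i) q p (2 * k i))" for i
  define r3 where "r3 i = ell_fact (a * x i * (q ^ 2 / q ^ N)) (q ^ 3) p (k i)" for i
  have M1: "M1 i / r3 i = (w i * v) * (th (a * X k i * q ^ n) * F2 a N k i / F3 a N k i) * Bp i
      * (P i / (EN i * R i))" if i: "i \<in> {1..r}" for i
  proof -
    have B: "1 / (ell_fact (a * q / b i) q p n * ell_fact (b i * (1 / q ^ N) / a) q p n) = v * (Bp i / EN i)"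
      unfolding v_def Bp_def EN_def by (rule b_part[OF a i n(2) nz[OF i]])
    have X: "ell_fact (a * x i) q p n * ell_fact (1 / q ^ N / (a * x i)) q p (n - k i)
     / (th (a * x i) * ell_fact (q ^ k i * q ^ N * q / q ^ n * a * x i) q p (2 * k i)) = w i * (P i / F3 a N k i)"
      unfolding w_def P_def n_def by (rule x_part[OF gen i n(1)])
    have nr: "ell_fact (a * x i * (q ^ 2 / q ^ N)) (q ^ 3) p m \<noteq> 0" for m
    proof -
      have "th (a * x i * (q ^ 2 / q ^ N) * (q ^ 3) ^ s) \<noteq> 0" for s
      proof -
        have "th (a * x i * q ^ (2 + 3 * s) / q ^ N) \<noteq> 0" using gen i unfolding generic_def by blast
        then show ?thesis unfolding power_add power_mult[of q 3 s] by (simp add: mult.assoc)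
      qed
      then show ?thesis unfolding ell_fact_eq_0_iff by blast
    qed
    \<comment> \<open>The initial string \<open>r3\<close> of length k_i is traded for its
      complement \<open>F2\<close> in the full string \<open>R\<close>, which belongs to
      \<open>norm_factor\<close>.\<close>
    have "k i \<le> N" using tsum_ge[OF i, of k] n by simp
    then have "R i = ell_fact (a * x i * (q ^ 2 / q ^ N)) (q ^ 3) p (k i + (N - k i))"
      by (simp add: R_def)
    also have "\<dots> = r3 i * F2 a N k i"
      unfolding ell_fact_add r3_def F2_def X_def power_mult[of q 3] by (simp add: mult_ac)
    finally have R: "R i = r3 i * F2 a N k i" .
    have "R i = ell_fact (a * x i * (q ^ 2 / q ^ N)) (q ^ 3) p N" by (simp add: R_def)
    then have r: "r3 i \<noteq> 0" "F2 a N k i \<noteq> 0" using nr R by (auto simp: r3_def)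
    have t: "th (a * x i * q ^ (n + 3 * k i)) = th (a * X k i * q ^ n)"
      by (simp add: X_def power_add mult_ac)
    have alg: "T / t * (D * B) / (E * G * C) / s = T / s * (D * B / (t * C)) * (1 / (E * G))"
      for B C D E G T s t :: complex by (simp add: mult_ac)
    have "M1 i / r3 i = th (a * X k i * q ^ n) / r3 i
      * (ell_fact (a * x i) q p n * ell_fact (1 / q ^ N / (a * x i)) q p (n - k i)
     / (th (a * x i) * ell_fact (q ^ k i * q ^ N * q / q ^ n * a * x i) q p (2 * k i)))
      * (1 / (ell_fact (a * q / b i) q p n * ell_fact (b i * (1 / q ^ N) / a) q p n))"
      unfolding M1_def t by (rule alg)
    then show ?thesis unfolding X B R using r by (simp add: mult_ac)
  qed
  define A1 where "A1 = Delta r (X k) p / Delta r x p"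
  define A2 where "A2 = (\<Prod>i=1..r. \<Prod>j=i+1..r. 1 / ell_fact (a\<^sup>2 * q ^ (N + 1) * x i * x j) (q ^ 3) p (k i + k j))"
  define A3 where "A3 = (\<Prod>i=1..r. \<Prod>j=1..r. 1 / ell_fact (q ^ 3 * x i / x j) (q ^ 3) p (k i))"
  define BB where "BB = (\<Prod>j=1..r. \<Prod>i=1..r. ell_fact (b j * x i) (q ^ 3) p (k i)
         * ell_fact (a\<^sup>2 * q ^ (N + 1) * x i / b j) (q ^ 3) p (k i))"
  define qp where "qp = q powi (int n - 2 * int (e2 r k))"
  define w0 where "w0 = (- 1 / q ^ N) ^ (2 * n) * q ^ ((2 * n) choose 2)"
  have Xk: "X k = (\<lambda>i. x i * q ^ (3 * k i))" by (rule ext) (simp add: X_def)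
  have e2': "(\<Prod>i=1..r. \<Prod>j=i+1..r. 1 / ell_fact (a\<^sup>2 * x i * x j * q ^ (N + 1)) (q ^ 3) p (k i + k j)) = A2"
  proof -
    have "a\<^sup>2 * x i * x j * q ^ (N + 1) = a\<^sup>2 * q ^ (N + 1) * x i * x j" for i j by (simp only: mult_ac)
    then show ?thesis unfolding A2_def by (simp only:)
  qed
  have e3: "(\<Prod>i=1..r. \<Prod>j=1..r. ell_fact (b j * x i) (q^3) p (k i)
             * ell_fact (a\<^sup>2 * x i * q ^ (N + 1) / b j) (q^3) p (k i)
             / ell_fact (q^3 * x i / x j) (q^3) p (k i)) = BB * A3"
  proof -
    have "a\<^sup>2 * x i * q ^ (N + 1) = a\<^sup>2 * q ^ (N + 1) * x i" for i by (simp only: mult_ac)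
    then have "(\<Prod>i=1..r. \<Prod>j=1..r. ell_fact (b j * x i) (q^3) p (k i)
             * ell_fact (a\<^sup>2 * x i * q ^ (N + 1) / b j) (q^3) p (k i)
             / ell_fact (q^3 * x i / x j) (q^3) p (k i)) =
       (\<Prod>i=1..r. \<Prod>j=1..r. ell_fact (b j * x i) (q^3) p (k i)
             * ell_fact (a\<^sup>2 * q ^ (N + 1) * x i / b j) (q^3) p (k i)
             * (1 / ell_fact (q^3 * x i / x j) (q^3) p (k i)))"
      by (simp only: times_divide_eq_right mult_1_right)
    also have "\<dots> = BB * A3"
    proof -
      have BB: "BB = (\<Prod>i=1..r. \<Prod>j=1..r. ell_fact (b j * x i) (q ^ 3) p (k i)
         * ell_fact (a\<^sup>2 * q ^ (N + 1) * x i / b j) (q ^ 3) p (k i))"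
        unfolding BB_def by (rule prod.swap)
      show ?thesis unfolding BB A3_def prod.distrib ..
    qed
    finally show ?thesis .
  qed
  have F1e: "ell_fact (q ^ (N + 1)) q p n * ell_fact (1 / q ^ N) q p (2 * n) = w0 * F1 N n"
  proof -
    define y where "y = q ^ N / q ^ (2 * n)"
    have y: "y \<noteq> 0" using q0 by (simp add: y_def)
    have yq: "y * q ^ (2 * n) = q ^ N" using q0 by (simp add: y_def)
    have "ell_fact (1 / q ^ N) q p (2 * n) = (- 1 / q ^ N) ^ (2 * n) * q ^ ((2 * n) choose 2) * ell_fact (y * q) q p (2 * n)"
      using ell_fact_reflect[OF p y q0, of "2 * n"] unfolding yq .
    moreover have "F1 N n = ell_fact (y * q) q p (2 * n) * ell_fact (q ^ (N + 1)) q p n"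
    proof -
      have "F1 N n = ell_fact (y * q) q p (2 * n + n)" by (simp add: F1_def y_def mult.commute)
      also have "\<dots> = ell_fact (y * q) q p (2 * n) * ell_fact (y * q ^ (2 * n) * q) q p n"
        unfolding ell_fact_add by (simp add: mult_ac)
      finally show ?thesis unfolding yq by (simp add: mult.commute)
    qed
    ultimately show ?thesis by (simp add: w0_def)
  qed
  have S: "summand a N k = A1 * qp * A2 * (\<Prod>i=1..r. M1 i) * (w0 * F1 N n / (\<Prod>i=1..r. r3 i)) * (BB * A3)"
    unfolding summand_def n_def[symmetric] qm q2 q3 e2' e3 F1e M1_def[symmetric] r3_def[symmetric] qp_def A1_def Xk ..
  have "(\<Prod>i=1..r. M1 i) / (\<Prod>i=1..r. r3 i) =
    (\<Prod>i=1..r. (w i * v) * (th (a * X k i * q ^ n) * F2 a N k i / F3 a N k i) * Bp i * (P i / (EN i * R i)))"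
    unfolding prod_dividef[symmetric] by (rule prod.cong[OF refl M1])
  also have "\<dots> = (\<Prod>i=1..r. w i * v) * (\<Prod>i=1..r. th (a * X k i * q ^ n) * F2 a N k i / F3 a N k i)
      * (\<Prod>i=1..r. Bp i) * norm_factor a N"
    unfolding norm_factor_def P_def[symmetric] EN_def[symmetric] R_def[symmetric] prod.distrib[symmetric] ..
  finally have PM: "(\<Prod>i=1..r. M1 i) / (\<Prod>i=1..r. r3 i) = (\<Prod>i=1..r. w i * v) *
      (\<Prod>i=1..r. th (a * X k i * q ^ n) * F2 a N k i / F3 a N k i) * (\<Prod>i=1..r. Bp i) * norm_factor a N" .
  have Pw: "qp * (\<Prod>i=1..r. w i * v) * w0 = Pw a N k"
    unfolding qp_def w_def v_def w0_def n_def by (rule power_part[OF a])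
  have Ef: "Ef (a\<^sup>2 * q ^ (N + 1)) k = A1 * A2 * A3"
    unfolding Ef_def A1_def A2_def A3_def ..
  have Bf: "Bf a N k = (\<Prod>i=1..r. Bp i) * BB"
    unfolding Bf_def n_def[symmetric] Bp_def BB_def prod.distrib ..
  have alg: "a1 * qp' * a2 * m * (w' * f / r') * (bb * a3) = nf * ((qp' * wv * w') * f * (a1 * a2 * a3) * t * (bp * bb))"
    if "m / r' = wv * t * bp * nf" for a1 qp' a2 m w' f r' bb a3 nf wv t bp :: complex
  proof -
    have "a1 * qp' * a2 * m * (w' * f / r') * (bb * a3) = a1 * qp' * a2 * w' * f * bb * a3 * (m / r')"
      by (simp add: mult_ac)
    then show ?thesis unfolding that by (simp add: mult_ac)
  qed
  show ?thesis
    unfolding S Df_def n_def[symmetric] Pw[symmetric] Ef Bf by (rule alg[OF PM])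
qed

lemma summand_sum_generic:
  assumes gen: "generic a N N"
    and nz: "\<And>i. i \<in> {1..r} \<Longrightarrow> ell_fact (a * q / b i) q p N \<noteq> 0"
  shows "(\<Sum>k\<in>sum_range r N. summand a N k) = (\<Prod>i=1..r.
          ell_fact (a * x i * q) q p N * ell_fact (a * q powi (2 - int N) / b i) (q^3) p N
          / (ell_fact (a * q / b i) q p N
             * ell_fact (a * x i * q powi (2 - int N)) (q^3) p N))"
proof -
  have q2: "q powi (2 - int N) = q ^ 2 / q ^ N"
    using q0 by (simp add: power_int_diff)
  have "(\<Sum>k\<in>sum_range r N. summand a N k) = (\<Sum>k\<in>sum_range r N. norm_factor a N * (Df a N k * Bf a N k))"
    by (rule sum.cong[OF refl summand_eq[OF gen _ nz]])
  also have "\<dots> = norm_factor a N * (\<Prod>j=1..r. ell_fact (a * q ^ 2 / q ^ N / b j) (q ^ 3) p N)"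
    unfolding sum_distrib_left[symmetric] Df_Bf_sum[OF gen order.refl] ..
  also have "\<dots> = (\<Prod>i=1..r.
          ell_fact (a * x i * q) q p N * ell_fact (a * q powi (2 - int N) / b i) (q^3) p N
          / (ell_fact (a * q / b i) q p N
             * ell_fact (a * x i * q powi (2 - int N)) (q^3) p N))"
    unfolding norm_factor_def q2 prod.distrib[symmetric] by (rule prod.cong) simp_all
  finally show ?thesis .
qed

end

subsection \<open>Removal of the genericity assumption\<close>

lemma continuous_on_ell_fact [continuous_intros]:
  assumes "norm p < 1" "q \<noteq> 0" "continuous_on S f" "\<And>z. z \<in> S \<Longrightarrow> f z \<noteq> 0"
  shows "continuous_on S (\<lambda>z. ell_fact (f z) q p n)"
  unfolding ell_fact_def using assms by (intro continuous_intros) auto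

lemma countable_theta_zeros_scaled:
  assumes p: "norm p < 1" and u: "u \<noteq> 0"
  shows "countable {a. a \<noteq> 0 \<and> theta (a * u) p = 0}"
proof (rule countable_subset)
  let ?Z = "{x. x \<noteq> 0 \<and> theta x p = 0}"
  show "{a. a \<noteq> 0 \<and> theta (a * u) p = 0} \<subseteq> (\<lambda>w. w / u) ` ?Z"
  proof
    fix a assume "a \<in> {a. a \<noteq> 0 \<and> theta (a * u) p = 0}"
    then have "a * u / u \<in> (\<lambda>w. w / u) ` ?Z" using u by (intro imageI) auto
    then show "a \<in> (\<lambda>w. w / u) ` ?Z" using u by simp
  qed
  show "countable ((\<lambda>w. w / u) ` ?Z)" using countable_theta_zeros[OF p] by (rule countable_image)
qed

text \<open>The square of a is confined to a countable set, and each value has only the two roots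
  given by \<open>csqrt\<close> and its negative.\<close>

lemma countable_theta_zeros_square:
  assumes p: "norm p < 1" and u: "u \<noteq> 0"
  shows "countable {a. a \<noteq> 0 \<and> theta (a\<^sup>2 * u) p = 0}"
proof (rule countable_subset)
  let ?Z = "{a. a \<noteq> 0 \<and> theta (a * u) p = 0}"
  show "{a. a \<noteq> 0 \<and> theta (a\<^sup>2 * u) p = 0} \<subseteq> csqrt ` ?Z \<union> (\<lambda>w. - csqrt w) ` ?Z"
  proof
    fix a assume "a \<in> {a. a \<noteq> 0 \<and> theta (a\<^sup>2 * u) p = 0}"
    then have "a\<^sup>2 \<in> ?Z" by simp
    moreover have "(csqrt (a\<^sup>2))\<^sup>2 = a\<^sup>2" by simp
    then have "a = csqrt (a\<^sup>2) \<or> a = - csqrt (a\<^sup>2)" by (simp only: power2_eq_iff) auto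
    ultimately show "a \<in> csqrt ` ?Z \<union> (\<lambda>w. - csqrt w) ` ?Z" by blast
  qed
  show "countable (csqrt ` ?Z \<union> (\<lambda>w. - csqrt w) ` ?Z)"
    using countable_theta_zeros_scaled[OF p u] by auto
qed

context theta_setting
begin

text \<open>The nonvanishing conditions of the theorem that involve a, collected as a set of values
  of a on which both sides can be varied continuously.\<close>

definition regular :: "nat \<Rightarrow> complex \<Rightarrow> bool" where
  "regular N a \<longleftrightarrow> a \<noteq> 0 \<and> (\<forall>i\<in>{1..r}. th (a * x i) \<noteq> 0) \<and>
    (\<forall>k\<in>sum_range r N. \<forall>i\<in>{1..r}. \<forall>j\<in>{i+1..r}.
       ell_fact (a^2 * x i * x j * q ^ (N + 1)) (q^3) p (k i + k j) \<noteq> 0) \<and>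
    (\<forall>k\<in>sum_range r N. \<forall>i\<in>{1..r}.
       ell_fact (a * q / b i) q p (tsum r k) \<noteq> 0 \<and>
       ell_fact (b i * q powi (- int N) / a) q p (tsum r k) \<noteq> 0 \<and>
       ell_fact (q powi (int (k i) - int (tsum r k) + int N + 1) * a * x i) q p (2 * k i) \<noteq> 0 \<and>
       ell_fact (a * x i * q powi (2 - int N)) (q^3) p (k i) \<noteq> 0) \<and>
    (\<forall>i\<in>{1..r}. ell_fact (a * q / b i) q p N \<noteq> 0 \<and>
       ell_fact (a * x i * q powi (2 - int N)) (q^3) p N \<noteq> 0)"

text \<open>The conditions are finitely many, so they amount to the nonvanishing of one product,
  continuous on the punctured plane.\<close>

lemma open_regular: "open {a. regular N a}"
proof -
  define D where "D a = (\<Prod>i\<in>{1..r}. th (a * x i)) *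
    (\<Prod>k\<in>sum_range r N. \<Prod>i\<in>{1..r}. \<Prod>j\<in>{i+1..r}.
       ell_fact (a^2 * x i * x j * q ^ (N + 1)) (q^3) p (k i + k j)) *
    (\<Prod>k\<in>sum_range r N. \<Prod>i\<in>{1..r}.
       ell_fact (a * q / b i) q p (tsum r k) *
       (ell_fact (b i * q powi (- int N) / a) q p (tsum r k) *
       (ell_fact (q powi (int (k i) - int (tsum r k) + int N + 1) * a * x i) q p (2 * k i) *
       ell_fact (a * x i * q powi (2 - int N)) (q^3) p (k i)))) *
    (\<Prod>i\<in>{1..r}. ell_fact (a * q / b i) q p N *
       ell_fact (a * x i * q powi (2 - int N)) (q^3) p N)" for a
  have eq: "regular N a \<longleftrightarrow> a \<in> - {0} \<inter> D -` (- {0})" for a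
    unfolding regular_def D_def by (simp add: prod_zero_iff finite_sum_range)
  have "continuous_on (- {0}) D"
    unfolding D_def using p q0 x0 b0
    by (intro continuous_intros) auto
  then have "open (- {0} \<inter> D -` (- {0}))"
    by (intro continuous_open_preimage) auto
  then show ?thesis unfolding eq Collect_mem_eq .
qed

lemma continuous_summand:
  assumes k: "k \<in> sum_range r N"
    and E: "\<And>i j. i \<in> {1..r} \<Longrightarrow> j \<in> {1..r} \<Longrightarrow>
      ell_fact (q^3 * x i / x j) (q^3) p (k i) \<noteq> 0"
  shows "continuous_on {a. regular N a} (\<lambda>a. summand a N k)"
proof -
  let ?S = "{a. regular N a}"
  have nz: "a \<noteq> 0" "i \<in> {1..r} \<Longrightarrow> th (a * x i) \<noteq> 0"
    "i \<in> {1..r} \<Longrightarrow> j \<in> {i+1..r} \<Longrightarrow>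
      ell_fact (a^2 * x i * x j * q ^ (N + 1)) (q^3) p (k i + k j) \<noteq> 0"
    "i \<in> {1..r} \<Longrightarrow> ell_fact (a * q / b i) q p (tsum r k) \<noteq> 0"
    "i \<in> {1..r} \<Longrightarrow> ell_fact (b i * q powi (- int N) / a) q p (tsum r k) \<noteq> 0"
    "i \<in> {1..r} \<Longrightarrow>
      ell_fact (q powi (int (k i) - int (tsum r k) + int N + 1) * a * x i) q p (2 * k i) \<noteq> 0"
    "i \<in> {1..r} \<Longrightarrow> ell_fact (a * x i * q powi (2 - int N)) (q^3) p (k i) \<noteq> 0"
    if "a \<in> ?S" for a i j
    using that k unfolding regular_def by blast+
  have prod_nz: "prod f A \<noteq> (0 :: complex)" if "\<And>i. i \<in> A \<Longrightarrow> f i \<noteq> 0" for f and A :: "nat set"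
    using that by (cases "finite A") auto
  have pin: "u powi m \<noteq> 0" if "u \<noteq> 0" for u :: complex and m
    using that by simp
  have din: "u / w \<noteq> 0" if "u \<noteq> 0" "w \<noteq> 0" for u w :: complex
    using that by simp
  have xj: "x j \<noteq> 0" if "j \<in> {i+1..r}" for i j using that x0 by simp
  show ?thesis
    unfolding summand_def
    by (intro continuous_intros; (rule ballI)?;
        (rule p | rule q0 | (rule nz x0 b0 xj E; assumption) | (intro no_zero_divisors prod_nz; rule nz(2-); assumption)
          | (intro no_zero_divisors power_not_zero pin din;
              (rule q0 | (rule nz(1), assumption) | (rule x0 b0 xj, assumption)))))
qed

lemma continuous_summand_rhs:
  "continuous_on {a. regular N a} (\<lambda>a. \<Prod>i=1..r.
          ell_fact (a * x i * q) q p N * ell_fact (a * q powi (2 - int N) / b i) (q^3) p N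
          / (ell_fact (a * q / b i) q p N
             * ell_fact (a * x i * q powi (2 - int N)) (q^3) p N))"
proof -
  have nz: "a \<noteq> 0" "i \<in> {1..r} \<Longrightarrow> ell_fact (a * q / b i) q p N \<noteq> 0"
    "i \<in> {1..r} \<Longrightarrow> ell_fact (a * x i * q powi (2 - int N)) (q^3) p N \<noteq> 0"
    if "a \<in> {a. regular N a}" for a i
    using that unfolding regular_def by blast+
  have pin: "u powi m \<noteq> 0" if "u \<noteq> 0" for u :: complex and m
    using that by simp
  have din: "u / w \<noteq> 0" if "u \<noteq> 0" "w \<noteq> 0" for u w :: complex
    using that by simp
  have xj: "x j \<noteq> 0" if "j \<in> {i+1..r}" for i j using that x0 by simp
  show ?thesis
    by (intro continuous_intros; (rule ballI)?;
        (rule p | rule q0 | (rule nz x0 b0 xj; assumption) | (intro no_zero_divisors; rule nz(2-); assumption)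
          | (intro no_zero_divisors power_not_zero pin din;
              (rule q0 | (rule nz(1), assumption) | (rule x0 b0 xj, assumption)))))
qed

text \<open>Each condition of \<open>generic\<close> on a confines a failing a, or its square, to a
  multiple of p^Z, and there are countably many such conditions. The condition free of a is provided
  by \<open>sep\<close>.\<close>

lemma countable_not_generic:
  assumes sep: "\<And>i j s t. i \<in> {1..r} \<Longrightarrow> j \<in> {1..r} \<Longrightarrow> i \<noteq> j \<Longrightarrow> 2 * (s + t) \<le> N \<Longrightarrow>
      th (x i * q ^ (3 * s) / (x j * q ^ (3 * t))) \<noteq> 0"
  shows "countable {a. a \<noteq> 0 \<and> \<not> generic a N N}"
proof (rule countable_subset)
  let ?A = "\<Union>i\<in>{1..r}. \<Union>m. \<Union>l. {a. a \<noteq> 0 \<and> th (a * (x i * q ^ m / q ^ l)) = 0}"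
  let ?B = "\<Union>i\<in>{1..r}. \<Union>j\<in>{1..r}. \<Union>m. {a. a \<noteq> 0 \<and> th (a\<^sup>2 * (q ^ (N + 1) * x i * x j * q ^ m)) = 0}"
  show "countable (?A \<union> ?B)"
    using x0 q0 by (intro countable_Un countable_UN countable_theta_zeros_scaled[OF p]
        countable_theta_zeros_square[OF p]) auto
  show "{a. a \<noteq> 0 \<and> \<not> generic a N N} \<subseteq> ?A \<union> ?B"
  proof
    fix a assume a: "a \<in> {a. a \<noteq> 0 \<and> \<not> generic a N N}"
    have e: "a * x i * q ^ m / q ^ l = a * (x i * q ^ m / q ^ l)"
      "a\<^sup>2 * q ^ (N + 1) * x i * x j * q ^ m = a\<^sup>2 * (q ^ (N + 1) * x i * x j * q ^ m)" for i j m l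
      by (simp_all only: mult.assoc times_divide_eq_right)
    from a sep have "(\<exists>i\<in>{1..r}. \<exists>m l. th (a * x i * q ^ m / q ^ l) = 0) \<or>
      (\<exists>i\<in>{1..r}. \<exists>j\<in>{1..r}. \<exists>m. th (a\<^sup>2 * q ^ (N + 1) * x i * x j * q ^ m) = 0)"
      unfolding generic_def by blast
    then show "a \<in> ?A \<union> ?B"
    proof (elim disjE bexE exE)
      fix i m l assume "i \<in> {1..r}" "th (a * x i * q ^ m / q ^ l) = 0"
      then show ?thesis using a unfolding e by (intro UnI1 UN_I[of i] UN_I[of m] UN_I[of l]) auto
    next
      fix i j m
      assume "i \<in> {1..r}" "j \<in> {1..r}" "th (a\<^sup>2 * q ^ (N + 1) * x i * x j * q ^ m) = 0"
      then show ?thesis using a unfolding e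
        by (intro UnI2 UN_I[of i] UN_I[of j] UN_I[of m]) (simp_all del: power_Suc)
    qed
  qed
qed

text \<open>After cancelling the smaller power of q^3, either s = t and a factor of Delta is at
  hand, or a factor of (q^3 x_i/x_j; q^3)_d with d the difference of s and t, possibly with i and j
  exchanged. The bound on s + t keeps d within the range.\<close>

lemma separated:
  assumes D: "Delta r x p \<noteq> 0"
    and E: "\<And>k i j. k \<in> sum_range r N \<Longrightarrow> i \<in> {1..r} \<Longrightarrow> j \<in> {1..r} \<Longrightarrow>
      ell_fact (q^3 * x i / x j) (q^3) p (k i) \<noteq> 0"
    and ij: "i \<in> {1..r}" "j \<in> {1..r}" "i \<noteq> j" and st: "2 * (s + t) \<le> N"
  shows "th (x i * q ^ (3 * s) / (x j * q ^ (3 * t))) \<noteq> 0"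
proof -
  have x: "x i / x j \<noteq> 0" if "i \<in> {1..r}" "j \<in> {1..r}" for i j using x0 that by simp
  have gt: "th (x i * q ^ (3 * d) / x j) \<noteq> 0" if ij: "i \<in> {1..r}" "j \<in> {1..r}" and d: "d > 0" "2 * d \<le> N" for i j d
  proof -
    \<comment> \<open>The tuple concentrated in position i: its denominator contains theta(q^(3d)
      x_i/x_j) as last factor, and it is in the range because 2d <= N.\<close>
    define k where "k = (\<lambda>l\<in>{1..r}. if l = i then d else 0)"
    have "tsum r k = (\<Sum>l\<in>{1..r}. if l = i then d else 0)"
      unfolding tsum_def by (rule sum.cong) (simp_all add: k_def)
    then have "tsum r k = d" using ij by simp
    then have "k \<in> sum_range r N" using d by (simp add: sum_range_def k_def)
    then have "ell_fact (q^3 * x i / x j) (q^3) p (k i) \<noteq> 0" using E ij by blast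
    moreover have "k i = Suc (d - 1)" using ij d by (simp add: k_def)
    ultimately have "th (q^3 * x i / x j * (q^3) ^ (d - 1)) \<noteq> 0" by (simp add: ell_fact_Suc)
    moreover have "q ^ (3 * d) = q ^ 3 * (q ^ 3) ^ (d - 1)"
      using d by (simp add: power_mult flip: power_Suc)
    ultimately show ?thesis by (simp add: mult_ac)
  qed
  have lt: "th (x u / x v) \<noteq> 0" if "u \<in> {1..r}" "v \<in> {1..r}" "u < v" for u v
  proof
    assume "th (x u / x v) = 0"
    then have "\<exists>j\<in>{u+1..r}. x j * th (x u / x j) = 0" using that by (intro bexI[of _ v]) auto
    then have "(\<Prod>j=u+1..r. x j * th (x u / x j)) = 0" by (rule prod_zero[rotated]) simp
    then have "\<exists>i\<in>{1..r}. (\<Prod>j=i+1..r. x j * th (x i / x j)) = 0" using that by blast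
    then have "Delta r x p = 0" unfolding Delta_def by (rule prod_zero[rotated]) simp
    then show False using D by simp
  qed
  have eq: "th (x i / x j) \<noteq> 0"
  proof (cases "i < j")
    case False
    then show ?thesis using lt[of j i] ij theta_nonzero_swap[of "x j" "x i"] x0 by simp
  qed (use lt ij in blast)
  consider "s = t" | d where "d > 0" "s = t + d" | d where "d > 0" "t = s + d"
    by (metis less_imp_add_positive linorder_neqE_nat)
  then show ?thesis
  proof cases
    case 1
    then show ?thesis using eq q0 by simp
  next
    case (2 d)
    have "x i * q ^ (3 * s) / (x j * q ^ (3 * t)) = x i * q ^ (3 * d) / x j"
      using q0 by (simp add: 2 distrib_left power_add)
    then show ?thesis using gt[OF ij(1,2) 2(1)] st 2 by simp
  next
    case (3 d)
    have "x i * q ^ (3 * s) / (x j * q ^ (3 * t)) = x i / (x j * q ^ (3 * d))"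
      using q0 by (simp add: 3 distrib_left power_add)
    moreover have "th (x j * q ^ (3 * d) / x i) \<noteq> 0" using gt[OF ij(2,1) 3(1)] st 3 by simp
    ultimately show ?thesis using theta_nonzero_swap[of "x j * q ^ (3 * d)" "x i"] x0 ij q0 by simp
  qed
qed

text \<open>Only a is varied, with x and b fixed: both sides are continuous on the open set of
  regular values and agree off a countable set.\<close>

lemma summand_sum:
  assumes D: "Delta r x p \<noteq> 0"
    and E: "\<And>k i j. k \<in> sum_range r N \<Longrightarrow> i \<in> {1..r} \<Longrightarrow> j \<in> {1..r} \<Longrightarrow>
      ell_fact (q^3 * x i / x j) (q^3) p (k i) \<noteq> 0"
    and reg: "regular N a"
  shows "(\<Sum>k\<in>sum_range r N. summand a N k) = (\<Prod>i=1..r.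
          ell_fact (a * x i * q) q p N * ell_fact (a * q powi (2 - int N) / b i) (q^3) p N
          / (ell_fact (a * q / b i) q p N
             * ell_fact (a * x i * q powi (2 - int N)) (q^3) p N))" (is "?f a = ?g a")
proof (rule eq_off_countable[where S = "{a. regular N a}" and f = ?f and g = ?g])
  show "countable {a. a \<noteq> 0 \<and> \<not> generic a N N}"
  proof (rule countable_not_generic)
    fix i j s t
    assume ij: "i \<in> {1..r}" "j \<in> {1..r}" "i \<noteq> j" "2 * (s + t) \<le> N"
    show "th (x i * q ^ (3 * s) / (x j * q ^ (3 * t))) \<noteq> 0"
    proof (rule separated[where N = N])
      show "ell_fact (q^3 * x i / x j) (q^3) p (k i) \<noteq> 0"
        if "k \<in> sum_range r N" "i \<in> {1..r}" "j \<in> {1..r}" for k i j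
        using E[OF that] .
    qed (fact D ij)+
  qed
  show "continuous_on {a. regular N a} ?f"
    by (intro continuous_on_sum continuous_summand E)
  fix a assume a: "a \<in> {a. regular N a}" "a \<notin> {a. a \<noteq> 0 \<and> \<not> generic a N N}"
  then have "generic a N N" by (auto simp: regular_def)
  then show "?f a = ?g a"
    by (rule summand_sum_generic) (use a in \<open>simp add: regular_def\<close>)
qed (use reg open_regular continuous_summand_rhs in auto)

end

theorem corollary4p12:
  fixes p q a :: complex and b x :: "nat \<Rightarrow> complex" and r N :: nat
  assumes p: "norm p < 1"
    and q: "q \<noteq> 0" "\<forall>n::nat. n > 0 \<longrightarrow> (\<forall>m::int. q ^ n \<noteq> p powi m)"
    and r: "r \<ge> 1"
    and nonzero: "a \<noteq> 0" "\<forall>i\<in>{1..r}. b i \<noteq> 0" "\<forall>i\<in>{1..r}. x i \<noteq> 0"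
    and generic_lhs:
      "Delta r x p \<noteq> 0"
      "\<forall>i\<in>{1..r}. theta (a * x i) p \<noteq> 0"
      "\<forall>k\<in>sum_range r N. \<forall>i\<in>{1..r}. \<forall>j\<in>{i+1..r}.
         ell_fact (a^2 * x i * x j * q ^ (N + 1)) (q^3) p (k i + k j) \<noteq> 0"
      "\<forall>k\<in>sum_range r N. \<forall>i\<in>{1..r}.
         ell_fact (a * q / b i) q p (tsum r k) \<noteq> 0 \<and>
         ell_fact (b i * q powi (- int N) / a) q p (tsum r k) \<noteq> 0 \<and>
         ell_fact (q powi (int (k i) - int (tsum r k) + int N + 1) * a * x i) q p (2 * k i) \<noteq> 0 \<and>
         ell_fact (a * x i * q powi (2 - int N)) (q^3) p (k i) \<noteq> 0"
      "\<forall>k\<in>sum_range r N. \<forall>i\<in>{1..r}. \<forall>j\<in>{1..r}.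
         ell_fact (q^3 * x i / x j) (q^3) p (k i) \<noteq> 0"
    and generic_rhs:
      "\<forall>i\<in>{1..r}. ell_fact (a * q / b i) q p N \<noteq> 0 \<and>
         ell_fact (a * x i * q powi (2 - int N)) (q^3) p N \<noteq> 0"
  shows
    "(\<Sum>k\<in>sum_range r N.
        Delta r (\<lambda>i. x i * q ^ (3 * k i)) p / Delta r x p
        * q powi (int (tsum r k) - 2 * int (e2 r k))
        * (\<Prod>i=1..r. \<Prod>j=i+1..r.
             1 / ell_fact (a^2 * x i * x j * q ^ (N + 1)) (q^3) p (k i + k j))
        * (\<Prod>i=1..r.
             theta (a * x i * q ^ (tsum r k + 3 * k i)) p / theta (a * x i) p
             * (ell_fact (a * x i) q p (tsum r k)
                * ell_fact (q powi (- int N) / (a * x i)) q p (tsum r k - k i))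
             / (ell_fact (a * q / b i) q p (tsum r k)
                * ell_fact (b i * q powi (- int N) / a) q p (tsum r k)
                * ell_fact (q powi (int (k i) - int (tsum r k) + int N + 1) * a * x i)
                    q p (2 * k i)))
        * (ell_fact (q ^ (N + 1)) q p (tsum r k)
           * ell_fact (q powi (- int N)) q p (2 * tsum r k)
           / (\<Prod>i=1..r. ell_fact (a * x i * q powi (2 - int N)) (q^3) p (k i)))
        * (\<Prod>i=1..r. \<Prod>j=1..r.
             ell_fact (b j * x i) (q^3) p (k i)
             * ell_fact (a^2 * x i * q ^ (N + 1) / b j) (q^3) p (k i)
             / ell_fact (q^3 * x i / x j) (q^3) p (k i)))
     = (\<Prod>i=1..r.
          ell_fact (a * x i * q) q p N * ell_fact (a * q powi (2 - int N) / b i) (q^3) p N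
          / (ell_fact (a * q / b i) q p N
             * ell_fact (a * x i * q powi (2 - int N)) (q^3) p N))"
proof -
  interpret theta_setting p q r x b
  proof
    \<comment> \<open>The hypothesis that q^n avoids p^Z says, by the description of the zeros, that
      theta(q^n) does not vanish.\<close>
    fix n :: nat assume n: "n > 0"
    show "theta (q ^ n) p \<noteq> 0"
      using q n theta_eq_0_iff[OF p, of "q ^ n"] by auto
  qed (use p q nonzero in auto)
  have "regular N a"
    unfolding regular_def using nonzero generic_lhs generic_rhs by blast
  from summand_sum[OF generic_lhs(1) _ this] generic_lhs(5)
  show ?thesis unfolding summand_def by blast
qed

end
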